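(* For any $\nu>0$, consider the generalized Cauchy target $\pi_\nu\propto\exp(-V_\nu)$ on $\mathbb{R}^d$ with $V_\nu(x)=\frac{d+\nu}{2}\ln(1+|x|^2)$. Consider the stable proximal sampler with parameter $\alpha\in(0,2)$, $\alpha\le\nu$, and target $\pi_\nu$, with step size $\eta\in(0,1)$ and initial sample drawn from the standard Gaussian density on $\mathbb{R}^d$. Then the number of iterations required by the sampler to produce an $\varepsilon$-accurate sample in $\chi^2$-divergence is $$\mathcal{O}\big(C_{\mathrm{FPI}(\alpha)}\,\eta^{-1}\log(d/\varepsilon)\big),$$ where $C_{\mathrm{FPI}(\alpha)}$ is the $\alpha$-fractional Poincaré parameter of $\pi_\nu$.
   Context: $\chi^2(\rho|\pi)=\int(\rho/\pi-1)^2\pi\,\mathrm{d}x$; an iterate is $\varepsilon$-accurate if $\chi^2(\mathrm{Law}(x_k)|\pi_\nu)\le\varepsilon$. $\mathcal{O}$ hides constants that may depend on $\nu$ (and $\alpha$). Isotropic $\alpha$-stable density: $p_t^{(\alpha)}(y)=(2\pi)^{-d}\int_{\mathbb{R}^d}e^{-t|\xi|^\alpha}e^{-i\langle\xi,y\rangle}\,\mathrm{d}\xi$ and $p^{(\alpha)}(t;x,y)=p_t^{(\alpha)}(y-x)$. Stable proximal sampler with parameter $\alpha$, step $\eta$, target $\pi^X$: started from $x_0$, at each iteration $k=0,1,\dots$ (i) sample $y_k\mid x_k\sim p^{(\alpha)}(\eta;x_k,\cdot)$; (ii) sample $x_{k+1}\mid y_k$ from the density proportional to $\pi^X(\cdot)\,p^{(\alpha)}(\eta;\cdot,y_k)$.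 Fractional Poincaré inequality: for $\vartheta\in(0,2)$, a probability density $\mu$ satisfies the $\vartheta$-fractional Poincaré inequality with parameter $C_{\mathrm{FPI}(\vartheta)}>0$ if $\mathrm{Var}_\mu(\phi)\le C_{\mathrm{FPI}(\vartheta)}\mathcal{E}_\mu^{(\vartheta)}(\phi)$ for every $\phi:\mathbb{R}^d\to\mathbb{R}$ in the domain of $\mathcal{E}_\mu^{(\vartheta)}$, where $\mathcal{E}_\mu^{(\vartheta)}(\phi)=c_{d,\vartheta}\iint_{\{x\ne y\}}\frac{(\phi(x)-\phi(y))^2}{|x-y|^{d+\vartheta}}\,\mathrm{d}x\,\mu(y)\,\mathrm{d}y$ and $c_{d,\vartheta}=\frac{2^\vartheta\Gamma((d+\vartheta)/2)}{\pi^{d/2}|\Gamma(-\vartheta/2)|}$. It is a known result (Wang and Wang, 2015) that $\pi_\nu$ satisfies the $\alpha$-fractional Poincaré inequality for $\alpha\in(0,2)$ with $\alpha\le\nu$. *)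

theory Defs
  imports "HOL-Probability.Probability"
begin

text \<open>The hidden constant of the theorem does not depend on the dimension \<open>d\<close>, so \<open>d\<close> has to be
  quantified inside the formula. Hence \<open>\<real>\<^sup>d\<close> is carried by the product measure space on
  functions \<open>nat \<Rightarrow> real\<close> indexed by \<open>{..<d}\<close> (undefined outside the index set), not by a type.
  Norm and inner product only look at coordinates below \<open>d\<close>.\<close>

abbreviation leb :: "nat \<Rightarrow> (nat \<Rightarrow> real) measure" where
  "leb d \<equiv> Pi\<^sub>M {..<d} (\<lambda>_. lborel)"

definition enorm :: "nat \<Rightarrow> (nat \<Rightarrow> real) \<Rightarrow> real" where
  "enorm d x = L2_set x {..<d}"

definition einner :: "nat \<Rightarrow> (nat \<Rightarrow> real) \<Rightarrow> (nat \<Rightarrow> real) \<Rightarrow> real" where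
  "einner d x y = (\<Sum>i<d. x i * y i)"

definition prob_normalize :: "'a measure \<Rightarrow> ('a \<Rightarrow> real) \<Rightarrow> 'a \<Rightarrow> real" where
  "prob_normalize M f x = f x / (\<integral>z. f z \<partial>M)"

definition cauchy_potential :: "nat \<Rightarrow> real \<Rightarrow> (nat \<Rightarrow> real) \<Rightarrow> real" where
  "cauchy_potential d \<nu> x = (real d + \<nu>) / 2 * ln (1 + (enorm d x)\<^sup>2)"

definition cauchy_density :: "nat \<Rightarrow> real \<Rightarrow> (nat \<Rightarrow> real) \<Rightarrow> real" where
  "cauchy_density d \<nu> = prob_normalize (leb d) (\<lambda>x. exp (- cauchy_potential d \<nu> x))"

definition gaussian_density :: "nat \<Rightarrow> (nat \<Rightarrow> real) \<Rightarrow> real" where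
  "gaussian_density d x = (2 * pi) powr (- real d / 2) * exp (- (enorm d x)\<^sup>2 / 2)"

text \<open>The Fourier integral is real because its integrand is conjugated by \<open>\<xi> \<mapsto> -\<xi>\<close>;
  \<open>Re\<close> only changes the type.\<close>

definition stable_density :: "nat \<Rightarrow> real \<Rightarrow> real \<Rightarrow> (nat \<Rightarrow> real) \<Rightarrow> real" where
  "stable_density d \<alpha> t y =
     Re (\<integral>\<xi>. complex_of_real (exp (- t * enorm d \<xi> powr \<alpha>))
               * exp (- (\<i> * complex_of_real (einner d \<xi> y))) \<partial>leb d)
     / (2 * pi) ^ d"

definition stable_trans :: "nat \<Rightarrow> real \<Rightarrow> real \<Rightarrow> (nat \<Rightarrow> real) \<Rightarrow> (nat \<Rightarrow> real) \<Rightarrow> real" where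
  "stable_trans d \<alpha> t x y = stable_density d \<alpha> t (\<lambda>i. y i - x i)"

definition forward_kernel ::
  "nat \<Rightarrow> real \<Rightarrow> real \<Rightarrow> (nat \<Rightarrow> real) \<Rightarrow> (nat \<Rightarrow> real) measure" where
  "forward_kernel d \<alpha> \<eta> x = density (leb d) (\<lambda>y. ennreal (stable_trans d \<alpha> \<eta> x y))"

definition backward_kernel ::
  "nat \<Rightarrow> real \<Rightarrow> real \<Rightarrow> ((nat \<Rightarrow> real) \<Rightarrow> real) \<Rightarrow> (nat \<Rightarrow> real) \<Rightarrow> (nat \<Rightarrow> real) measure" where
  "backward_kernel d \<alpha> \<eta> p y =
     density (leb d)
       (\<lambda>x. ennreal (prob_normalize (leb d) (\<lambda>z. p z * stable_trans d \<alpha> \<eta> z y) x))"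

primrec sampler_law ::
  "nat \<Rightarrow> real \<Rightarrow> real \<Rightarrow> ((nat \<Rightarrow> real) \<Rightarrow> real) \<Rightarrow> (nat \<Rightarrow> real) measure \<Rightarrow> nat
     \<Rightarrow> (nat \<Rightarrow> real) measure" where
  "sampler_law d \<alpha> \<eta> p \<mu>0 0 = \<mu>0"
| "sampler_law d \<alpha> \<eta> p \<mu>0 (Suc k) =
     Giry_Monad.bind (Giry_Monad.bind (sampler_law d \<alpha> \<eta> p \<mu>0 k) (forward_kernel d \<alpha> \<eta>))
       (backward_kernel d \<alpha> \<eta> p)"

text \<open>Extended-valued, so that an infinite divergence is never small.\<close>

definition chi_square :: "'a measure \<Rightarrow> ('a \<Rightarrow> real) \<Rightarrow> ('a \<Rightarrow> real) \<Rightarrow> ennreal" where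
  "chi_square M \<rho> p = (\<integral>\<^sup>+x. ennreal ((\<rho> x / p x - 1)\<^sup>2 * p x) \<partial>M)"

text \<open>The density \<open>\<rho>\<close> of the law is unique almost everywhere, so the divergence does not depend on
  its choice; laws without a density are not accurate.\<close>

definition chi_square_accurate ::
  "'a measure \<Rightarrow> real \<Rightarrow> 'a measure \<Rightarrow> ('a \<Rightarrow> real) \<Rightarrow> bool" where
  "chi_square_accurate M \<epsilon> L p \<longleftrightarrow>
     (\<exists>\<rho>. \<rho> \<in> borel_measurable M \<and> (\<forall>x. 0 \<le> \<rho> x) \<and> L = density M (\<lambda>x. ennreal (\<rho> x))
          \<and> chi_square M \<rho> p \<le> ennreal \<epsilon>)"

definition frac_const :: "nat \<Rightarrow> real \<Rightarrow> real" where
  "frac_const d \<theta> =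
     2 powr \<theta> * Gamma ((real d + \<theta>) / 2) / (pi powr (real d / 2) * \<bar>Gamma (- \<theta> / 2)\<bar>)"

definition frac_energy ::
  "nat \<Rightarrow> real \<Rightarrow> ((nat \<Rightarrow> real) \<Rightarrow> real) \<Rightarrow> ((nat \<Rightarrow> real) \<Rightarrow> real) \<Rightarrow> ennreal" where
  "frac_energy d \<theta> \<mu> \<phi> =
     ennreal (frac_const d \<theta>) *
     (\<integral>\<^sup>+y. (\<integral>\<^sup>+x. ennreal ((\<phi> x - \<phi> y)\<^sup>2 / enorm d (\<lambda>i. x i - y i) powr (real d + \<theta>))
                  * indicator {z. z \<noteq> y} x \<partial>leb d)
            * ennreal (\<mu> y) \<partial>leb d)"

text \<open>The domain of the Dirichlet form: square-integrable functions of finite energy.\<close>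

definition frac_domain ::
  "nat \<Rightarrow> real \<Rightarrow> ((nat \<Rightarrow> real) \<Rightarrow> real) \<Rightarrow> ((nat \<Rightarrow> real) \<Rightarrow> real) set" where
  "frac_domain d \<theta> \<mu> =
     {\<phi> \<in> borel_measurable (leb d).
        integrable (density (leb d) (\<lambda>x. ennreal (\<mu> x))) (\<lambda>x. (\<phi> x)\<^sup>2) \<and> frac_energy d \<theta> \<mu> \<phi> < \<infinity>}"

definition fractional_poincare ::
  "nat \<Rightarrow> real \<Rightarrow> ((nat \<Rightarrow> real) \<Rightarrow> real) \<Rightarrow> real \<Rightarrow> bool" where
  "fractional_poincare d \<theta> \<mu> C \<longleftrightarrow>
     0 < C \<and>
     (\<forall>\<phi> \<in> frac_domain d \<theta> \<mu>.
        ennreal (prob_space.variance (density (leb d) (\<lambda>x. ennreal (\<mu> x))) \<phi>)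
          \<le> ennreal C * frac_energy d \<theta> \<mu> \<phi>)"

end

theory Submission
  imports Defs "HOL-Real_Asymp.Real_Asymp"
begin

text \<open>Let \<open>p\<^sub>t\<close> be the stable density and \<open>P\<^sub>t\<close> its semigroup. If \<open>X\<close> is a sum of \<open>n\<close> independent increments with law
  \<open>p\<^sub>\<eta>\<^sub>/\<^sub>n\<close>, projecting \<open>g(X)\<close> onto functions of single increments gives
  \<open>Var(g(X)) \<ge> n Var(P g(X\<^sub>1))\<close> with \<open>P = P\<^sub>\<eta>\<^sub>-\<^sub>\<eta>\<^sub>/\<^sub>n\<close>. Since \<open>p\<^sub>t(z) / t\<close> tends to
  \<open>c \<bar>z\<bar>\<^sup>-\<^sup>d\<^sup>-\<^sup>\<alpha>\<close> as \<open>t\<close> tends to \<open>0\<close>, Fatou's lemma turns this into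
  \<open>\<eta> \<Gamma>(P\<^sub>\<eta> g) \<le> P\<^sub>\<eta>(g\<^sup>2) - (P\<^sub>\<eta> g)\<^sup>2\<close>, where \<open>\<Gamma>\<close> is the square field of the fractional energy. Integrating against the
  target and inserting the fractional Poincare inequality shows that the backward step of the sampler divides
  the chi-square divergence by at least \<open>1 + \<eta> / C\<close>, while the forward step does not increase it by the
  Cauchy-Schwarz inequality. The initial divergence is at most linear in the dimension, and \<open>C\<close> is bounded below
  uniformly in the dimension, as the test function \<open>sin x\<^sub>1\<close> shows.

  Positivity and the asymptotics of \<open>p\<^sub>t\<close> are read off from Gaussian mixtures that converge to it.\<close>

section \<open>Lebesgue measure and Gaussian integrals\<close>

text \<open>The stable density is given only as an oscillatory integral, from which neither its
  sign, nor its integrability, nor its tail can be read. Each needs its own device: Gaussian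
  mixtures for the sign, Gaussian damping for the mass, and a polynomial approximation carried
  through the mixtures for the tail. Discrete mixtures and integer Laplace arguments stand in for a
  limiting subordinator, so that only numerical sequences have to converge. The divergence is never
  differentiated along a flow. The reverse inequality compares finite quantities for bounded
  measurable functions, and it also shows that \<open>Q \<eta> g\<close> has finite energy, which is
  what admits it to the Poincare inequality. For Fatou's lemma the limit of \<open>p t z / t\<close>
  at each single \<open>z\<close> is enough. Unbounded density ratios enter by truncation.
  Divergences are carried as second moments, which equal one plus the divergence, so that extended
  reals are never subtracted.\<close>

lemma product_sigma_finite_lborel: "product_sigma_finite (\<lambda>_::nat. lborel :: real measure)"
  by (simp add: product_sigma_finite_def sigma_finite_lborel)

interpretation lebI: product_sigma_finite "\<lambda>_::nat. lborel :: real measure"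
  by (rule product_sigma_finite_lborel)

lemma sigma_finite_leb: "sigma_finite_measure (leb d)"
  by (rule lebI.sigma_finite) simp

interpretation leb: sigma_finite_measure "leb d" for d
  by (rule sigma_finite_leb)

interpretation leb_pair: pair_sigma_finite "leb d" "leb d" for d
  by (simp add: pair_sigma_finite_def sigma_finite_leb)

text \<open>The restriction to \<open>{..<d}\<close> keeps the image a point of
  \<open>leb d\<close>. Bare differences such as \<open>\<lambda>i. y i - x i\<close> leave that
  space, which is why congruence on the first \<open>d\<close> coordinates is invoked
  throughout.\<close>

definition affine_map :: "nat \<Rightarrow> (nat \<Rightarrow> real) \<Rightarrow> real \<Rightarrow> (nat \<Rightarrow> real) \<Rightarrow> nat \<Rightarrow> real" where
  "affine_map d b c x = (\<lambda>i\<in>{..<d}. b i + c * x i)"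

lemma measurable_affine [measurable]: "affine_map d b c \<in> measurable (leb d) (leb d)"
  unfolding affine_map_def by measurable

text \<open>Boxes determine the product measure, and a coordinatewise affine map pulls boxes back to
  boxes, so everything reduces to one-dimensional scaling. Later uses are translation
  (\<open>c = 1\<close>), reflection (\<open>c = -1\<close>) and the rescaling of a
  Gaussian.\<close>

lemma distr_affine:
  assumes "c \<noteq> 0"
  shows "density (distr (leb d) (leb d) (affine_map d b c)) (\<lambda>_. ennreal (\<bar>c\<bar> ^ d)) = leb d"
proof (rule lebI.PiM_eqI)
  show "finite {..<d}" by simp
  show "sets (density (distr (leb d) (leb d) (affine_map d b c)) (\<lambda>_. ennreal (\<bar>c\<bar> ^ d))) = sets (leb d)" by simp
  fix A :: "nat \<Rightarrow> real set" assume A: "\<And>i. i \<in> {..<d} \<Longrightarrow> A i \<in> sets lborel"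
  have A': "Pi\<^sub>E {..<d} A \<in> sets (leb d)" using A by (intro sets_PiM_I_finite) auto
  define B where "B i = (\<lambda>t. b i + c * t) -` A i" for i
  have B: "B i \<in> sets lborel" if "i \<in> {..<d}" for i
  proof -
    have [measurable]: "A i \<in> sets borel" using A that by simp
    show ?thesis unfolding B_def
    proof -
      have "(\<lambda>t. b i + c * t) \<in> borel_measurable lborel" by measurable
      then have "(\<lambda>t. b i + c * t) -` A i \<inter> space lborel \<in> sets lborel"
        by (rule measurable_sets) fact
      then show "(\<lambda>t. b i + c * t) -` A i \<in> sets lborel" by (simp only: space_lborel space_borel Int_UNIV_right)
    qed
  qed
  have vimage: "affine_map d b c -` Pi\<^sub>E {..<d} A \<inter> space (leb d) = Pi\<^sub>E {..<d} B"
  proof (intro set_eqI)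
    fix x
    have "affine_map d b c x \<in> Pi\<^sub>E {..<d} A \<longleftrightarrow> (\<forall>i<d. b i + c * x i \<in> A i)"
      by (simp add: affine_map_def PiE_iff Ball_def)
    moreover have "x \<in> space (leb d) \<longleftrightarrow> x \<in> extensional {..<d}" by (simp add: space_PiM PiE_iff)
    moreover have "x \<in> Pi\<^sub>E {..<d} B \<longleftrightarrow> x \<in> extensional {..<d} \<and> (\<forall>i<d. b i + c * x i \<in> A i)"
      by (simp add: B_def PiE_iff Ball_def conj_commute)
    ultimately show "x \<in> affine_map d b c -` Pi\<^sub>E {..<d} A \<inter> space (leb d) \<longleftrightarrow> x \<in> Pi\<^sub>E {..<d} B" by blast
  qed
  have AB: "emeasure lborel (A i) = ennreal \<bar>c\<bar> * emeasure lborel (B i)" if "i \<in> {..<d}" for i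
  proof -
    have [measurable]: "A i \<in> sets borel" using A that by simp
    have "emeasure lborel (A i) = (\<integral>\<^sup>+x. indicator (A i) x \<partial>lborel)" by simp
    also have "\<dots> = ennreal \<bar>c\<bar> * (\<integral>\<^sup>+x. indicator (A i) (b i + c * x) \<partial>lborel)"
      using assms by (intro nn_integral_real_affine) auto
    also have "(\<lambda>x. indicator (A i) (b i + c * x) :: ennreal) = indicator (B i)"
      by (auto simp: B_def indicator_def fun_eq_iff)
    finally show ?thesis using B[OF that] by simp
  qed
  have "emeasure (density (distr (leb d) (leb d) (affine_map d b c)) (\<lambda>_. ennreal (\<bar>c\<bar> ^ d))) (Pi\<^sub>E {..<d} A)
      = ennreal (\<bar>c\<bar> ^ d) * emeasure (distr (leb d) (leb d) (affine_map d b c)) (Pi\<^sub>E {..<d} A)"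
    using A' by (subst emeasure_density_const) auto
  also have "\<dots> = ennreal (\<bar>c\<bar> ^ d) * emeasure (leb d) (Pi\<^sub>E {..<d} B)"
    using A' by (subst emeasure_distr) (auto simp: vimage)
  also have "\<dots> = ennreal \<bar>c\<bar> ^ d * (\<Prod>i<d. emeasure lborel (B i))"
    using B by (subst lebI.emeasure_PiM) (auto simp: ennreal_power)
  also have "\<dots> = (\<Prod>i<d. ennreal \<bar>c\<bar> * emeasure lborel (B i))"
    by (simp add: prod.distrib)
  also have "\<dots> = (\<Prod>i<d. emeasure lborel (A i))" using AB by (intro prod.cong) auto
  finally show "emeasure (density (distr (leb d) (leb d) (affine_map d b c)) (\<lambda>_. ennreal (\<bar>c\<bar> ^ d))) (Pi\<^sub>E {..<d} A)
     = (\<Prod>i<d. emeasure lborel (A i))" .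
qed

lemma nn_integral_affine:
  assumes "c \<noteq> 0" and [measurable]: "f \<in> borel_measurable (leb d)"
  shows "(\<integral>\<^sup>+x. f x \<partial>leb d) = ennreal (\<bar>c\<bar> ^ d) * (\<integral>\<^sup>+x. f (affine_map d b c x) \<partial>leb d)"
proof -
  have "(\<integral>\<^sup>+x. f x \<partial>leb d) = (\<integral>\<^sup>+x. f x \<partial>density (distr (leb d) (leb d) (affine_map d b c)) (\<lambda>_. ennreal (\<bar>c\<bar> ^ d)))"
    by (subst distr_affine[OF assms(1)]) simp
  also have "\<dots> = ennreal (\<bar>c\<bar> ^ d) * (\<integral>\<^sup>+x. f (affine_map d b c x) \<partial>leb d)"
    by (simp add: nn_integral_density nn_integral_cmult nn_integral_distr)
  finally show ?thesis .
qed

lemma integral_affine: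
  fixes f :: "(nat \<Rightarrow> real) \<Rightarrow> real"
  assumes "c \<noteq> 0" and [measurable]: "f \<in> borel_measurable (leb d)"
  shows "(\<integral>x. f x \<partial>leb d) = \<bar>c\<bar> ^ d * (\<integral>x. f (affine_map d b c x) \<partial>leb d)"
proof -
  have "(\<integral>x. f x \<partial>leb d) = (\<integral>x. f x \<partial>density (distr (leb d) (leb d) (affine_map d b c)) (\<lambda>_. ennreal (\<bar>c\<bar> ^ d)))"
    by (subst distr_affine[OF assms(1)]) simp
  also have "\<dots> = \<bar>c\<bar> ^ d * (\<integral>x. f (affine_map d b c x) \<partial>leb d)"
    by (subst integral_real_density) (auto simp: integral_distr)
  finally show ?thesis .
qed

lemma integrable_affine_iff:
  fixes f :: "(nat \<Rightarrow> real) \<Rightarrow> real"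
  assumes "c \<noteq> 0" and [measurable]: "f \<in> borel_measurable (leb d)"
  shows "integrable (leb d) (\<lambda>x. f (affine_map d b c x)) \<longleftrightarrow> integrable (leb d) f"
proof -
  have "integrable (leb d) f \<longleftrightarrow> integrable (density (distr (leb d) (leb d) (affine_map d b c)) (\<lambda>_. ennreal (\<bar>c\<bar> ^ d))) f"
    by (subst distr_affine[OF assms(1)]) simp
  also have "\<dots> \<longleftrightarrow> integrable (leb d) (\<lambda>x. f (affine_map d b c x))"
    using assms(1) by (subst integrable_real_density) (auto simp: integrable_distr_eq)
  finally show ?thesis ..
qed

lemma measurable_enorm [measurable]: "enorm d \<in> borel_measurable (leb d)"
  unfolding enorm_def L2_set_def by measurable

lemma measurable_component_leb:
  "i < d \<Longrightarrow> (\<lambda>x. x i) \<in> borel_measurable (leb d)"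
  by measurable

lemma measurable_diff_leb:
  assumes "f \<in> measurable M (leb d)" "g \<in> measurable M (leb d)" "i < d"
  shows "(\<lambda>x. f x i - g x i) \<in> borel_measurable M"
proof -
  have "(\<lambda>x. f x i) \<in> borel_measurable M" "(\<lambda>x. g x i) \<in> borel_measurable M"
    using measurable_compose[OF assms(1) measurable_component_leb[OF assms(3)]]
     measurable_compose[OF assms(2) measurable_component_leb[OF assms(3)]] by auto
  then show ?thesis by measurable
qed

lemma measurable_einner [measurable (raw)]:
  assumes "f \<in> measurable M (leb d)" "g \<in> measurable M (leb d)"
  shows "(\<lambda>x. einner d (f x) (g x)) \<in> borel_measurable M"
proof -
  have "(\<lambda>x. f x i) \<in> borel_measurable M" "(\<lambda>x. g x i) \<in> borel_measurable M" if "i \<in> {..<d}" for i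
    using measurable_compose[OF assms(1) measurable_component_leb]
     measurable_compose[OF assms(2) measurable_component_leb] that by auto
  then show ?thesis unfolding einner_def by measurable
qed

lemma enorm_sq: "(enorm d x)\<^sup>2 = (\<Sum>i<d. (x i)\<^sup>2)"
  by (simp add: enorm_def L2_set_def sum_nonneg)

lemma enorm_nonneg [simp]: "0 \<le> enorm d x"
  by (simp add: enorm_def)

lemma enorm_cong: "(\<And>i. i < d \<Longrightarrow> x i = y i) \<Longrightarrow> enorm d x = enorm d y"
  by (auto simp: enorm_def intro!: L2_set_cong)

lemma einner_cong: "(\<And>i. i < d \<Longrightarrow> x i = x' i) \<Longrightarrow> (\<And>i. i < d \<Longrightarrow> y i = y' i) \<Longrightarrow> einner d x y = einner d x' y'"
  by (auto simp: einner_def intro!: sum.cong)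

lemma einner_commute: "einner d x y = einner d y x"
  by (simp add: einner_def mult.commute)

lemma enorm_eq_0: "enorm d x = 0 \<longleftrightarrow> (\<forall>i<d. x i = 0)"
  by (auto simp: enorm_def L2_set_eq_0_iff)

section \<open>Fourier transforms of Gaussians\<close>

lemma gauss_1d:
  fixes u t :: real
  assumes "u > 0"
  shows "integrable lborel (\<lambda>x::real. complex_of_real (exp (- u * x\<^sup>2)) * exp (- (\<i> * complex_of_real (x * t))))"
    and "(\<integral>x. complex_of_real (exp (- u * x\<^sup>2)) * exp (- (\<i> * complex_of_real (x * t))) \<partial>lborel)
      = complex_of_real (sqrt (pi / u) * exp (- t\<^sup>2 / (4 * u)))"
proof -
  \<comment> \<open>The scale at which \<open>exp (- u * x\<^sup>2)\<close> becomes the standard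
    normal density up to the factor \<open>sqrt (2 * pi)\<close>; the value is then the known
    characteristic function at \<open>- s * t\<close>.\<close>
  define s where "s = 1 / sqrt (2 * u)"
  have s: "s > 0" "s\<^sup>2 = 1 / (2 * u)" using assms by (auto simp: s_def power_divide)
  define f where "f x = complex_of_real (exp (- u * x\<^sup>2)) * exp (- (\<i> * complex_of_real (x * t)))" for x :: real
  have f: "f (0 + s * x) = complex_of_real (sqrt (2 * pi)) * (std_normal_density x *\<^sub>R iexp ((- s * t) * x))" for x
  proof -
    have "- u * (s * x)\<^sup>2 = - x\<^sup>2 / 2" using assms by (simp add: power_mult_distrib s)
    then show ?thesis
      by (simp add: f_def std_normal_density_def scaleR_conv_of_real mult_ac)
  qed
  have char: "(\<integral>x. std_normal_density x *\<^sub>R iexp ((- s * t) * x) \<partial>lborel) = complex_of_real (exp (- (s * t)\<^sup>2 / 2))"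
    using fun_cong[OF char_std_normal_distribution, of "- s * t"]
    unfolding char_def by (subst (asm) integral_density) auto
  have int: "integrable lborel (\<lambda>x. std_normal_density x *\<^sub>R iexp ((- s * t) * x))"
    by (rule Bochner_Integration.integrable_bound[OF integrable_normal_density[of 1 0]]) (auto)
  have "integrable lborel (\<lambda>x. f (0 + s * x))" unfolding f
    by (rule integrable_mult_right[OF int])
  then show "integrable lborel f"
    using lborel_integrable_real_affine_iff[of s f 0] s by auto
  have "(\<integral>x. f x \<partial>lborel) = \<bar>s\<bar> *\<^sub>R (\<integral>x. f (0 + s * x) \<partial>lborel)"
    using s by (intro lborel_integral_real_affine) auto
  also have "\<dots> = complex_of_real (s * sqrt (2 * pi)) * complex_of_real (exp (- (s * t)\<^sup>2 / 2))"
    unfolding f using s(1) char by (simp add: scaleR_conv_of_real)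
  also have "s * sqrt (2 * pi) = sqrt (pi / u)"
  proof -
    have "1 / sqrt (2 * u) * sqrt (2 * pi) = sqrt ((2 * pi) / (2 * u))"
      unfolding real_sqrt_divide by simp
    then show ?thesis by (simp add: s_def)
  qed
  also have "- (s * t)\<^sup>2 / 2 = - t\<^sup>2 / (4 * u)"
    by (simp add: power_mult_distrib s)
  finally show "(\<integral>x. f x \<partial>lborel) = complex_of_real (sqrt (pi / u) * exp (- t\<^sup>2 / (4 * u)))" by simp
qed

text \<open>The complex exponential, unlike the cosine, factorises over coordinates, so the product
  formula for integrals applies; the real form is extracted afterwards.\<close>

lemma gauss_complex:
  assumes "u > 0"
  shows "integrable (leb d) (\<lambda>x. complex_of_real (exp (- u * (enorm d x)\<^sup>2)) * exp (- (\<i> * complex_of_real (einner d x y))))"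
    and "(\<integral>x. complex_of_real (exp (- u * (enorm d x)\<^sup>2)) * exp (- (\<i> * complex_of_real (einner d x y))) \<partial>leb d)
      = complex_of_real ((pi / u) powr (real d / 2) * exp (- (enorm d y)\<^sup>2 / (4 * u)))"
proof -
  define f where "f i x = complex_of_real (exp (- u * x\<^sup>2)) * exp (- (\<i> * complex_of_real (x * y i)))" for i and x :: real
  have prod: "complex_of_real (exp (- u * (enorm d x)\<^sup>2)) * exp (- (\<i> * complex_of_real (einner d x y)))
     = (\<Prod>i<d. f i (x i))" for x
  proof -
    have "(\<Prod>i<d. f i (x i)) = complex_of_real (\<Prod>i<d. exp (- u * (x i)\<^sup>2)) * (\<Prod>i<d. exp (- (\<i> * complex_of_real (x i * y i))))"
      unfolding f_def by (simp only: prod.distrib of_real_prod)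
    also have "(\<Prod>i<d. exp (- u * (x i)\<^sup>2)) = exp (\<Sum>i<d. - u * (x i)\<^sup>2)"
      by (rule exp_sum[symmetric]) simp
    also have "(\<Sum>i<d. - u * (x i)\<^sup>2) = - u * (enorm d x)\<^sup>2" by (simp only: enorm_sq sum_distrib_left)
    also have "(\<Prod>i<d. exp (- (\<i> * complex_of_real (x i * y i)))) = exp (\<Sum>i<d. - (\<i> * complex_of_real (x i * y i)))"
      by (rule exp_sum[symmetric]) simp
    also have "(\<Sum>i<d. - (\<i> * complex_of_real (x i * y i))) = - (\<i> * complex_of_real (einner d x y))"
      unfolding einner_def by (simp only: sum_negf sum_distrib_left of_real_sum)
    finally show ?thesis by simp
  qed
  show "integrable (leb d) (\<lambda>x. complex_of_real (exp (- u * (enorm d x)\<^sup>2)) * exp (- (\<i> * complex_of_real (einner d x y))))"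
    unfolding prod using gauss_1d(1)[OF assms] by (intro lebI.product_integrable_prod) (auto simp: f_def)
  have "(\<integral>x. (\<Prod>i<d. f i (x i)) \<partial>leb d) = (\<Prod>i<d. integral\<^sup>L lborel (f i))"
    using gauss_1d(1)[OF assms] by (intro lebI.product_integral_prod) (auto simp: f_def)
  also have "\<dots> = complex_of_real (\<Prod>i<d. sqrt (pi / u) * exp (- (y i)\<^sup>2 / (4 * u)))"
    unfolding f_def using gauss_1d(2)[OF assms] by simp
  also have "(\<Prod>i<d. sqrt (pi / u) * exp (- (y i)\<^sup>2 / (4 * u))) = (pi / u) powr (real d / 2) * exp (- (enorm d y)\<^sup>2 / (4 * u))"
  proof -
    have "(\<Prod>i<d. sqrt (pi / u) * exp (- (y i)\<^sup>2 / (4 * u))) = sqrt (pi / u) ^ d * (\<Prod>i<d. exp (- (y i)\<^sup>2 / (4 * u)))"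
      by (simp only: prod.distrib prod_constant card_lessThan)
    also have "(\<Prod>i<d. exp (- (y i)\<^sup>2 / (4 * u))) = exp (\<Sum>i<d. - (y i)\<^sup>2 / (4 * u))"
      by (rule exp_sum[symmetric]) simp
    also have "(\<Sum>i<d. - (y i)\<^sup>2 / (4 * u)) = - (enorm d y)\<^sup>2 / (4 * u)"
      by (simp add: enorm_sq sum_divide_distrib sum_negf)
    also have "sqrt (pi / u) ^ d = (pi / u) powr (real d / 2)"
    proof -
      have "sqrt (pi / u) ^ d = sqrt (pi / u) powr real d" using assms by (simp add: powr_realpow)
      moreover have "sqrt (pi / u) = (pi / u) powr (1 / 2)" using assms by (simp add: powr_half_sqrt)
      ultimately show ?thesis by (simp only: powr_powr) simp
    qed
    finally show ?thesis .
  qed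
  finally show "(\<integral>x. complex_of_real (exp (- u * (enorm d x)\<^sup>2)) * exp (- (\<i> * complex_of_real (einner d x y))) \<partial>leb d)
      = complex_of_real ((pi / u) powr (real d / 2) * exp (- (enorm d y)\<^sup>2 / (4 * u)))"
    unfolding prod .
qed

lemma gauss_cos:
  assumes "u > 0"
  shows "integrable (leb d) (\<lambda>x. exp (- u * (enorm d x)\<^sup>2))"
    and "(\<integral>x. exp (- u * (enorm d x)\<^sup>2) * cos (einner d x y) \<partial>leb d)
      = (pi / u) powr (real d / 2) * exp (- (enorm d y)\<^sup>2 / (4 * u))"
    and "(\<integral>x. exp (- u * (enorm d x)\<^sup>2) \<partial>leb d) = (pi / u) powr (real d / 2)"
proof -
  have re: "Re (complex_of_real a * exp (- (\<i> * complex_of_real b))) = a * cos b" for a b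
    by (simp add: Re_exp)
  have c: "(\<integral>x. exp (- u * (enorm d x)\<^sup>2) * cos (einner d x y) \<partial>leb d)
      = (pi / u) powr (real d / 2) * exp (- (enorm d y)\<^sup>2 / (4 * u))" for y
    using arg_cong[OF gauss_complex(2)[OF assms, of d y], of Re]
    by (subst (asm) integral_Re[symmetric, OF gauss_complex(1)[OF assms]]) (simp only: re Re_complex_of_real)
  then show "(\<integral>x. exp (- u * (enorm d x)\<^sup>2) * cos (einner d x y) \<partial>leb d)
      = (pi / u) powr (real d / 2) * exp (- (enorm d y)\<^sup>2 / (4 * u))" .
  have "integrable (leb d) (\<lambda>x. Re (complex_of_real (exp (- u * (enorm d x)\<^sup>2)) * exp (- (\<i> * complex_of_real (einner d x (\<lambda>_. 0))))))"
    by (intro integrable_Re gauss_complex(1) assms)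
  then show "integrable (leb d) (\<lambda>x. exp (- u * (enorm d x)\<^sup>2))"
    unfolding re by (simp add: einner_def)
  show "(\<integral>x. exp (- u * (enorm d x)\<^sup>2) \<partial>leb d) = (pi / u) powr (real d / 2)"
    using c[of "\<lambda>_. 0"] by (simp add: einner_def enorm_sq)
qed

section \<open>Gamma integrals and Gaussian mixtures\<close>

text \<open>Substitution \<open>u \<mapsto> v * u\<close> in the Gamma integral. Read backwards it
  presents \<open>v powr (- s)\<close> as a mixture of exponentials in \<open>v\<close>, which later
  turns the Cauchy weight into a mixture of Gaussians.\<close>

lemma nn_integral_Gamma_scaled:
  fixes s v :: real
  assumes "s > 0" "v > 0"
  shows "(\<integral>\<^sup>+u. ennreal (indicator {0<..} u * u powr (s - 1) * exp (- v * u)) \<partial>lborel) = ennreal (Gamma s * v powr (- s))"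
proof -
  have "ennreal (Gamma s) = (\<integral>\<^sup>+u. ennreal (indicator {0..} u * u powr (s - 1) / exp u) \<partial>lborel)"
    by (rule Gamma_conv_nn_integral_real[OF assms(1)])
  also have "\<dots> = ennreal \<bar>v\<bar> * (\<integral>\<^sup>+u. ennreal (indicator {0..} (0 + v * u) * (0 + v * u) powr (s - 1) / exp (0 + v * u)) \<partial>lborel)"
    using assms by (intro nn_integral_real_affine) auto
  also have "(\<lambda>u. ennreal (indicator {0..} (0 + v * u) * (0 + v * u) powr (s - 1) / exp (0 + v * u)))
    = (\<lambda>u. ennreal (v powr (s - 1)) * ennreal (indicator {0<..} u * u powr (s - 1) * exp (- v * u)))"
    using assms by (auto simp: fun_eq_iff indicator_def zero_le_mult_iff ennreal_mult[symmetric] powr_mult exp_minus divide_simps)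
  also have "ennreal \<bar>v\<bar> * (\<integral>\<^sup>+u. ennreal (v powr (s - 1)) * ennreal (indicator {0<..} u * u powr (s - 1) * exp (- v * u)) \<partial>lborel)
    = ennreal (v powr s) * (\<integral>\<^sup>+u. ennreal (indicator {0<..} u * u powr (s - 1) * exp (- v * u)) \<partial>lborel)" (is "_ = _ * ?I")
  proof -
    have "v * v powr (s - 1) = v powr s" using assms powr_mult_base[of v "s - 1"] by simp
    then have "ennreal \<bar>v\<bar> * ennreal (v powr (s - 1)) = ennreal (v powr s)"
      using assms by (simp add: ennreal_mult[symmetric])
    moreover have "(\<integral>\<^sup>+u. ennreal (v powr (s - 1)) * ennreal (indicator {0<..} u * u powr (s - 1) * exp (- v * u)) \<partial>lborel)
      = ennreal (v powr (s - 1)) * ?I" by (rule nn_integral_cmult) simp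
    ultimately show ?thesis by (simp only: mult.assoc[symmetric])
  qed
  finally have eq: "ennreal (Gamma s) = ennreal (v powr s) * ?I" .
  have "?I = ennreal (v powr (-s)) * (ennreal (v powr s) * ?I)"
    using assms by (simp add: mult.assoc[symmetric] ennreal_mult[symmetric] powr_add[symmetric])
  then show ?thesis
    using assms Gamma_real_pos[of s] unfolding eq[symmetric] by (simp add: ennreal_mult[symmetric] mult.commute)
qed

lemma nn_integral_powr_from_0:
  fixes b c :: real
  assumes "b > 0" "c \<ge> 0"
  shows "(\<integral>\<^sup>+v. ennreal (indicator {0..c} v * v powr (b - 1)) \<partial>lborel) = ennreal (c powr b / b)"
  using nn_integral_has_integral_lebesgue[OF _ has_integral_powr_from_0[of "b - 1" c]] assms by simp

text \<open>Writing \<open>1 - exp (- l * u)\<close> as the integral of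
  \<open>u * exp (- v * u)\<close> over \<open>v\<close> in \<open>{0..l}\<close> and exchanging the
  integrals leaves a Gamma integral and then a power. The formula says that
  \<open>u powr (- 1 - b)\<close> is, up to a constant, the Levy measure of the positive stable
  subordinator with exponent \<open>l powr b\<close>.\<close>

lemma nn_integral_levy:
  fixes b l :: real
  assumes "0 < b" "b < 1" "l \<ge> 0"
  shows "(\<integral>\<^sup>+u. ennreal (indicator {0<..} u * (1 - exp (- l * u)) * u powr (- 1 - b)) \<partial>lborel) = ennreal (l powr b * Gamma (1 - b) / b)"
proof -
  have inner: "ennreal (indicator {0<..} u * (1 - exp (- l * u)) * u powr (- 1 - b)) =
     (\<integral>\<^sup>+v. ennreal (indicator {0..l} v * (indicator {0<..} u * u powr (1 - b - 1) * exp (- v * u))) \<partial>lborel)" for u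
  proof (cases "u > 0")
    case True
    have "(\<integral>\<^sup>+v. ennreal (u * exp (- v * u)) * indicator {0..l} v \<partial>lborel) = ennreal ((- exp (- l * u)) - (- exp (- 0 * u)))"
      using True assms by (intro nn_integral_FTC_Icc) (auto intro!: derivative_eq_intros)
    then have *: "(\<integral>\<^sup>+v. ennreal (u * exp (- v * u)) * indicator {0..l} v \<partial>lborel) = ennreal (1 - exp (- l * u))" by simp
    have "(\<integral>\<^sup>+v. ennreal (indicator {0..l} v * (indicator {0<..} u * u powr (1 - b - 1) * exp (- v * u))) \<partial>lborel)
      = (\<integral>\<^sup>+v. ennreal (u powr (-1 - b)) * (ennreal (u * exp (- v * u)) * indicator {0..l} v) \<partial>lborel)"
    proof (intro nn_integral_cong)
      fix v :: real
      have "u powr (1 - b - 1) = u powr (-1 - b) * u"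
        using True powr_add[of u "-1 - b" 1] by (simp add: powr_one)
      then show "ennreal (indicator {0..l} v * (indicator {0<..} u * u powr (1 - b - 1) * exp (- v * u))) =
        ennreal (u powr (-1 - b)) * (ennreal (u * exp (- v * u)) * indicator {0..l} v)"
        using True by (auto simp: indicator_def ennreal_mult[symmetric] mult_ac)
    qed
    also have "\<dots> = ennreal (u powr (-1 - b)) * ennreal (1 - exp (- l * u))"
      by (subst nn_integral_cmult) (simp, simp only: *)
    finally show ?thesis using True assms by (simp add: ennreal_mult[symmetric] mult.commute)
  qed simp
  have "(\<integral>\<^sup>+u. ennreal (indicator {0<..} u * (1 - exp (- l * u)) * u powr (- 1 - b)) \<partial>lborel)
    = (\<integral>\<^sup>+v. (\<integral>\<^sup>+u. ennreal (indicator {0..l} v * (indicator {0<..} u * u powr (1 - b - 1) * exp (- v * u))) \<partial>lborel) \<partial>lborel)"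
    unfolding inner by (rule lborel_pair.Fubini') measurable
  also have "\<dots> = (\<integral>\<^sup>+v. ennreal (Gamma (1 - b)) * ennreal (indicator {0..l} v * v powr (b - 1)) \<partial>lborel)"
  proof (rule nn_integral_cong_AE)
    \<comment> \<open>At \<open>v = 0\<close> the inner integral is infinite while
      \<open>0 powr (b - 1)\<close> is \<open>0\<close>, so the identity holds only almost
      everywhere.\<close>
    have "AE v::real in lborel. v \<noteq> 0" by (rule AE_lborel_singleton)
    then show "AE v in lborel. (\<integral>\<^sup>+u. ennreal (indicator {0..l} v * (indicator {0<..} u * u powr (1 - b - 1) * exp (- v * u))) \<partial>lborel)
      = ennreal (Gamma (1 - b)) * ennreal (indicator {0..l} v * v powr (b - 1))"
    proof eventually_elim
      case (elim v)
      show ?case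
      proof (cases "v \<in> {0..l}")
        case True
        with elim have "v > 0" by auto
        then show ?thesis
          using True nn_integral_Gamma_scaled[of "1 - b" v] assms
          by (simp add: ennreal_mult[symmetric])
      qed simp
    qed
  qed
  also have "\<dots> = ennreal (Gamma (1 - b)) * ennreal (l powr b / b)"
    using assms by (subst nn_integral_cmult) (auto simp: nn_integral_powr_from_0)
  also have "\<dots> = ennreal (l powr b * Gamma (1 - b) / b)"
    using assms Gamma_real_pos[of "1 - b"] by (simp add: ennreal_mult[symmetric] mult.commute)
  finally show ?thesis .
qed

text \<open>The substitution \<open>u = 1 / w\<close> turns this into a Gamma integral. The
  change-of-variables theorem speaks of absolutely integrable functions, so the known side is first
  moved to the Henstock-Kurzweil integral and the result moved back.\<close>

lemma nn_integral_inverse_Gamma: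
  fixes s a :: real
  assumes "s > 0" "a > 0"
  shows "(\<integral>\<^sup>+u. ennreal (indicator {0<..} u * (u powr (- 1 - s) * exp (- a / u))) \<partial>lborel) = ennreal (Gamma s * a powr (- s))"
proof -
  let ?f = "\<lambda>u::real. u powr (- 1 - s) * exp (- a / u)"
  let ?h = "\<lambda>w::real. w powr (s - 1) * exp (- a * w)"
  have h_nn: "(\<integral>\<^sup>+w. ennreal (indicator {0<..} w *\<^sub>R ?h w) \<partial>lborel) = ennreal (Gamma s * a powr (- s))"
    using nn_integral_Gamma_scaled[OF assms] by (simp add: mult.assoc)
  have "((\<lambda>w. indicator {0<..} w *\<^sub>R ?h w) has_integral (Gamma s * a powr (- s))) UNIV"
    by (rule nn_integral_has_integral[OF _ _ h_nn]) (use Gamma_real_pos[OF assms(1)] in auto)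
  also have "(\<lambda>w. indicator {0<..} w *\<^sub>R ?h w) = (\<lambda>w. if w \<in> {0<..} then ?h w else 0)"
    by (auto simp: indicator_def)
  finally have "(?h has_integral (Gamma s * a powr (- s))) {0<..}"
    by (simp only: has_integral_restrict_UNIV)
  then have h: "?h absolutely_integrable_on {0<..} \<and> integral {0<..} ?h = Gamma s * a powr (- s)"
    by (auto simp: has_integral_iff intro!: nonnegative_absolutely_integrable_1)
  have h': "\<bar>- 1 / w\<^sup>2\<bar> * ?f (1 / w) = ?h w" if "w \<in> {0<..}" for w :: real
  proof -
    have "(1 / w) powr (-1 - s) = w powr (s + 1)"
      using that powr_minus_divide[of w "1+s"] by (simp add: powr_divide powr_minus field_simps)
    also have "\<dots> = w powr (s - 1) * w\<^sup>2"
      using that powr_add[of w "s - 1" 2] by (simp add: add.commute)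
    finally show ?thesis using that by (simp add: field_simps)
  qed
  have img: "(\<lambda>w::real. 1 / w) ` {0<..} = {0<..}"
  proof (intro set_eqI iffI)
    fix x :: real assume "x \<in> {0<..}"
    then show "x \<in> (\<lambda>w. 1 / w) ` {0<..}" by (intro image_eqI[of _ _ "1 / x"]) auto
  qed auto
  have "(\<lambda>w. \<bar>- 1 / w\<^sup>2\<bar> * ?f (1 / w)) absolutely_integrable_on {0<..} \<and>
     integral {0<..} (\<lambda>w. \<bar>- 1 / w\<^sup>2\<bar> * ?f (1 / w)) = Gamma s * a powr (- s) \<longleftrightarrow>
     ?f absolutely_integrable_on ((\<lambda>w. 1 / w) ` {0<..}) \<and> integral ((\<lambda>w. 1 / w) ` {0<..}) ?f = Gamma s * a powr (- s)"
    by (rule has_absolute_integral_change_of_variables_1')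
       (auto intro!: derivative_eq_intros inj_onI simp: field_simps power2_eq_square)
  moreover have "(\<lambda>w. \<bar>- 1 / w\<^sup>2\<bar> * ?f (1 / w)) absolutely_integrable_on {0<..} \<longleftrightarrow> ?h absolutely_integrable_on {0<..}"
    using h' by (intro set_integrable_cong) auto
  moreover have "integral {0<..} (\<lambda>w. \<bar>- 1 / w\<^sup>2\<bar> * ?f (1 / w)) = integral {0<..} ?h"
    using h' by (intro integral_cong) auto
  ultimately have "?f absolutely_integrable_on {0<..} \<and> integral {0<..} ?f = Gamma s * a powr (- s)"
    using h img by simp
  then have "(?f has_integral (Gamma s * a powr (- s))) {0<..}"
    by (auto simp: has_integral_iff dest: set_lebesgue_integral_eq_integral(1))
  from nn_integral_has_integral_lebesgue[OF _ this]
  show ?thesis by simp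
qed

section \<open>Sibuya's law and its convolution powers\<close>

lemma sibuya_coeff:
  fixes b :: real
  assumes "0 < b" "b < 1"
  obtains c where "\<And>k::nat. 0 \<le> c k" "c 0 = 0"
    "\<And>x. 0 \<le> x \<Longrightarrow> x < 1 \<Longrightarrow> (\<lambda>k. c k * x ^ k) sums (1 - (1 - x) powr b)"
proof -
  define g where "g k = - ((b gchoose k) * (-1) ^ k)" for k :: nat
  define c where "c k = (if k = 0 then 0 else g k)" for k
  have rec: "g (Suc k) = g k * (real k - b) / real (Suc k)" for k
  proof -
    have "real (Suc k) * (b gchoose (Suc k)) = (b - real k) * (b gchoose k)"
      using gbinomial_mult_1[of b k] by (simp add: algebra_simps)
    then have "b gchoose (Suc k) = (b - real k) * (b gchoose k) / real (Suc k)"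
      by (simp add: field_simps)
    then show ?thesis by (simp add: g_def algebra_simps minus_divide_left)
  qed
  \<comment> \<open>The first coefficient is \<open>b\<close> and every later ratio
    \<open>(k - b) / (k + 1)\<close> is nonnegative because \<open>b < 1\<close>; only the constant
    term of the series has the other sign, and \<open>c\<close> removes it.\<close>
  have pos: "0 \<le> g (Suc k)" for k
  proof (induction k)
    case (Suc k)
    then show ?case using assms by (subst rec) (auto intro!: divide_nonneg_pos mult_nonneg_nonneg)
  next
    case 0
    show ?case using assms rec[of 0] by (simp add: g_def)
  qed
  show ?thesis
  proof (rule that)
    show "0 \<le> c k" for k using pos by (cases k) (auto simp: c_def)
    show "c 0 = 0" by (simp add: c_def)
    fix x :: real assume x: "0 \<le> x" "x < 1"
    have "(\<lambda>k. (b gchoose k) * (- x) ^ k) sums (1 + - x) powr b"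
      using x by (intro gen_binomial_real) auto
    then have "(\<lambda>k. - ((b gchoose k) * (- x) ^ k)) sums (- ((1 - x) powr b))"
      using sums_minus by fastforce
    then have "(\<lambda>k. (if k = 0 then 1 else 0) + - ((b gchoose k) * (- x) ^ k)) sums (1 + - ((1 - x) powr b))"
      using sums_single[of 0 "\<lambda>_. 1::real"] by (intro sums_add) auto
    also have "(\<lambda>k. (if k = 0 then 1 else 0) + - ((b gchoose k) * (- x) ^ k)) = (\<lambda>k. c k * x ^ k)"
      by (auto simp: c_def g_def fun_eq_iff power_minus[of x])
    finally show "(\<lambda>k. c k * x ^ k) sums (1 - (1 - x) powr b)" by simp
  qed
qed

text \<open>Cauchy products keep coefficients nonnegative; the \<open>n\<close>-th power is the
  generating function of a sum of \<open>n\<close> independent Sibuya variables. The vanishing of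
  \<open>c 0\<close> matters later, since index \<open>0\<close> would stand for a heat kernel at
  time zero.\<close>

lemma sibuya_power_coeff:
  fixes b :: real
  assumes "0 < b" "b < 1" "n \<ge> 1"
  shows "\<exists>c::nat\<Rightarrow>real. (\<forall>k. 0 \<le> c k) \<and> c 0 = 0 \<and>
    (\<forall>x. 0 \<le> x \<longrightarrow> x < 1 \<longrightarrow> (\<lambda>k. c k * x ^ k) sums (1 - (1 - x) powr b) ^ n)"
  using assms(3)
proof (induction n rule: dec_induct)
  case base
  show ?case using sibuya_coeff[OF assms(1,2)] by (metis power_one_right)
next
  case (step n)
  obtain a where a: "\<And>k::nat. 0 \<le> a k" "a 0 = 0"
    "\<And>x. 0 \<le> x \<Longrightarrow> x < 1 \<Longrightarrow> (\<lambda>k. a k * x ^ k) sums (1 - (1 - x) powr b)"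
    using sibuya_coeff[OF assms(1,2)] by blast
  obtain c where c: "\<And>k::nat. 0 \<le> c k" "c 0 = 0"
    "\<And>x. 0 \<le> x \<Longrightarrow> x < 1 \<Longrightarrow> (\<lambda>k. c k * x ^ k) sums (1 - (1 - x) powr b) ^ n"
    using step.IH by blast
  show ?case
  proof (intro exI[of _ "\<lambda>k. \<Sum>i\<le>k. a i * c (k - i)"] conjI allI impI)
    show "0 \<le> (\<Sum>i\<le>k. a i * c (k - i))" for k using a c by (auto intro!: sum_nonneg)
    show "(\<Sum>i\<le>0. a i * c (0 - i)) = 0" using a c by simp
    fix x :: real assume x: "0 \<le> x" "x < 1"
    have "(\<lambda>k. \<Sum>i\<le>k. (a i * x ^ i) * (c (k - i) * x ^ (k - i))) sums ((\<Sum>k. a k * x ^ k) * (\<Sum>k. c k * x ^ k))"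
      using a c x by (intro Cauchy_product_sums) (auto dest!: sums_summable)
    also have "(\<lambda>k. \<Sum>i\<le>k. (a i * x ^ i) * (c (k - i) * x ^ (k - i))) = (\<lambda>k. (\<Sum>i\<le>k. a i * c (k - i)) * x ^ k)"
    proof (intro ext, unfold sum_distrib_right, intro sum.cong refl)
      fix k i :: nat assume "i \<in> {..k}"
      then have "x ^ i * x ^ (k - i) = x ^ k" by (simp add: power_add[symmetric])
      then show "(a i * x ^ i) * (c (k - i) * x ^ (k - i)) = a i * c (k - i) * x ^ k"
        by (metis mult.assoc mult.left_commute)
    qed
    also have "(\<Sum>k. a k * x ^ k) * (\<Sum>k. c k * x ^ k) = (1 - (1 - x) powr b) ^ Suc n"
      using a(3)[OF x] c(3)[OF x] by (simp add: sums_iff)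
    finally show "(\<lambda>k. (\<Sum>i\<le>k. a i * c (k - i)) * x ^ k) sums (1 - (1 - x) powr b) ^ Suc n" .
  qed
qed

text \<open>\<open>1 - (1 - x)\<^sup>b\<close> is the generating function of Sibuya's law, which lies in the domain of attraction
  of the positive \<open>b\<close>-stable law. Hence \<open>sib b t n\<close>, the Laplace transform of a rescaled sum of \<open>n\<close> independent
  Sibuya variables, is a nonnegative combination of exponentials and tends to \<open>exp (- t v\<^sup>b)\<close>.\<close>

definition sib :: "real \<Rightarrow> real \<Rightarrow> nat \<Rightarrow> real \<Rightarrow> real" where
  "sib b t n v = (1 - (1 - exp (- (v * (t / real n) powr (1 / b)))) powr b) ^ n"

text \<open>An exponential bound survives the \<open>n\<close>-th power, and the rescaling then
  removes \<open>n\<close>: this yields the dominating function under which the Fourier integrals of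
  \<open>sib\<close> converge. The factor \<open>1 / 2\<close> is the price for replacing
  \<open>1 - exp (- w)\<close> by a linear function on \<open>{0..1}\<close>.\<close>

lemma sib_factor_bound:
  fixes w b :: real
  assumes "0 < b" "b < 1" "0 \<le> w"
  shows "0 \<le> 1 - (1 - exp (- w)) powr b" "1 - (1 - exp (- w)) powr b \<le> exp (- ((w / 2) powr b))"
proof -
  have e: "0 \<le> 1 - exp (- w)" "1 - exp (- w) \<le> 1" using assms by auto
  then show "0 \<le> 1 - (1 - exp (- w)) powr b" using assms powr_le1[of b "1 - exp (-w)"] by simp
  show "1 - (1 - exp (- w)) powr b \<le> exp (- ((w / 2) powr b))"
  proof (cases "w \<le> 1")
    case True
    have "w * w \<le> 1 * w" using assms True by (intro mult_right_mono) auto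
    then have "1 \<le> (1 - w / 2) * (1 + w)" by (simp add: algebra_simps)
    also have "\<dots> \<le> (1 - w / 2) * exp w" using True by (intro mult_left_mono exp_ge_add_one_self) auto
    finally have "exp (- w) \<le> 1 - w / 2" by (simp add: exp_minus field_simps)
    then have "w / 2 \<le> 1 - exp (- w)" by simp
    then have "(w / 2) powr b \<le> (1 - exp (- w)) powr b" using assms by (intro powr_mono2) auto
    then have "exp (- ((1 - exp (- w)) powr b)) \<le> exp (- ((w / 2) powr b))" by simp
    with exp_ge_add_one_self[of "- ((1 - exp (- w)) powr b)"] show ?thesis by linarith
  next
    case False
    \<comment> \<open>Beyond \<open>w = 1\<close> the plain exponential \<open>exp (- w)\<close>
      already suffices, because a number in \<open>{0..1}\<close> is below its \<open>b\<close>-th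
      power and \<open>w powr b \<le> w\<close>.\<close>
    have "1 - exp (- w) \<le> (1 - exp (- w)) powr b"
      using e assms powr_mono'[of b 1 "1 - exp (-w)"] by (simp add: powr_one_gt_zero_iff)
    then have "1 - (1 - exp (- w)) powr b \<le> exp (- w)" by simp
    moreover have "(w / 2) powr b \<le> w powr b" using assms by (intro powr_mono2) auto
    moreover have "w powr b \<le> w powr 1" using assms False by (intro powr_mono) auto
    ultimately have "1 - (1 - exp (- w)) powr b \<le> exp (- w)" "(w / 2) powr b \<le> w" using False by auto
    then show ?thesis by (meson exp_le_cancel_iff neg_le_iff_le order_trans)
  qed
qed

lemma powr_scale_cancel:
  assumes "0 < b" "0 < t" "0 \<le> v" "n \<ge> 1"
  shows "real n * (v * (t / real n) powr (1 / b) / 2) powr b = t * (v / 2) powr b"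
proof -
  have "(v * (t / real n) powr (1 / b) / 2) powr b = ((v / 2) * (t / real n) powr (1 / b)) powr b" by simp
  also have "\<dots> = (v / 2) powr b * (t / real n)"
  proof -
    have "((t / real n) powr (1 / b)) powr b = t / real n" using assms by (simp add: powr_powr)
    then show ?thesis using assms by (simp only: powr_mult)
  qed
  finally show ?thesis using assms by simp
qed

lemma sib_bounds:
  assumes "0 < b" "b < 1" "0 < t" "0 \<le> v" "n \<ge> 1"
  shows "0 \<le> sib b t n v" "sib b t n v \<le> exp (- t * (v / 2) powr b)"
proof -
  let ?w = "v * (t / real n) powr (1 / b)"
  have w: "0 \<le> ?w" using assms by simp
  show "0 \<le> sib b t n v" unfolding sib_def using sib_factor_bound(1)[OF assms(1,2) w] by simp
  have "sib b t n v \<le> exp (- ((?w / 2) powr b)) ^ n"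
    unfolding sib_def using sib_factor_bound[OF assms(1,2) w] by (intro power_mono) auto
  also have "\<dots> = exp (- (real n * (?w / 2) powr b))" by (simp add: exp_of_nat_mult[symmetric])
  also have "\<dots> = exp (- t * (v / 2) powr b)" using powr_scale_cancel assms by simp
  finally show "sib b t n v \<le> exp (- t * (v / 2) powr b)" .
qed

text \<open>With \<open>x n\<close> the complement of one factor, \<open>n * x n\<close> tends to
  \<open>t * v powr b\<close>, and \<open>(1 - x n) ^ n\<close> lies between
  \<open>exp (- n * x n / (1 - x n))\<close> and \<open>exp (- n * x n)\<close>. The scale
  \<open>(t / n) powr (1 / b)\<close> is the stable normalisation that makes \<open>n * x n\<close>
  converge.\<close>

lemma sib_limit:
  fixes b t v :: real
  assumes "0 < b" "b < 1" "0 < t" "0 \<le> v"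
  shows "(\<lambda>n. sib b t n v) \<longlonglongrightarrow> exp (- t * v powr b)"
proof (cases "v = 0")
  case True
  then show ?thesis using assms by (simp add: sib_def)
next
  case False
  with assms have v: "v > 0" by simp
  define x where "x n = (1 - exp (- (v * (t / real n) powr (1 / b)))) powr b" for n :: nat
  have x0: "x \<longlonglongrightarrow> 0" unfolding x_def using assms v by real_asymp
  have nx: "(\<lambda>n. real n * x n) \<longlonglongrightarrow> t * v powr b" unfolding x_def using assms v
    by (real_asymp simp: powr_mult powr_powr)
  have up: "\<forall>\<^sub>F n in sequentially. sib b t n v \<le> exp (- (real n * x n))"
    using order_tendstoD(2)[OF x0, of 1, simplified]
  proof eventually_elim
    case (elim n)
    have "(1 - x n) ^ n \<le> exp (- x n) ^ n" using elim exp_ge_add_one_self[of "- x n"] by (intro power_mono) auto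
    then show ?case by (simp add: sib_def x_def exp_of_nat_mult[symmetric])
  qed
  have lo: "\<forall>\<^sub>F n in sequentially. exp (- (real n * x n / (1 - x n))) \<le> sib b t n v"
    using order_tendstoD(2)[OF x0, of 1, simplified]
  proof eventually_elim
    case (elim n)
    have "1 / (1 - x n) \<le> exp (x n / (1 - x n))"
      using exp_ge_add_one_self[of "x n / (1 - x n)"] elim by (simp add: field_simps)
    then have "exp (- (x n / (1 - x n))) \<le> 1 - x n"
      using elim by (simp add: exp_minus field_simps)
    then have "exp (- (x n / (1 - x n))) ^ n \<le> (1 - x n) ^ n" by (intro power_mono) auto
    then show ?case by (simp add: sib_def x_def exp_of_nat_mult[symmetric])
  qed
  show ?thesis
  proof (rule tendsto_sandwich[OF lo up])
    show "(\<lambda>n. exp (- (real n * x n))) \<longlonglongrightarrow> exp (- t * v powr b)"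
      using tendsto_exp[OF tendsto_minus[OF nx]] by simp
    have "(\<lambda>n. exp (- (real n * x n / (1 - x n)))) \<longlonglongrightarrow> exp (- (t * v powr b / (1 - 0)))"
      by (intro tendsto_intros nx x0) auto
    then show "(\<lambda>n. exp (- (real n * x n / (1 - x n)))) \<longlonglongrightarrow> exp (- t * v powr b)" by simp
  qed
qed

section \<open>The isotropic stable density\<close>

interpretation lborel_leb: pair_sigma_finite "lborel :: real measure" "leb d" for d
  by (simp add: pair_sigma_finite_def sigma_finite_leb sigma_finite_lborel)

text \<open>The Sibuya series is summed only at arguments below \<open>1\<close>, that is, away from
  frequency zero; this lemma discards the exception. It also discards the singularity of the jump
  kernel.\<close>

lemma AE_enorm_neq_0:
  assumes "1 \<le> d"
  shows "AE x in leb d. enorm d x \<noteq> 0"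
proof (rule AE_I)
  show "{x \<in> space (leb d). \<not> enorm d x \<noteq> 0} \<subseteq> Pi\<^sub>E {..<d} (\<lambda>_. {0})"
    by (auto simp: space_PiM PiE_iff enorm_eq_0 fun_eq_iff extensional_def)
  show "emeasure (leb d) (Pi\<^sub>E {..<d} (\<lambda>_. {0})) = 0"
    using assms by (subst lebI.emeasure_PiM) auto
  show "Pi\<^sub>E {..<d} (\<lambda>_. {0}) \<in> sets (leb d)" by (intro sets_PiM_I_finite) auto
qed

lemma gauss_nn:
  assumes "u > 0"
  shows "(\<integral>\<^sup>+x. ennreal (exp (- u * (enorm d x)\<^sup>2)) \<partial>leb d) = ennreal ((pi / u) powr (real d / 2))"
  using gauss_cos(1,3)[OF assms, of d] by (subst nn_integral_eq_integral) auto

text \<open>The Cauchy weight is a Gamma mixture of Gaussians. Integrals against it thus reduce to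
  Gaussian ones, both for the normalising constant and for the test function
  \<open>sin (x 0)\<close>.\<close>

lemma nn_integral_cauchy_mixture:
  fixes s :: real
  assumes "s > 0" and [measurable]: "g \<in> borel_measurable (leb d)"
  shows "ennreal (Gamma s) * (\<integral>\<^sup>+x. g x * ennreal ((1 + (enorm d x)\<^sup>2) powr (- s)) \<partial>leb d)
    = (\<integral>\<^sup>+u. ennreal (indicator {0<..} u * u powr (s - 1) * exp (- u)) *
        (\<integral>\<^sup>+x. g x * ennreal (exp (- u * (enorm d x)\<^sup>2)) \<partial>leb d) \<partial>lborel)"
proof -
  have pos: "0 < 1 + (enorm d x)\<^sup>2" for x by (simp add: add_pos_nonneg)
  have "ennreal (Gamma s) * (\<integral>\<^sup>+x. g x * ennreal ((1 + (enorm d x)\<^sup>2) powr (- s)) \<partial>leb d)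
     = (\<integral>\<^sup>+x. g x * ennreal (Gamma s * (1 + (enorm d x)\<^sup>2) powr (- s)) \<partial>leb d)"
    using Gamma_real_pos[OF assms(1)]
    by (subst nn_integral_cmult[symmetric]) (auto simp: ennreal_mult mult_ac)
  also have "\<dots> = (\<integral>\<^sup>+x. (\<integral>\<^sup>+u. g x * ennreal (indicator {0<..} u * u powr (s - 1) * exp (- (1 + (enorm d x)\<^sup>2) * u)) \<partial>lborel) \<partial>leb d)"
    by (subst nn_integral_Gamma_scaled[OF assms(1) pos, symmetric]) (simp add: nn_integral_cmult)
  also have "\<dots> = (\<integral>\<^sup>+u. (\<integral>\<^sup>+x. g x * ennreal (indicator {0<..} u * u powr (s - 1) * exp (- (1 + (enorm d x)\<^sup>2) * u)) \<partial>leb d) \<partial>lborel)"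
    by (rule lborel_leb.Fubini') measurable
  also have "\<dots> = (\<integral>\<^sup>+u. ennreal (indicator {0<..} u * u powr (s - 1) * exp (- u)) *
        (\<integral>\<^sup>+x. g x * ennreal (exp (- u * (enorm d x)\<^sup>2)) \<partial>leb d) \<partial>lborel)"
  proof (intro nn_integral_cong)
    fix u :: real
    have "exp (- (1 + (enorm d x)\<^sup>2) * u) = exp (- u) * exp (- u * (enorm d x)\<^sup>2)" for x
      by (simp add: exp_add[symmetric] algebra_simps)
    then have "g x * ennreal (indicator {0<..} u * u powr (s - 1) * exp (- (1 + (enorm d x)\<^sup>2) * u))
      = ennreal (indicator {0<..} u * u powr (s - 1) * exp (- u)) * (g x * ennreal (exp (- u * (enorm d x)\<^sup>2)))" for x
      by (simp add: ennreal_mult mult_ac)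
    then show "(\<integral>\<^sup>+x. g x * ennreal (indicator {0<..} u * u powr (s - 1) * exp (- (1 + (enorm d x)\<^sup>2) * u)) \<partial>leb d)
      = ennreal (indicator {0<..} u * u powr (s - 1) * exp (- u)) * (\<integral>\<^sup>+x. g x * ennreal (exp (- u * (enorm d x)\<^sup>2)) \<partial>leb d)"
      by (simp add: nn_integral_cmult)
  qed
  finally show ?thesis .
qed

lemma nn_integral_cauchy:
  fixes s :: real
  assumes "s > real d / 2"
  shows "(\<integral>\<^sup>+x. ennreal ((1 + (enorm d x)\<^sup>2) powr (- s)) \<partial>leb d) = ennreal (pi powr (real d / 2) * Gamma (s - real d / 2) / Gamma s)"
proof -
  have s: "s > 0" using assms by (auto intro: le_less_trans[rotated])
  note G = Gamma_real_pos[OF s]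
  have "ennreal (Gamma s) * (\<integral>\<^sup>+x. 1 * ennreal ((1 + (enorm d x)\<^sup>2) powr (- s)) \<partial>leb d)
    = (\<integral>\<^sup>+u. ennreal (indicator {0<..} u * u powr (s - 1) * exp (- u)) *
        (\<integral>\<^sup>+x. 1 * ennreal (exp (- u * (enorm d x)\<^sup>2)) \<partial>leb d) \<partial>lborel)"
    by (rule nn_integral_cauchy_mixture[OF s]) simp
  also have "\<dots> = (\<integral>\<^sup>+u. ennreal (pi powr (real d / 2)) * ennreal (indicator {0<..} u * u powr (s - real d / 2 - 1) * exp (- 1 * u)) \<partial>lborel)"
  proof (intro nn_integral_cong)
    fix u :: real
    show "ennreal (indicator {0<..} u * u powr (s - 1) * exp (- u)) * (\<integral>\<^sup>+x. 1 * ennreal (exp (- u * (enorm d x)\<^sup>2)) \<partial>leb d)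
      = ennreal (pi powr (real d / 2)) * ennreal (indicator {0<..} u * u powr (s - real d / 2 - 1) * exp (- 1 * u))"
    proof (cases "u > 0")
      case True
      have "u powr (s - 1) * (pi / u) powr (real d / 2) = pi powr (real d / 2) * u powr (s - real d / 2 - 1)"
        using True powr_diff[of u "s - 1" "real d / 2"] by (simp add: powr_divide algebra_simps)
      then show ?thesis using True gauss_nn[OF True, of d]
        by (simp add: ennreal_mult[symmetric] mult_ac)
    qed simp
  qed
  also have "\<dots> = ennreal (pi powr (real d / 2)) * ennreal (Gamma (s - real d / 2) * 1 powr (- (s - real d / 2)))"
    using nn_integral_Gamma_scaled[of "s - real d / 2" 1] assms by (subst nn_integral_cmult) auto
  finally have eq: "ennreal (Gamma s) * (\<integral>\<^sup>+x. ennreal ((1 + (enorm d x)\<^sup>2) powr (- s)) \<partial>leb d) = ennreal (pi powr (real d / 2) * Gamma (s - real d / 2))"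
    using assms Gamma_real_pos[of "s - real d / 2"] by (simp add: ennreal_mult[symmetric])
  have "(\<integral>\<^sup>+x. ennreal ((1 + (enorm d x)\<^sup>2) powr (- s)) \<partial>leb d) = ennreal (1 / Gamma s) * (ennreal (Gamma s) * (\<integral>\<^sup>+x. ennreal ((1 + (enorm d x)\<^sup>2) powr (- s)) \<partial>leb d))"
    using G by (simp add: mult.assoc[symmetric] ennreal_mult[symmetric])
  also have "\<dots> = ennreal (pi powr (real d / 2) * Gamma (s - real d / 2) / Gamma s)"
    unfolding eq using G assms Gamma_real_pos[of "s - real d / 2"] by (simp add: ennreal_mult[symmetric])
  finally show ?thesis .
qed

lemma integrable_cauchy:
  assumes "s > real d / 2"
  shows "integrable (leb d) (\<lambda>x. (1 + (enorm d x)\<^sup>2) powr (- s))"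
  by (rule integrableI_nn_integral_finite[OF _ _ nn_integral_cauchy[OF assms]])
     (use assms in \<open>auto intro!: divide_nonneg_nonneg mult_nonneg_nonneg Gamma_real_nonneg\<close>)

lemma integrable_exp_powr:
  fixes t \<alpha> :: real
  assumes "1 \<le> d" "0 < t" "0 < \<alpha>"
  shows "integrable (leb d) (\<lambda>x. exp (- t * enorm d x powr \<alpha>))"
proof -
  \<comment> \<open>Any exponent above \<open>d / 2\<close> makes the comparison weight integrable;
    \<open>d\<close> qualifies since \<open>1 \<le> d\<close>.\<close>
  define s where "s = real d"
  have s: "s > real d / 2" "s > 0" using assms by (auto simp: s_def)
  have lim: "((\<lambda>r. (1 + r\<^sup>2) powr s * exp (- t * r powr \<alpha>)) \<longlongrightarrow> 0) at_top"
    using assms s by real_asymp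
  then have "\<forall>\<^sub>F r in at_top. (1 + r\<^sup>2) powr s * exp (- t * r powr \<alpha>) < 1"
    by (rule order_tendstoD) simp
  then obtain R where R: "\<And>r. r \<ge> R \<Longrightarrow> (1 + r\<^sup>2) powr s * exp (- t * r powr \<alpha>) < 1"
    by (auto simp: eventually_at_top_linorder)
  define B where "B = max 1 ((1 + R\<^sup>2) powr s)"
  have B: "(1 + r\<^sup>2) powr s * exp (- t * r powr \<alpha>) \<le> B" if "r \<ge> 0" for r
  proof (cases "r \<ge> R")
    case True
    then show ?thesis using R[of r] by (simp add: B_def)
  next
    case False
    have "(1 + r\<^sup>2) powr s * exp (- t * r powr \<alpha>) \<le> (1 + R\<^sup>2) powr s * 1"
      using False that assms s by (intro mult_mono powr_mono2) (auto intro!: power_mono)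
    then show ?thesis by (simp add: B_def)
  qed
  show ?thesis
  proof (rule Bochner_Integration.integrable_bound)
    show "integrable (leb d) (\<lambda>x. B * (1 + (enorm d x)\<^sup>2) powr (- s))"
      using integrable_cauchy[OF s(1)] by simp
    show "AE x in leb d. norm (exp (- t * enorm d x powr \<alpha>)) \<le> norm (B * (1 + (enorm d x)\<^sup>2) powr (- s))"
    proof (rule AE_I2)
      fix x
      have p: "0 < 1 + (enorm d x)\<^sup>2" by (simp add: add_pos_nonneg)
      have "exp (- t * enorm d x powr \<alpha>) = ((1 + (enorm d x)\<^sup>2) powr s * exp (- t * enorm d x powr \<alpha>)) * (1 + (enorm d x)\<^sup>2) powr (- s)"
        using p by (simp add: powr_minus field_simps)
      also have "\<dots> \<le> B * (1 + (enorm d x)\<^sup>2) powr (- s)"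
        by (intro mult_right_mono B) auto
      finally show "norm (exp (- t * enorm d x powr \<alpha>)) \<le> norm (B * (1 + (enorm d x)\<^sup>2) powr (- s))"
        by (simp add: B_def)
    qed
  qed measurable
qed

lemma stable_density_cos:
  assumes "1 \<le> d" "0 < t" "0 < \<alpha>"
  shows "stable_density d \<alpha> t y = (\<integral>\<xi>. exp (- t * enorm d \<xi> powr \<alpha>) * cos (einner d \<xi> y) \<partial>leb d) / (2 * pi) ^ d"
proof -
  let ?F = "\<lambda>\<xi>. complex_of_real (exp (- t * enorm d \<xi> powr \<alpha>)) * exp (- (\<i> * complex_of_real (einner d \<xi> y)))"
  have m: "(\<lambda>\<xi>. einner d \<xi> y) \<in> borel_measurable (leb d)"
    unfolding einner_def by measurable
  have n: "norm (exp (- (\<i> * complex_of_real r))) = 1" for r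
    by (simp add: norm_exp_eq_Re)
  have "integrable (leb d) ?F"
  proof (rule Bochner_Integration.integrable_bound[OF integrable_exp_powr[OF assms]])
    show "?F \<in> borel_measurable (leb d)" using m by measurable
  qed (simp add: norm_mult n)
  from integral_Re[OF this] show ?thesis
    unfolding stable_density_def by (simp add: Re_exp)
qed

text \<open>The Gaussian with covariance \<open>2 * u\<close> times the identity, normalised so that
  its Fourier transform is \<open>exp (- u * |\<xi>|^2)\<close>; stable densities arise from it by
  randomising the time \<open>u\<close>.\<close>

definition heat :: "nat \<Rightarrow> real \<Rightarrow> (nat \<Rightarrow> real) \<Rightarrow> real" where
  "heat d u y = (4 * pi * u) powr (- real d / 2) * exp (- (enorm d y)\<^sup>2 / (4 * u))"

lemma heat_nonneg [simp]: "0 \<le> heat d u y" by (simp add: heat_def)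

lemma heat_fourier:
  assumes "u > 0"
  shows "(\<integral>\<xi>. exp (- u * (enorm d \<xi>)\<^sup>2) * cos (einner d \<xi> y) \<partial>leb d) / (2 * pi) ^ d = heat d u y"
proof -
  have "(pi / u) powr (real d / 2) / (2 * pi) ^ d = (pi / u) powr (real d / 2) / ((2 * pi)\<^sup>2) powr (real d / 2)"
  proof -
    have "(2 * pi)\<^sup>2 = (2 * pi) powr 2" by simp
    then have "((2 * pi)\<^sup>2) powr (real d / 2) = (2 * pi) powr real d" by (simp only: powr_powr) simp
    also have "\<dots> = (2 * pi) ^ d" by (simp add: powr_realpow)
    finally show ?thesis by simp
  qed
  also have "\<dots> = (pi / u / (2 * pi)\<^sup>2) powr (real d / 2)" using assms by (subst powr_divide) auto
  also have "pi / u / (2 * pi)\<^sup>2 = 1 / (4 * pi * u)" by (simp add: power2_eq_square)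
  also have "(1 / (4 * pi * u)) powr (real d / 2) = (4 * pi * u) powr (- real d / 2)"
    using assms by (simp add: powr_minus powr_divide field_simps)
  finally have "(pi / u) powr (real d / 2) / (2 * pi) ^ d = (4 * pi * u) powr (- real d / 2)" .
  then show ?thesis unfolding gauss_cos(2)[OF assms] heat_def by (metis times_divide_eq_left)
qed

lemma measurable_sib [measurable]: "sib b t n \<in> borel_measurable borel"
  unfolding sib_def by measurable

lemma measurable_einner_const [measurable]: "(\<lambda>\<xi>. einner d \<xi> y) \<in> borel_measurable (leb d)"
  unfolding einner_def by measurable

lemma enorm_sq_powr: "((enorm d x)\<^sup>2) powr (\<alpha> / 2) = enorm d x powr \<alpha>"
proof -
  have "((enorm d x)\<^sup>2) powr (\<alpha> / 2) = (enorm d x powr 2) powr (\<alpha> / 2)" by simp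
  then show ?thesis by (simp only: powr_powr) simp
qed

lemma sib_enorm_bound:
  assumes "0 < t" "0 < \<alpha>" "\<alpha> < 2"
  shows "0 \<le> sib (\<alpha> / 2) t (Suc n) ((enorm d \<xi>)\<^sup>2)"
    and "sib (\<alpha> / 2) t (Suc n) ((enorm d \<xi>)\<^sup>2) \<le> exp (- (t * (1 / 2) powr (\<alpha> / 2)) * enorm d \<xi> powr \<alpha>)"
proof -
  show "0 \<le> sib (\<alpha> / 2) t (Suc n) ((enorm d \<xi>)\<^sup>2)" using assms by (intro sib_bounds) auto
  have "sib (\<alpha> / 2) t (Suc n) ((enorm d \<xi>)\<^sup>2) \<le> exp (- t * ((enorm d \<xi>)\<^sup>2 / 2) powr (\<alpha> / 2))"
    using assms by (intro sib_bounds) auto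
  also have "((enorm d \<xi>)\<^sup>2 / 2) powr (\<alpha> / 2) = (1 / 2) powr (\<alpha> / 2) * enorm d \<xi> powr \<alpha>"
    using powr_mult[of "1/2" "(enorm d \<xi>)\<^sup>2" "\<alpha> / 2"] by (simp add: enorm_sq_powr)
  finally show "sib (\<alpha> / 2) t (Suc n) ((enorm d \<xi>)\<^sup>2) \<le> exp (- (t * (1 / 2) powr (\<alpha> / 2)) * enorm d \<xi> powr \<alpha>)"
    by (simp add: mult.assoc)
qed

text \<open>Bochner subordination in discrete form. \<open>A n\<close> are the Sibuya power
  coefficients and \<open>k * \<mu> n\<close> the rescaled values, so \<open>I n\<close> is a
  mixture of heat kernels whose Fourier transform is \<open>sib\<close> at \<open>|\<xi>|^2\<close>,
  and \<open>S n j\<close> is the Laplace transform of the same mixture at \<open>j\<close>. Both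
  limits are recorded for one and the same \<open>A\<close>, because the small-time argument
  transfers an approximation of the heat kernel by powers of \<open>exp (- u)\<close> through the
  mixture.\<close>

lemma stable_mixture:
  assumes d: "1 \<le> d" and t: "0 < t" and \<alpha>: "0 < \<alpha>" "\<alpha> < 2"
  obtains A :: "nat \<Rightarrow> nat \<Rightarrow> real" and \<mu> :: "nat \<Rightarrow> real" and I S where
    "\<And>n k. 0 \<le> A n k" "\<And>n. A n 0 = 0" "\<And>n. 0 < \<mu> n"
    "\<And>n y. (\<lambda>k. A n k * heat d (real k * \<mu> n) y) sums I n y"
    "\<And>y. (\<lambda>n. I n y) \<longlonglongrightarrow> stable_density d \<alpha> t y"
    "\<And>n j. 0 < j \<Longrightarrow> (\<lambda>k. A n k * exp (- (real j * (real k * \<mu> n)))) sums S n j"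
    "\<And>j. 0 < j \<Longrightarrow> (\<lambda>n. S n j) \<longlonglongrightarrow> exp (- t * real j powr (\<alpha> / 2))"
    "\<And>n N. (\<Sum>k<N. A n k) \<le> 1"
proof -
  define b where "b = \<alpha> / 2"
  have b: "0 < b" "b < 1" using \<alpha> by (auto simp: b_def)
  define \<mu> where "\<mu> n = (t / real (Suc n)) powr (1 / b)" for n
  have \<mu>: "0 < \<mu> n" for n using t by (simp add: \<mu>_def)
  obtain A :: "nat \<Rightarrow> nat \<Rightarrow> real" where A: "\<And>n k. 0 \<le> A n k" "\<And>n. A n 0 = 0"
    and A_sums: "\<And>n x. 0 \<le> x \<Longrightarrow> x < 1 \<Longrightarrow> (\<lambda>k. A n k * x ^ k) sums (1 - (1 - x) powr b) ^ Suc n"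
    using sibuya_power_coeff[OF b, of "Suc _"] by (metis le_add1 plus_1_eq_Suc)
  have sib: "(\<lambda>k. A n k * exp (- (v * (real k * \<mu> n)))) sums sib b t (Suc n) v" if "v > 0" for n v
  proof -
    have "exp (- (v * \<mu> n)) < 1" using that \<mu>[of n] by simp
    then have "(\<lambda>k. A n k * exp (- (v * \<mu> n)) ^ k) sums (1 - (1 - exp (- (v * \<mu> n))) powr b) ^ Suc n"
      by (intro A_sums) auto
    then show ?thesis by (simp add: sib_def \<mu>_def exp_of_nat_mult[symmetric] mult_ac)
  qed
  \<comment> \<open>Abel's argument: for \<open>x < 1\<close> the partial sums lie below the value
    of the generating function, which is at most \<open>1\<close>; then \<open>x\<close> tends to
    \<open>1\<close> from the left.\<close>
  have A_le: "(\<Sum>k<N. A n k) \<le> 1" for n N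
  proof (rule tendsto_le[OF _ tendsto_const])
    show "((\<lambda>x. \<Sum>k<N. A n k * x ^ k) \<longlongrightarrow> (\<Sum>k<N. A n k)) (at_left (1::real))"
    proof -
      have "((\<lambda>x. \<Sum>k<N. A n k * x ^ k) \<longlongrightarrow> (\<Sum>k<N. A n k * 1 ^ k)) (at_left (1::real))"
        by (intro tendsto_intros)
      then show ?thesis by simp
    qed
    have "\<forall>\<^sub>F x in at_left (1::real). x \<in> {0<..<1}"
      by (rule eventually_at_leftI[of 0]) auto
    then show "\<forall>\<^sub>F x in at_left 1. (\<Sum>k<N. A n k * x ^ k) \<le> 1"
    proof eventually_elim
      case (elim x)
      then have x: "0 \<le> x" "x < 1" by auto
      note s = A_sums[OF x, of n]
      have "(\<Sum>k<N. A n k * x ^ k) \<le> (\<Sum>k. A n k * x ^ k)"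
        using s x A by (intro sum_le_suminf) (auto simp: sums_iff)
      also have "\<dots> = (1 - (1 - x) powr b) ^ Suc n" using s by (simp add: sums_iff)
      also have "\<dots> \<le> 1" using x b powr_le1[of b "1 - x"] by (intro power_le_one) auto
      finally show ?case .
    qed
  qed simp
  define I where "I n y = (\<integral>\<xi>. sib b t (Suc n) ((enorm d \<xi>)\<^sup>2) * cos (einner d \<xi> y) \<partial>leb d) / (2 * pi) ^ d" for n y
  define w where "w \<xi> = exp (- (t * (1 / 2) powr (\<alpha> / 2)) * enorm d \<xi> powr \<alpha>)" for \<xi>
  have w: "integrable (leb d) w" unfolding w_def using d t \<alpha> by (intro integrable_exp_powr) auto
  have sw: "0 \<le> sib b t (Suc n) ((enorm d \<xi>)\<^sup>2)" "sib b t (Suc n) ((enorm d \<xi>)\<^sup>2) \<le> w \<xi>" for n \<xi>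
    unfolding w_def b_def using sib_enorm_bound[OF t \<alpha>] by auto
  have scos: "\<bar>a * cos c\<bar> \<le> a'" if "0 \<le> a" "a \<le> a'" for a c a' :: real
    using that mult_mono[of "\<bar>a\<bar>" a' "\<bar>cos c\<bar>" 1] by (simp add: abs_mult)
  show ?thesis
  proof (rule that[of A \<mu> I "\<lambda>n j. sib b t (Suc n) (real j)"])
    show "(\<lambda>k. A n k * exp (- (real j * (real k * \<mu> n)))) sums sib b t (Suc n) (real j)" if "0 < j" for n j
      using that by (intro sib) auto
    show "(\<lambda>n. sib b t (Suc n) (real j)) \<longlonglongrightarrow> exp (- t * real j powr (\<alpha> / 2))" for j
      using LIMSEQ_Suc[OF sib_limit[OF b t, of "real j"]] by (simp add: b_def)
    fix y
    have "(\<lambda>n. \<integral>\<xi>. sib b t (Suc n) ((enorm d \<xi>)\<^sup>2) * cos (einner d \<xi> y) \<partial>leb d) \<longlonglongrightarrow>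
        (\<integral>\<xi>. exp (- t * enorm d \<xi> powr \<alpha>) * cos (einner d \<xi> y) \<partial>leb d)"
    proof (rule integral_dominated_convergence[where w = w])
      show "AE \<xi> in leb d. (\<lambda>n. sib b t (Suc n) ((enorm d \<xi>)\<^sup>2) * cos (einner d \<xi> y)) \<longlonglongrightarrow>
         exp (- t * enorm d \<xi> powr \<alpha>) * cos (einner d \<xi> y)"
      proof (rule AE_I2, rule tendsto_mult[OF _ tendsto_const])
        fix \<xi>
        show "(\<lambda>n. sib b t (Suc n) ((enorm d \<xi>)\<^sup>2)) \<longlonglongrightarrow> exp (- t * enorm d \<xi> powr \<alpha>)"
          using LIMSEQ_Suc[OF sib_limit[OF b t, of "(enorm d \<xi>)\<^sup>2"]] by (simp add: b_def enorm_sq_powr)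
      qed
      show "AE \<xi> in leb d. norm (sib b t (Suc n) ((enorm d \<xi>)\<^sup>2) * cos (einner d \<xi> y)) \<le> w \<xi>" for n
        using scos sw by auto
    qed (use w in measurable)
    then show "(\<lambda>n. I n y) \<longlonglongrightarrow> stable_density d \<alpha> t y"
      unfolding I_def stable_density_cos[OF d t \<alpha>(1)] by (intro tendsto_divide tendsto_const) auto
    fix n
    define v where "v \<xi> = sib b t (Suc n) ((enorm d \<xi>)\<^sup>2)" for \<xi>
    have v: "integrable (leb d) v"
    proof (rule Bochner_Integration.integrable_bound[OF w])
      show "v \<in> borel_measurable (leb d)" unfolding v_def by measurable
      show "AE \<xi> in leb d. norm (v \<xi>) \<le> norm (w \<xi>)"
        using sw by (intro AE_I2) (simp add: v_def w_def)
    qed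
    \<comment> \<open>The term \<open>k = 0\<close> carries no Gaussian decay; it is harmless
      because \<open>A n 0 = 0\<close>.\<close>
    have ik: "integrable (leb d) (\<lambda>\<xi>. A n k * (exp (- (real k * \<mu> n) * (enorm d \<xi>)\<^sup>2) * cos (einner d \<xi> y)))" for k
    proof (cases "k = 0")
      case False
      then have "real k * \<mu> n > 0" using \<mu>[of n] by simp
      from gauss_cos(1)[OF this, of d] have "integrable (leb d) (\<lambda>\<xi>. exp (- (real k * \<mu> n) * (enorm d \<xi>)\<^sup>2) * cos (einner d \<xi> y))"
        by (rule Bochner_Integration.integrable_bound) (auto simp: abs_mult intro!: mult_left_le)
      then show ?thesis by simp
    qed (simp add: A)
    have pk: "(\<integral>\<xi>. A n k * (exp (- (real k * \<mu> n) * (enorm d \<xi>)\<^sup>2) * cos (einner d \<xi> y)) \<partial>leb d) / (2 * pi) ^ d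
      = A n k * heat d (real k * \<mu> n) y" for k
    proof (cases "k = 0")
      case False
      then have "real k * \<mu> n > 0" using \<mu>[of n] by simp
      from heat_fourier[OF this, of d y] show ?thesis
        by (simp only: integral_mult_right_zero times_divide_eq_right[symmetric])
    qed (simp add: A)
    \<comment> \<open>Termwise integration: all weights are nonnegative and the cosine is at most
      \<open>1\<close> in absolute value, so the partial sums are dominated by the full sum
      \<open>v\<close> of the series without cosine.\<close>
    have "(\<lambda>N. \<integral>\<xi>. (\<Sum>k<N. A n k * (exp (- (real k * \<mu> n) * (enorm d \<xi>)\<^sup>2) * cos (einner d \<xi> y))) \<partial>leb d)
      \<longlonglongrightarrow> (\<integral>\<xi>. v \<xi> * cos (einner d \<xi> y) \<partial>leb d)"
    proof (rule integral_dominated_convergence[where w = v])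
      show "AE \<xi> in leb d. (\<lambda>N. \<Sum>k<N. A n k * (exp (- (real k * \<mu> n) * (enorm d \<xi>)\<^sup>2) * cos (einner d \<xi> y))) \<longlonglongrightarrow> v \<xi> * cos (einner d \<xi> y)"
        using AE_enorm_neq_0[OF d]
      proof eventually_elim
        case (elim \<xi>)
        then have "(\<lambda>k. A n k * exp (- ((enorm d \<xi>)\<^sup>2 * (real k * \<mu> n)))) sums v \<xi>"
          unfolding v_def by (intro sib) (simp add: zero_less_power2)
        from sums_mult2[OF this, of "cos (einner d \<xi> y)"] show ?case
          by (simp add: sums_def mult_ac)
      qed
      show "AE \<xi> in leb d. norm (\<Sum>k<N. A n k * (exp (- (real k * \<mu> n) * (enorm d \<xi>)\<^sup>2) * cos (einner d \<xi> y))) \<le> v \<xi>" for N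
        using AE_enorm_neq_0[OF d]
      proof eventually_elim
        case (elim \<xi>)
        then have s: "(\<lambda>k. A n k * exp (- ((enorm d \<xi>)\<^sup>2 * (real k * \<mu> n)))) sums v \<xi>"
          unfolding v_def by (intro sib) (simp add: zero_less_power2)
        have "norm (\<Sum>k<N. A n k * (exp (- (real k * \<mu> n) * (enorm d \<xi>)\<^sup>2) * cos (einner d \<xi> y)))
          \<le> (\<Sum>k<N. A n k * exp (- ((enorm d \<xi>)\<^sup>2 * (real k * \<mu> n))))"
          by (rule sum_norm_le) (auto simp: abs_mult A mult_ac intro!: mult_left_mono mult_left_le)
        also have "\<dots> \<le> (\<Sum>k. A n k * exp (- ((enorm d \<xi>)\<^sup>2 * (real k * \<mu> n))))"
          using s A by (intro sum_le_suminf) (auto simp: sums_iff)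
        also have "\<dots> = v \<xi>" using s by (simp add: sums_iff)
        finally show ?case .
      qed
    qed (use v in measurable)
    then have "(\<lambda>N. (\<integral>\<xi>. (\<Sum>k<N. A n k * (exp (- (real k * \<mu> n) * (enorm d \<xi>)\<^sup>2) * cos (einner d \<xi> y))) \<partial>leb d) / (2 * pi) ^ d)
      \<longlonglongrightarrow> I n y"
      unfolding I_def v_def by (intro tendsto_divide tendsto_const) auto
    also have "(\<lambda>N. (\<integral>\<xi>. (\<Sum>k<N. A n k * (exp (- (real k * \<mu> n) * (enorm d \<xi>)\<^sup>2) * cos (einner d \<xi> y))) \<partial>leb d) / (2 * pi) ^ d)
      = (\<lambda>N. \<Sum>k<N. A n k * heat d (real k * \<mu> n) y)"
      by (intro ext) (subst Bochner_Integration.integral_sum, rule ik, simp only: sum_divide_distrib pk)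
    finally show "(\<lambda>k. A n k * heat d (real k * \<mu> n) y) sums I n y" by (simp add: sums_def)
  qed (use A \<mu> A_le in auto)
qed

text \<open>Invisible in the Fourier integral, but inherited in the limit from the nonnegative
  mixtures of heat kernels.\<close>

lemma stable_density_nonneg:
  assumes "1 \<le> d" "0 < t" "0 < \<alpha>" "\<alpha> < 2"
  shows "0 \<le> stable_density d \<alpha> t y"
proof -
  obtain A :: "nat \<Rightarrow> nat \<Rightarrow> real" and \<mu> :: "nat \<Rightarrow> real" and I S where
    A: "\<And>n k. 0 \<le> A n k" and
    sums: "\<And>n y. (\<lambda>k. A n k * heat d (real k * \<mu> n) y) sums I n y" and
    lim: "\<And>y. (\<lambda>n. I n y) \<longlonglongrightarrow> stable_density d \<alpha> t y"
    by (rule stable_mixture[OF assms]) blast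
  have "0 \<le> I n y" for n
    by (rule sums_le[OF _ sums_zero sums]) (simp add: A)
  then show ?thesis using lim[of y] by (intro LIMSEQ_le_const) auto
qed

text \<open>The mixture sends a power \<open>exp (- j * u)\<close> to
  \<open>exp (- t * j powr (\<alpha> / 2))\<close> in the limit. It therefore turns a polynomial
  approximation of the heat kernel in the time variable into one of the stable density, and the
  error weight \<open>1 - exp (- u)\<close> into \<open>1 - exp (- t)\<close>, which is of order
  \<open>t\<close>.\<close>

lemma stable_density_approx:
  assumes "1 \<le> d" "0 < t" "0 < \<alpha>" "\<alpha> < 2"
    and P: "poly P 0 = 0" "0 \<le> \<delta>" "\<And>u. 0 < u \<Longrightarrow> \<bar>heat d u y - poly P (exp (- u))\<bar> \<le> \<delta> * (1 - exp (- u))"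
  shows "\<bar>stable_density d \<alpha> t y - (\<Sum>j\<le>degree P. coeff P j * exp (- t * real j powr (\<alpha> / 2)))\<bar> \<le> \<delta> * (1 - exp (- t))"
proof -
  obtain A :: "nat \<Rightarrow> nat \<Rightarrow> real" and \<mu> :: "nat \<Rightarrow> real" and I S where
    A: "\<And>n k. 0 \<le> A n k" "\<And>n. A n 0 = 0" "\<And>n. 0 < \<mu> n" and
    I: "\<And>n y. (\<lambda>k. A n k * heat d (real k * \<mu> n) y) sums I n y"
    "\<And>y. (\<lambda>n. I n y) \<longlonglongrightarrow> stable_density d \<alpha> t y" and
    S: "\<And>n j. 0 < j \<Longrightarrow> (\<lambda>k. A n k * exp (- (real j * (real k * \<mu> n)))) sums S n j"
    "\<And>j. 0 < j \<Longrightarrow> (\<lambda>n. S n j) \<longlonglongrightarrow> exp (- t * real j powr (\<alpha> / 2))" and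
    A_le: "\<And>n N. (\<Sum>k<N. A n k) \<le> 1"
    by (rule stable_mixture[OF assms(1-4)]) blast
  \<comment> \<open>A constant term would call for \<open>S n 0\<close>, which is specified only for
    positive arguments.\<close>
  have c0: "coeff P 0 = 0" using P(1) by (simp add: poly_0_coeff_0)
  have "\<bar>I n y - (\<Sum>j\<le>degree P. coeff P j * S n j)\<bar> \<le> \<delta> * (1 - S n 1)" for n
  proof -
    define x where "x k = exp (- (real k * \<mu> n))" for k
    have polyx: "poly P (x k) = (\<Sum>j\<le>degree P. coeff P j * exp (- (real j * (real k * \<mu> n))))" for k
      unfolding poly_altdef x_def by (simp add: exp_of_nat_mult[symmetric])
    have "(\<lambda>k. A n k * poly P (x k)) sums (\<Sum>j\<le>degree P. coeff P j * S n j)"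
    proof -
      have "(\<lambda>k. \<Sum>j\<le>degree P. coeff P j * (A n k * exp (- (real j * (real k * \<mu> n))))) sums (\<Sum>j\<le>degree P. coeff P j * S n j)"
      proof (rule sums_sum)
        fix j
        show "(\<lambda>k. coeff P j * (A n k * exp (- (real j * (real k * \<mu> n))))) sums (coeff P j * S n j)"
          by (cases "j = 0") (auto simp: c0 intro!: sums_mult S)
      qed
      then show ?thesis unfolding polyx by (simp add: sum_distrib_left mult_ac)
    qed
    from sums_diff[OF I(1)[of n y] this]
    have diff: "(\<lambda>k. A n k * (heat d (real k * \<mu> n) y - poly P (x k))) sums (I n y - (\<Sum>j\<le>degree P. coeff P j * S n j))"
      by (simp add: algebra_simps)
    have sA: "summable (A n)"
      by (rule summableI_nonneg_bounded[of _ 1]) (use A A_le in auto)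
    \<comment> \<open>An upper bound on the mass suffices, since the mass enters the error with a
      positive sign.\<close>
    have "suminf (A n) \<le> 1" by (rule suminf_le_const[OF sA]) (use A_le in auto)
    have "(\<lambda>k. A n k - A n k * x k) sums (suminf (A n) - S n 1)"
      using S(1)[of 1 n] by (intro sums_diff summable_sums sA) (auto simp: x_def)
    from sums_mult[OF this, of \<delta>] have bnd: "(\<lambda>k. \<delta> * (A n k - A n k * x k)) sums (\<delta> * (suminf (A n) - S n 1))" .
    have le: "\<bar>A n k * (heat d (real k * \<mu> n) y - poly P (x k))\<bar> \<le> \<delta> * (A n k - A n k * x k)" for k
    proof (cases "k = 0")
      case False
      then have "\<bar>heat d (real k * \<mu> n) y - poly P (x k)\<bar> \<le> \<delta> * (1 - x k)"
        unfolding x_def using A(3)[of n] by (intro P(3)) simp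
      from mult_left_mono[OF this A(1)[of n k]]
      have "\<bar>A n k * (heat d (real k * \<mu> n) y - poly P (x k))\<bar> \<le> A n k * (\<delta> * (1 - x k))"
        using A(1)[of n k] by (simp only: abs_mult abs_of_nonneg)
      also have "\<dots> = \<delta> * (A n k - A n k * x k)" by (simp add: algebra_simps)
      finally show ?thesis .
    qed (simp add: A)
    have "I n y - (\<Sum>j\<le>degree P. coeff P j * S n j) \<le> \<delta> * (suminf (A n) - S n 1)"
      by (rule sums_le[OF _ diff bnd]) (use le abs_le_D1 in blast)
    moreover have "- (I n y - (\<Sum>j\<le>degree P. coeff P j * S n j)) \<le> \<delta> * (suminf (A n) - S n 1)"
      by (rule sums_le[OF _ sums_minus[OF diff] bnd]) (use le abs_le_D2 in blast)
    moreover have "\<delta> * (suminf (A n) - S n 1) \<le> \<delta> * (1 - S n 1)"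
      using P(2) \<open>suminf (A n) \<le> 1\<close> by (intro mult_left_mono) auto
    ultimately show ?thesis by linarith
  qed
  moreover have "(\<lambda>n. \<bar>I n y - (\<Sum>j\<le>degree P. coeff P j * S n j)\<bar>) \<longlonglongrightarrow>
     \<bar>stable_density d \<alpha> t y - (\<Sum>j\<le>degree P. coeff P j * exp (- t * real j powr (\<alpha> / 2)))\<bar>"
  proof (intro tendsto_rabs tendsto_diff I(2) tendsto_sum)
    fix j
    show "(\<lambda>n. coeff P j * S n j) \<longlonglongrightarrow> coeff P j * exp (- t * real j powr (\<alpha> / 2))"
      by (cases "j = 0") (auto simp: c0 intro!: tendsto_mult S(2)[simplified])
  qed
  moreover have "(\<lambda>n. \<delta> * (1 - S n 1)) \<longlonglongrightarrow> \<delta> * (1 - exp (- t))"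
    using S(2)[of 1] by (intro tendsto_intros) auto
  ultimately show ?thesis by (intro LIMSEQ_le) auto
qed

section \<open>Small-time asymptotics\<close>

lemma abs_Gamma_minus:
  assumes "0 < b" "b < (1::real)"
  shows "\<bar>Gamma (- b)\<bar> = Gamma (1 - b) / b"
proof -
  have "- b \<notin> \<int>\<^sub>\<le>\<^sub>0"
  proof
    assume "- b \<in> \<int>\<^sub>\<le>\<^sub>0"
    then have "- b \<in> \<int>" by (metis Ints_of_int nonpos_Ints_cases)
    then have "b \<in> \<int>" by simp
    then obtain k where k: "b = of_int k" by (elim Ints_cases)
    then have "0 < k" "k < 1" using assms by auto
    then show False by simp
  qed
  then have "Gamma (- b + 1) = - b * Gamma (- b)" by (intro Gamma_plus1) 
  then have "Gamma (- b) = - (Gamma (1 - b) / b)" using assms by (simp add: field_simps)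
  then show ?thesis using assms Gamma_real_pos[of "1 - b"] by simp
qed

text \<open>Averaging heat kernels over the Levy measure of the subordinator gives the jump kernel
  of the fractional energy; this is the point where the normalisation \<open>frac_const\<close> is
  matched. The integral in \<open>u\<close> is an inverse Gamma integral with shape
  \<open>(d + \<alpha>) / 2\<close>. The surplus factor is the constant of
  \<open>nn_integral_levy\<close> at \<open>l = 1\<close>.\<close>

lemma nn_integral_heat_levy:
  assumes "0 < \<alpha>" "\<alpha> < 2" "0 < enorm d y"
  shows "(\<integral>\<^sup>+u. ennreal (indicator {0<..} u * heat d u y * u powr (- 1 - \<alpha> / 2)) \<partial>lborel)
    = ennreal (frac_const d \<alpha> / enorm d y powr (real d + \<alpha>) * (Gamma (1 - \<alpha> / 2) / (\<alpha> / 2)))"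
proof -
  define s where "s = (real d + \<alpha>) / 2"
  define a where "a = (enorm d y)\<^sup>2 / 4"
  define r where "r = enorm d y"
  have s: "s > 0" and a: "a > 0" and r: "r > 0" using assms by (auto simp: s_def a_def r_def add_nonneg_pos)
  have h: "indicator {0<..} u * heat d u y * u powr (- 1 - \<alpha> / 2) =
      (4 * pi) powr (- real d / 2) * (indicator {0<..} u * (u powr (- 1 - s) * exp (- a / u)))" for u :: real
  proof (cases "u > 0")
    case True
    have "(4 * pi * u) powr (- real d / 2) * u powr (- 1 - \<alpha> / 2) = (4 * pi) powr (- real d / 2) * (u powr (- real d / 2) * u powr (- 1 - \<alpha> / 2))"
      using True by (subst powr_mult) auto
    also have "u powr (- real d / 2) * u powr (- 1 - \<alpha> / 2) = u powr (- 1 - s)"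
      unfolding powr_add[symmetric] by (rule arg_cong[where f = "(powr) u"]) (simp add: s_def field_simps)
    finally show ?thesis using True by (simp add: heat_def a_def mult_ac)
  qed simp
  have "(\<integral>\<^sup>+u. ennreal (indicator {0<..} u * heat d u y * u powr (- 1 - \<alpha> / 2)) \<partial>lborel)
    = ennreal ((4 * pi) powr (- real d / 2)) * ennreal (Gamma s * a powr (- s))"
    unfolding h nn_integral_inverse_Gamma[OF s a, symmetric]
    by (subst nn_integral_cmult[symmetric]) (auto simp: ennreal_mult)
  also have "\<dots> = ennreal ((4 * pi) powr (- real d / 2) * (Gamma s * a powr (- s)))"
    using Gamma_real_pos[OF s] by (simp add: ennreal_mult)
  also have "(4 * pi) powr (- real d / 2) * (Gamma s * a powr (- s)) = frac_const d \<alpha> / enorm d y powr (real d + \<alpha>) * (Gamma (1 - \<alpha> / 2) / (\<alpha> / 2))"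
  proof -
    have 1: "(4 * pi) powr (- real d / 2) = 4 powr (- real d / 2) * (1 / pi powr (real d / 2))"
      by (subst powr_mult) (auto simp: powr_minus_divide)
    have 2: "a powr (- s) = 4 powr s * (1 / r powr (real d + \<alpha>))"
    proof -
      have "a powr (- s) = (4 / r\<^sup>2) powr s" using r by (simp add: a_def r_def powr_minus powr_divide)
      also have "\<dots> = 4 powr s / (r powr 2) powr s" using r by (simp add: powr_divide)
      also have "(r powr 2) powr s = r powr (real d + \<alpha>)"
      proof -
        have "2 * s = real d + \<alpha>" by (simp add: s_def)
        then show ?thesis by (simp only: powr_powr)
      qed
      finally show ?thesis by simp
    qed
    have 3: "4 powr (- real d / 2) * 4 powr s = 2 powr \<alpha>"
    proof -
      have "4 powr (- real d / 2) * 4 powr s = (2 powr 2) powr (\<alpha> / 2)"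
        unfolding powr_add[symmetric] by (simp add: s_def field_simps)
      also have "\<dots> = 2 powr \<alpha>" by (simp only: powr_powr) simp
      finally show ?thesis .
    qed
    have G: "\<bar>Gamma (- \<alpha> / 2)\<bar> = Gamma (1 - \<alpha> / 2) / (\<alpha> / 2)"
      using abs_Gamma_minus[of "\<alpha> / 2"] assms by simp
    have "0 < Gamma (1 - \<alpha> / 2)" using assms by (intro Gamma_real_pos) simp
    then have "0 < Gamma (1 - \<alpha> / 2) / (\<alpha> / 2)" using assms by (intro divide_pos_pos) auto
    then have G0: "Gamma (1 - \<alpha> / 2) / (\<alpha> / 2) \<noteq> 0" by linarith
    have "(4 * pi) powr (- real d / 2) * (Gamma s * a powr (- s)) = (4 powr (- real d / 2) * 4 powr s) * Gamma s / pi powr (real d / 2) / r powr (real d + \<alpha>)"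
      unfolding 1 2 by (simp add: mult_ac)
    also have "\<dots> = frac_const d \<alpha> / r powr (real d + \<alpha>) * (Gamma (1 - \<alpha> / 2) / (\<alpha> / 2))"
      unfolding 3 frac_const_def G s_def[symmetric] using G0 by (simp add: field_simps)
    finally show ?thesis by (simp add: r_def)
  qed
  finally show ?thesis .
qed

text \<open>The Bernstein polynomials of \<open>heat d u y / (1 - exp (- u))\<close>, as a function of \<open>x = exp (- u) \<in> [0, 1]\<close>.
  The factor \<open>1 - exp (- u)\<close> makes the error integrable against the Levy measure of the subordinator.\<close>

lemma heat_poly_approx:
  assumes "1 \<le> d" "0 < enorm d y" "0 < \<delta>"
  obtains P :: "real poly" where "poly P 0 = 0" "poly P 1 = 0"
    "\<And>u. 0 < u \<Longrightarrow> \<bar>heat d u y - poly P (exp (- u))\<bar> \<le> \<delta> * (1 - exp (- u))"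
proof -
  define s where "s = real d / 2"
  define r where "r = (enorm d y)\<^sup>2 / 4"
  have s: "s > 0" and r: "r > 0" using assms by (auto simp: s_def r_def)
  define g where "g x = (4 * pi * (- ln x)) powr (- s) * exp (- r / (- ln x)) / (1 - x)" for x :: real
  have g_heat: "g x = heat d (- ln x) y / (1 - x)" for x
    by (simp add: g_def heat_def s_def r_def)
  \<comment> \<open>\<open>g\<close> is extended by \<open>0\<close> to both ends: near
    \<open>x = 1\<close>, that is for small \<open>u\<close>, the factor
    \<open>exp (- r / u)\<close> beats every power, and near \<open>x = 0\<close> the heat kernel
    decays like \<open>u powr (- d / 2)\<close>.\<close>
  define w where "w x = (if 0 < x \<and> x < 1 then g x else 0)" for x
  have g0: "(g \<longlongrightarrow> 0) (at_right 0)" unfolding g_def using s r by real_asymp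
  have g1: "(g \<longlongrightarrow> 0) (at_left 1)" unfolding g_def using s r by real_asymp
  have cont: "continuous_on {0..1} w"
    unfolding continuous_on_def
  proof
    fix x :: real assume x: "x \<in> {0..1}"
    consider "x = 0" | "x = 1" | "0 < x" "x < 1" using x by force
    then show "(w \<longlongrightarrow> w x) (at x within {0..1})"
    proof cases
      case 1
      have "\<forall>\<^sub>F x in at_right (0::real). w x = g x"
        by (rule eventually_at_rightI[of 0 1]) (auto simp: w_def)
      from tendsto_cong[OF this] g0 have "(w \<longlongrightarrow> 0) (at_right 0)" by blast
      moreover have "w 0 = 0" by (simp add: w_def)
      ultimately show ?thesis by (simp add: 1 at_within_Icc_at_right)
    next
      case 2
      have "\<forall>\<^sub>F x in at_left (1::real). w x = g x"
        by (rule eventually_at_leftI[of 0 1]) (auto simp: w_def)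
      from tendsto_cong[OF this] g1 have "(w \<longlongrightarrow> 0) (at_left 1)" by blast
      moreover have "w 1 = 0" by (simp add: w_def)
      ultimately show ?thesis by (simp add: 2 at_within_Icc_at_left)
    next
      case 3
      have "isCont g x" unfolding g_def using 3 by (intro continuous_intros) auto
      then have "(g \<longlongrightarrow> g x) (at x)" by (simp add: isCont_def)
      moreover have "\<forall>\<^sub>F x in at x. w x = g x"
      proof -
        have "\<forall>\<^sub>F x in at x. x \<in> {0<..<1::real}" using 3 by (intro eventually_at_in_open') auto
        then show ?thesis by eventually_elim (auto simp: w_def)
      qed
      ultimately have "(w \<longlongrightarrow> w x) (at x)" using tendsto_cong[of w g "at x"] 3 by (simp add: w_def)
      then show ?thesis by (rule tendsto_within_subset) simp
    qed
  qed
  obtain n where n: "\<And>x. x \<in> {0..1} \<Longrightarrow> \<bar>w x - (\<Sum>k\<le>n. w (real k / real n) * Bernstein n k x)\<bar> < \<delta>"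
    using Bernstein_Weierstrass[OF cont assms(3)] by blast
  \<comment> \<open>The factor \<open>1 - x\<close> gives \<open>poly P 1 = 0\<close> and multiplies
    the uniform error; \<open>poly P 0 = 0\<close> because at \<open>0\<close> only the Bernstein
    polynomial with \<open>k = 0\<close> survives and \<open>w 0 = 0\<close>.\<close>
  define P :: "real poly" where "P = [:1, -1:] * (\<Sum>k\<le>n. smult (w (real k / real n) * real (n choose k)) (monom 1 k * [:1, -1:] ^ (n - k)))"
  have P: "poly P x = (1 - x) * (\<Sum>k\<le>n. w (real k / real n) * Bernstein n k x)" for x
  proof -
    have "poly [:1, -1:] x = 1 - x" by simp
    then show ?thesis
      unfolding P_def poly_mult poly_sum poly_smult poly_power poly_monom Bernstein_def
      by (simp add: mult_ac)
  qed
  show ?thesis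
  proof (rule that[of P])
    show "poly P 1 = 0" by (simp add: P)
    have "w (real k / real n) * Bernstein n k 0 = 0" if "k \<in> {..n}" for k
      by (cases "k = 0") (auto simp: w_def Bernstein_def)
    then have "(\<Sum>k\<le>n. w (real k / real n) * Bernstein n k 0) = 0" by (intro sum.neutral ballI)
    then show "poly P 0 = 0" by (simp add: P)
    fix u :: real assume u: "0 < u"
    define x where "x = exp (- u)"
    have x: "0 < x" "x < 1" using u by (auto simp: x_def)
    have h: "heat d u y = (1 - x) * w x" using x by (simp add: w_def g_heat) (simp add: x_def)
    have "\<bar>heat d u y - poly P x\<bar> = (1 - x) * \<bar>w x - (\<Sum>k\<le>n. w (real k / real n) * Bernstein n k x)\<bar>"
      unfolding h P using x by (simp only: right_diff_distrib[symmetric] abs_mult)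
    also have "\<dots> \<le> (1 - x) * \<delta>" using n[of x] x by (intro mult_left_mono) auto
    finally show "\<bar>heat d u y - poly P (exp (- u))\<bar> \<le> \<delta> * (1 - exp (- u))" by (simp add: x_def mult.commute)
  qed
qed

lemma has_bochner_levy:
  fixes b l :: real
  assumes "0 < b" "b < 1" "l \<ge> 0"
  shows "has_bochner_integral lborel (\<lambda>u. indicator {0<..} u * (1 - exp (- l * u)) * u powr (- 1 - b)) (l powr b * (Gamma (1 - b) / b))"
  using nn_integral_levy[OF assms] Gamma_real_pos[of "1 - b"] assms
  by (intro has_bochner_integral_nn_integral) (auto simp: indicator_def)

text \<open>Both sides are compared with the same polynomial \<open>P\<close> in
  \<open>exp (- u)\<close>. On the left, the mixture bound compares the quotient with
  \<open>q t / t\<close>, a combination of difference quotients at \<open>0\<close> with limit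
  \<open>l\<close>; on the right, integrating the pointwise error of \<open>P\<close> against the
  Levy measure gives \<open>\<bar>L - l\<bar> \<le> \<delta>\<close>.\<close>

lemma stable_density_small_time:
  assumes d: "1 \<le> d" and \<alpha>: "0 < \<alpha>" "\<alpha> < 2" and y: "0 < enorm d y"
  shows "((\<lambda>t. stable_density d \<alpha> t y / t) \<longlongrightarrow> frac_const d \<alpha> / enorm d y powr (real d + \<alpha>)) (at_right 0)"
proof (rule tendstoI)
  fix e :: real assume e: "0 < e"
  define b where "b = \<alpha> / 2"
  have b: "0 < b" "b < 1" using \<alpha> by (auto simp: b_def)
  define L where "L = frac_const d \<alpha> / enorm d y powr (real d + \<alpha>)"
  define W where "W = Gamma (1 - b) / b"
  have W: "W > 0" using b Gamma_real_pos[of "1 - b"] by (simp add: W_def)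
  have L0: "0 \<le> L" unfolding L_def frac_const_def using \<alpha>
    by (intro divide_nonneg_nonneg mult_nonneg_nonneg Gamma_real_nonneg) auto
  \<comment> \<open>Three errors of at most \<open>\<delta>\<close> each arise below; the fourth
    quarter is slack.\<close>
  define \<delta> where "\<delta> = e / 4"
  have \<delta>: "\<delta> > 0" using e by (simp add: \<delta>_def)
  obtain P where P: "poly P 0 = 0" "poly P 1 = 0"
    "\<And>u. 0 < u \<Longrightarrow> \<bar>heat d u y - poly P (exp (- u))\<bar> \<le> \<delta> * (1 - exp (- u))"
    by (rule heat_poly_approx[OF d y \<delta>]) blast
  \<comment> \<open>The vanishing coefficient sum does two things: it lets
    \<open>poly P (exp (- u))\<close> be written through the Levy-integrable functions
    \<open>1 - exp (- j * u)\<close>, and it makes \<open>q t / t\<close> a combination of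
    difference quotients.\<close>
  have c1: "(\<Sum>j\<le>degree P. coeff P j) = 0" using P(2) by (simp add: poly_altdef)
  define l where "l = (\<Sum>j\<le>degree P. coeff P j * (- (real j powr b)))"
  let ?\<kappa> = "\<lambda>u::real. indicator {0<..} u * u powr (- 1 - b)"
  have hh: "has_bochner_integral lborel (\<lambda>u. indicator {0<..} u * heat d u y * u powr (- 1 - b)) (L * W)"
  proof (rule has_bochner_integral_nn_integral)
    show "(\<lambda>u. indicator {0<..} u * heat d u y * u powr (- 1 - b)) \<in> borel_measurable lborel"
      unfolding heat_def by measurable
    show "(\<integral>\<^sup>+u. ennreal (indicator {0<..} u * heat d u y * u powr (- 1 - b)) \<partial>lborel) = ennreal (L * W)"
      using nn_integral_heat_levy[OF \<alpha> y] unfolding b_def L_def W_def .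
  qed (use L0 W in auto)
  have hR: "has_bochner_integral lborel (\<lambda>u. \<Sum>j\<le>degree P. coeff P j * (- (indicator {0<..} u * (1 - exp (- real j * u)) * u powr (- 1 - b))))
     (\<Sum>j\<le>degree P. coeff P j * (- (real j powr b * W)))"
    unfolding W_def
    by (intro has_bochner_integral_sum has_bochner_integral_mult_right has_bochner_integral_minus has_bochner_levy b) auto
  have R: "(\<Sum>j\<le>degree P. coeff P j * (- (indicator {0<..} u * (1 - exp (- real j * u)) * u powr (- 1 - b)))) = ?\<kappa> u * poly P (exp (- u))" for u
  proof -
    have "(\<Sum>j\<le>degree P. coeff P j * (- (indicator {0<..} u * (1 - exp (- real j * u)) * u powr (- 1 - b))))
      = (\<Sum>j\<le>degree P. ?\<kappa> u * (coeff P j * exp (- real j * u)) - ?\<kappa> u * coeff P j)"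
      by (intro sum.cong) (auto simp: algebra_simps)
    also have "\<dots> = ?\<kappa> u * (\<Sum>j\<le>degree P. coeff P j * exp (- real j * u)) - ?\<kappa> u * (\<Sum>j\<le>degree P. coeff P j)"
      by (simp add: sum_subtractf sum_distrib_left)
    finally show ?thesis by (simp add: c1 poly_altdef exp_of_nat_mult[symmetric])
  qed
  have sl: "(\<Sum>j\<le>degree P. coeff P j * (- (real j powr b * W))) = l * W"
    unfolding l_def sum_distrib_right by (intro sum.cong) auto
  have hR': "has_bochner_integral lborel (\<lambda>u. ?\<kappa> u * poly P (exp (- u))) (l * W)"
    using hR unfolding R sl .
  have hd: "has_bochner_integral lborel (\<lambda>u. indicator {0<..} u * heat d u y * u powr (- 1 - b) - ?\<kappa> u * poly P (exp (- u))) (L * W - l * W)"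
    by (rule has_bochner_integral_diff[OF hh hR'])
  have h1: "has_bochner_integral lborel (\<lambda>u. \<delta> * (indicator {0<..} u * (1 - exp (- 1 * u)) * u powr (- 1 - b))) (\<delta> * W)"
    using has_bochner_integral_mult_right[OF has_bochner_levy[OF b, of 1], of \<delta>] by (simp add: W_def)
  \<comment> \<open>\<open>W\<close> is the integral of \<open>1 - exp (- u)\<close> against the
    Levy measure, so it scales values and error alike and cancels.\<close>
  have "norm (L * W - l * W) \<le> \<delta> * W"
  proof -
    have "norm (L * W - l * W) \<le> (\<integral>u. norm (indicator {0<..} u * heat d u y * u powr (- 1 - b) - ?\<kappa> u * poly P (exp (- u))) \<partial>lborel)"
      unfolding has_bochner_integral_integral_eq[OF hd, symmetric] by (rule integral_norm_bound)
    also have "\<dots> \<le> (\<integral>u. \<delta> * (indicator {0<..} u * (1 - exp (- 1 * u)) * u powr (- 1 - b)) \<partial>lborel)"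
    proof (rule integral_mono)
      show "integrable lborel (\<lambda>u. norm (indicator {0<..} u * heat d u y * u powr (- 1 - b) - ?\<kappa> u * poly P (exp (- u))))"
        using hd by (intro integrable_norm) (auto simp: has_bochner_integral_iff)
      show "integrable lborel (\<lambda>u. \<delta> * (indicator {0<..} u * (1 - exp (- 1 * u)) * u powr (- 1 - b)))"
        using h1 by (auto simp: has_bochner_integral_iff)
      fix u :: real
      show "norm (indicator {0<..} u * heat d u y * u powr (- 1 - b) - ?\<kappa> u * poly P (exp (- u))) \<le> \<delta> * (indicator {0<..} u * (1 - exp (- 1 * u)) * u powr (- 1 - b))"
      proof (cases "u > 0")
        case True
        have "indicator {0<..} u * heat d u y * u powr (- 1 - b) - ?\<kappa> u * poly P (exp (- u)) = (heat d u y - poly P (exp (- u))) * u powr (- 1 - b)"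
          using True by (simp add: algebra_simps)
        then have "norm (indicator {0<..} u * heat d u y * u powr (- 1 - b) - ?\<kappa> u * poly P (exp (- u))) = \<bar>heat d u y - poly P (exp (- u))\<bar> * u powr (- 1 - b)"
          by (simp add: abs_mult)
        also have "\<dots> \<le> (\<delta> * (1 - exp (- u))) * u powr (- 1 - b)" using P(3)[OF True] by (intro mult_right_mono) auto
        finally show ?thesis using True by (simp add: mult.assoc)
      qed simp
    qed
    also have "\<dots> = \<delta> * W" using h1 by (rule has_bochner_integral_integral_eq)
    finally show ?thesis .
  qed
  moreover have "L * W - l * W = (L - l) * W" by (simp add: left_diff_distrib)
  ultimately have "\<bar>L - l\<bar> * W \<le> \<delta> * W" using W by (simp add: abs_mult)
  then have Ll: "\<bar>L - l\<bar> \<le> \<delta>" using W by simp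
  define q where "q t = (\<Sum>j\<le>degree P. coeff P j * exp (- t * real j powr b))" for t
  have ql: "((\<lambda>t. \<Sum>j\<le>degree P. coeff P j * ((exp (- t * real j powr b) - 1) / t)) \<longlongrightarrow> l) (at_right 0)"
    unfolding l_def
  proof (intro tendsto_sum tendsto_mult tendsto_const)
    fix j
    have "((\<lambda>t. exp (- t * real j powr b)) has_real_derivative - (real j powr b)) (at 0)"
      by (auto intro!: derivative_eq_intros)
    then have "((\<lambda>t. (exp (- t * real j powr b) - 1) / t) \<longlongrightarrow> - (real j powr b)) (at 0)"
      by (simp add: has_field_derivative_iff)
    then show "((\<lambda>t. (exp (- t * real j powr b) - 1) / t) \<longlongrightarrow> - (real j powr b)) (at_right 0)"
      by (rule tendsto_mono[rotated]) (simp add: at_le)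
  qed
  have qq: "(\<lambda>t. \<Sum>j\<le>degree P. coeff P j * ((exp (- t * real j powr b) - 1) / t)) = (\<lambda>t. q t / t)"
  proof
    fix t
    have "(\<Sum>j\<le>degree P. coeff P j * ((exp (- t * real j powr b) - 1) / t)) = (q t - (\<Sum>j\<le>degree P. coeff P j)) / t"
      unfolding q_def sum_subtractf[symmetric] sum_divide_distrib
      by (intro sum.cong) (auto simp: right_diff_distrib diff_divide_distrib)
    then show "(\<Sum>j\<le>degree P. coeff P j * ((exp (- t * real j powr b) - 1) / t)) = q t / t" by (simp add: c1)
  qed
  have "\<forall>\<^sub>F t in at_right 0. dist (q t / t) l < \<delta>"
    by (rule tendstoD[OF ql[unfolded qq] \<delta>])
  moreover have "\<forall>\<^sub>F t in at_right (0::real). t \<in> {0<..<1}"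
    by (rule eventually_at_rightI[of 0 1]) auto
  ultimately show "\<forall>\<^sub>F t in at_right 0. dist (stable_density d \<alpha> t y / t) (frac_const d \<alpha> / enorm d y powr (real d + \<alpha>)) < e"
  proof eventually_elim
    case (elim t)
    then have t: "t > 0" by simp
    have "\<bar>stable_density d \<alpha> t y - q t\<bar> \<le> \<delta> * (1 - exp (- t))"
      unfolding q_def b_def using P \<delta> by (intro stable_density_approx d t \<alpha>) auto
    also have "\<dots> \<le> \<delta> * t" using \<delta> exp_ge_add_one_self[of "- t"] by (intro mult_left_mono) auto
    finally have "\<bar>(stable_density d \<alpha> t y - q t) / t\<bar> \<le> \<delta>"
      using t by (simp add: abs_divide pos_divide_le_eq)
    then have "\<bar>stable_density d \<alpha> t y / t - q t / t\<bar> \<le> \<delta>" by (simp add: diff_divide_distrib)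
    moreover have "\<bar>q t / t - l\<bar> < \<delta>" using elim by (simp add: dist_real_def)
    ultimately have "\<bar>stable_density d \<alpha> t y / t - L\<bar> < 4 * \<delta>" using Ll \<delta> by linarith
    then show ?case by (simp add: L_def dist_real_def \<delta>_def)
  qed
qed

section \<open>The convolution semigroup\<close>

lemma einner_diff_right: "einner d \<xi> (\<lambda>i. y i - w i) = einner d \<xi> y - einner d \<xi> w"
  by (simp add: einner_def right_diff_distrib sum_subtractf)

lemma einner_affine: "einner d (affine_map d b c x) y = einner d b y + c * einner d x y"
  by (simp add: einner_def affine_map_def algebra_simps sum.distrib sum_distrib_left)

lemma measurable_einner_const' [measurable (raw)]:
  assumes "f \<in> measurable M (leb d)"
  shows "(\<lambda>x. einner d (f x) y) \<in> borel_measurable M"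
  using measurable_compose[OF assms measurable_einner_const] .

lemma stable_density_cong:
  "(\<And>i. i < d \<Longrightarrow> y i = y' i) \<Longrightarrow> stable_density d \<alpha> t y = stable_density d \<alpha> t y'"
  unfolding stable_density_def using einner_cong[of d _ _ y y'] by simp

lemma measurable_stable_density [measurable]: "stable_density d \<alpha> t \<in> borel_measurable (leb d)"
  unfolding stable_density_def by measurable

lemma measurable_stable_diff [measurable (raw)]:
  assumes [measurable]: "f \<in> measurable M (leb d)" "g \<in> measurable M (leb d)"
  shows "(\<lambda>x. stable_density d \<alpha> t (\<lambda>i. f x i - g x i)) \<in> borel_measurable M"
proof -
  have [measurable]: "(\<lambda>x. \<lambda>i\<in>{..<d}. f x i - g x i) \<in> measurable M (leb d)"
  proof (rule measurable_restrict)
    fix i assume "i \<in> {..<d}"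
    then show "(\<lambda>x. f x i - g x i) \<in> measurable M lborel"
      using measurable_diff_leb[OF assms, of i] by simp
  qed
  have "(\<lambda>x. stable_density d \<alpha> t (\<lambda>i\<in>{..<d}. f x i - g x i)) \<in> borel_measurable M"
    by measurable
  also have "(\<lambda>x. stable_density d \<alpha> t (\<lambda>i\<in>{..<d}. f x i - g x i)) = (\<lambda>x. stable_density d \<alpha> t (\<lambda>i. f x i - g x i))"
    by (intro ext stable_density_cong) simp
  finally show ?thesis .
qed

lemma integrable_leb_pairI:
  fixes f :: "(nat \<Rightarrow> real) \<Rightarrow> (nat \<Rightarrow> real) \<Rightarrow> real"
  assumes [measurable]: "case_prod f \<in> borel_measurable (leb d \<Otimes>\<^sub>M leb d)"
    and b: "\<And>x. x \<in> space (leb d) \<Longrightarrow> (\<integral>\<^sup>+y. ennreal \<bar>f x y\<bar> \<partial>leb d) \<le> ennreal (F x)"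
    and F: "integrable (leb d) F" "\<And>x. 0 \<le> F x"
  shows "integrable (leb d \<Otimes>\<^sub>M leb d) (case_prod f)"
proof (rule integrableI_bounded)
  have "(\<integral>\<^sup>+z. ennreal (norm (case_prod f z)) \<partial>(leb d \<Otimes>\<^sub>M leb d)) = (\<integral>\<^sup>+x. (\<integral>\<^sup>+y. ennreal \<bar>f x y\<bar> \<partial>leb d) \<partial>leb d)"
    by (subst leb.nn_integral_fst[symmetric]) auto
  also have "\<dots> \<le> (\<integral>\<^sup>+x. ennreal (F x) \<partial>leb d)" using b by (intro nn_integral_mono) auto
  also have "\<dots> < \<infinity>" using F by (simp add: nn_integral_eq_integral)
  finally show "(\<integral>\<^sup>+z. ennreal (norm (case_prod f z)) \<partial>(leb d \<Otimes>\<^sub>M leb d)) < \<infinity>" .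
qed simp

lemma integrable_leb_pair_prodI:
  fixes f :: "(nat \<Rightarrow> real) \<Rightarrow> (nat \<Rightarrow> real) \<Rightarrow> real"
  assumes "case_prod f \<in> borel_measurable (leb d \<Otimes>\<^sub>M leb d)"
    and b: "\<And>x y. \<bar>f x y\<bar> \<le> F x * G y"
    and F: "integrable (leb d) F" "\<And>x. 0 \<le> F x" and G: "integrable (leb d) G" "\<And>x. 0 \<le> G x"
  shows "integrable (leb d \<Otimes>\<^sub>M leb d) (case_prod f)"
proof (rule integrable_leb_pairI[where F = "\<lambda>x. F x * integral\<^sup>L (leb d) G"])
  note [measurable] = borel_measurable_integrable[OF G(1)]
  fix x
  have "(\<integral>\<^sup>+y. ennreal \<bar>f x y\<bar> \<partial>leb d) \<le> (\<integral>\<^sup>+y. ennreal (F x) * ennreal (G y) \<partial>leb d)"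
    using b F G by (intro nn_integral_mono) (auto simp: ennreal_mult[symmetric])
  also have "\<dots> = ennreal (F x * integral\<^sup>L (leb d) G)"
    using F G by (simp add: nn_integral_cmult nn_integral_eq_integral ennreal_mult integral_nonneg)
  finally show "(\<integral>\<^sup>+y. ennreal \<bar>f x y\<bar> \<partial>leb d) \<le> ennreal (F x * integral\<^sup>L (leb d) G)" .
qed (use assms in \<open>auto intro!: mult_nonneg_nonneg integral_nonneg\<close>)

section \<open>Total mass, characteristic function and semigroup property of the stable
  density\<close>

locale stable_kernel =
  fixes d :: nat and \<alpha> :: real
  assumes d1: "1 \<le> d" and \<alpha>0: "0 < \<alpha>" and \<alpha>2: "\<alpha> < 2"
begin

abbreviation p :: "real \<Rightarrow> (nat \<Rightarrow> real) \<Rightarrow> real" where "p t \<equiv> stable_density d \<alpha> t"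

definition \<phi> :: "real \<Rightarrow> (nat \<Rightarrow> real) \<Rightarrow> real" where "\<phi> t \<xi> = exp (- t * enorm d \<xi> powr \<alpha>)"

lemma measurable_\<phi> [measurable]: "\<phi> t \<in> borel_measurable (leb d)" unfolding \<phi>_def by measurable

lemma \<phi>_pos: "0 < \<phi> t \<xi>" by (simp add: \<phi>_def)

lemma \<phi>_le_1: "0 < t \<Longrightarrow> \<phi> t \<xi> \<le> 1" by (simp add: \<phi>_def)

lemma \<phi>_integrable: "0 < t \<Longrightarrow> integrable (leb d) (\<phi> t)"
  unfolding \<phi>_def using integrable_exp_powr[OF d1 _ \<alpha>0] .

lemma p_eq: "0 < t \<Longrightarrow> p t y = (\<integral>\<xi>. \<phi> t \<xi> * cos (einner d \<xi> y) \<partial>leb d) / (2 * pi) ^ d"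
  unfolding \<phi>_def by (rule stable_density_cos[OF d1 _ \<alpha>0])

lemma p_nonneg: "0 < t \<Longrightarrow> 0 \<le> p t y"
  by (rule stable_density_nonneg[OF d1 _ \<alpha>0 \<alpha>2])

lemma p_bound: "0 < t \<Longrightarrow> p t y \<le> (\<integral>\<xi>. \<phi> t \<xi> \<partial>leb d) / (2 * pi) ^ d"
  unfolding p_eq
proof (intro divide_right_mono integral_mono)
  assume t: "0 < t"
  show "integrable (leb d) (\<lambda>\<xi>. \<phi> t \<xi> * cos (einner d \<xi> y))"
    by (rule Bochner_Integration.integrable_bound[OF \<phi>_integrable[OF t]])
       (auto simp: abs_mult intro!: mult_left_le)
  show "\<phi> t \<xi> * cos (einner d \<xi> y) \<le> \<phi> t \<xi>" for \<xi>
    using \<phi>_pos[of t \<xi>] by (intro mult_left_le) auto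
qed (auto intro: \<phi>_integrable)

text \<open>An approximate identity: Gaussians of width \<open>1 / (n + 1)\<close> act on the
  bounded continuous function \<open>\<phi> t\<close>. The constant \<open>pi powr (d / 2)\<close>
  is the mass of the unnormalised Gaussian.\<close>

lemma gauss_convolution_limit:
  assumes t: "0 < t"
  shows "(\<lambda>n. \<integral>w. \<phi> t (affine_map d \<zeta> (1 / real (Suc n)) w) * exp (- 1 * (enorm d w)\<^sup>2) \<partial>leb d) \<longlonglongrightarrow> \<phi> t \<zeta> * pi powr (real d / 2)"
proof -
  have g: "integrable (leb d) (\<lambda>w. exp (- 1 * (enorm d w)\<^sup>2))" by (rule gauss_cos(1)) simp
  have "(\<lambda>n. \<integral>w. \<phi> t (affine_map d \<zeta> (1 / real (Suc n)) w) * exp (- 1 * (enorm d w)\<^sup>2) \<partial>leb d) \<longlonglongrightarrow>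
    (\<integral>w. \<phi> t \<zeta> * exp (- 1 * (enorm d w)\<^sup>2) \<partial>leb d)"
  proof (rule integral_dominated_convergence[OF _ _ g])
    show "AE w in leb d. (\<lambda>n. \<phi> t (affine_map d \<zeta> (1 / real (Suc n)) w) * exp (- 1 * (enorm d w)\<^sup>2)) \<longlonglongrightarrow> \<phi> t \<zeta> * exp (- 1 * (enorm d w)\<^sup>2)"
    proof (intro AE_I2 tendsto_mult tendsto_const)
      fix w
      have inv: "(\<lambda>n. 1 / real (Suc n)) \<longlonglongrightarrow> 0" by real_asymp
      have "(\<lambda>n. sqrt (\<Sum>i<d. (\<zeta> i + 1 / real (Suc n) * w i)\<^sup>2)) \<longlonglongrightarrow> sqrt (\<Sum>i<d. (\<zeta> i + 0 * w i)\<^sup>2)"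
        by (intro tendsto_intros inv)
      moreover have "enorm d (affine_map d \<zeta> c w) = sqrt (\<Sum>i<d. (\<zeta> i + c * w i)\<^sup>2)" for c
        unfolding enorm_def L2_set_def by (intro arg_cong[where f = sqrt] sum.cong) (auto simp: affine_map_def)
      ultimately have "(\<lambda>n. enorm d (affine_map d \<zeta> (1 / real (Suc n)) w)) \<longlonglongrightarrow> enorm d \<zeta>"
        by (simp add: enorm_def L2_set_def)
      then show "(\<lambda>n. \<phi> t (affine_map d \<zeta> (1 / real (Suc n)) w)) \<longlonglongrightarrow> \<phi> t \<zeta>"
        unfolding \<phi>_def using \<alpha>0 by (intro tendsto_intros tendsto_powr') auto
    qed
    show "AE w in leb d. norm (\<phi> t (affine_map d \<zeta> (1 / real (Suc n)) w) * exp (- 1 * (enorm d w)\<^sup>2)) \<le> exp (- 1 * (enorm d w)\<^sup>2)" for n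
      using \<phi>_le_1[OF t] \<phi>_pos[of t] by (auto simp: abs_mult less_imp_le intro!: mult_left_le_one_le)
  qed measurable
  then show ?thesis using gauss_cos(3)[of 1 d] by simp
qed

text \<open>The inversion formula is damped by a Gaussian of variance tending to infinity, since
  integrability of \<open>p t\<close> is only a consequence.\<close>

lemma gauss_p_cos:
  assumes t: "0 < t"
  shows "(\<lambda>n. \<integral>y. p t y * cos (einner d \<zeta> y) * exp (- (1 / (2 * real (Suc n)))\<^sup>2 * (enorm d y)\<^sup>2) \<partial>leb d) \<longlonglongrightarrow> \<phi> t \<zeta>"
proof -
  define N where "N \<zeta> n = (\<integral>w. \<phi> t (affine_map d \<zeta> (1 / real (Suc n)) w) * exp (- 1 * (enorm d w)\<^sup>2) \<partial>leb d)" for \<zeta> n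
  have eq: "(\<integral>y. p t y * cos (einner d \<zeta> y) * exp (- (1 / (2 * real (Suc n)))\<^sup>2 * (enorm d y)\<^sup>2) \<partial>leb d)
     = (N \<zeta> n + N (\<lambda>i. - \<zeta> i) n) / 2 / pi powr (real d / 2)" for n
  proof -
    \<comment> \<open>Damping by \<open>exp (- \<delta> * |y|^2)\<close> corresponds in frequency to
      a Gaussian of width \<open>sqrt (4 * \<delta>)\<close>; \<open>\<delta>\<close> is chosen so
      that this width is \<open>c\<close>.\<close>
    define c where "c = 1 / real (Suc n)"
    define \<delta> where "\<delta> = (1 / (2 * real (Suc n)))\<^sup>2"
    have c: "c > 0" by (simp add: c_def)
    have \<delta>_eq: "\<delta> = (c / 2)\<^sup>2" unfolding \<delta>_def c_def by simp
    have \<delta>: "\<delta> > 0" "4 * \<delta> = c\<^sup>2" using c unfolding \<delta>_eq by (auto simp: power_divide)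
    have gi: "integrable (leb d) (\<lambda>y. exp (- \<delta> * (enorm d y)\<^sup>2))" by (rule gauss_cos(1)[OF \<delta>(1)])
    define f where "f y \<xi> = \<phi> t \<xi> * cos (einner d \<xi> y) * (cos (einner d \<zeta> y) * exp (- \<delta> * (enorm d y)\<^sup>2))" for y \<xi>
    have [measurable]: "case_prod f \<in> borel_measurable (leb d \<Otimes>\<^sub>M leb d)"
      unfolding f_def einner_commute[of d \<zeta>] by measurable
    have fi: "integrable (leb d \<Otimes>\<^sub>M leb d) (case_prod f)"
    proof (rule integrable_leb_pair_prodI[where F = "\<lambda>y. exp (- \<delta> * (enorm d y)\<^sup>2)" and G = "\<phi> t"])
      show "\<bar>f y \<xi>\<bar> \<le> exp (- \<delta> * (enorm d y)\<^sup>2) * \<phi> t \<xi>" for y \<xi>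
      proof -
        have "\<bar>cos (einner d \<xi> y)\<bar> * \<bar>cos (einner d \<zeta> y)\<bar> \<le> 1 * 1" by (intro mult_mono) auto
        then have "(\<bar>cos (einner d \<xi> y)\<bar> * \<bar>cos (einner d \<zeta> y)\<bar>) * (exp (- \<delta> * (enorm d y)\<^sup>2) * \<phi> t \<xi>) \<le> 1 * (exp (- \<delta> * (enorm d y)\<^sup>2) * \<phi> t \<xi>)"
          using \<phi>_pos[of t \<xi>] by (intro mult_right_mono) auto
        then show ?thesis using \<phi>_pos[of t \<xi>] by (simp add: f_def abs_mult mult_ac)
      qed
    qed (use gi t \<phi>_integrable \<phi>_pos in \<open>auto intro: less_imp_le\<close>)
    define H where "H v = (pi / \<delta>) powr (real d / 2) * exp (- (enorm d v)\<^sup>2 / (4 * \<delta>))" for v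
    \<comment> \<open>The product of the two cosines splits into frequencies
      \<open>\<xi> - \<zeta>\<close> and \<open>\<xi> + \<zeta>\<close>; the second is written
      \<open>\<xi> - (- \<zeta>)\<close> so that one computation covers both, and both limits agree
      because \<open>\<phi> t\<close> is even.\<close>
    have H: "(\<integral>y. cos (einner d \<xi> y) * (cos (einner d \<zeta> y) * exp (- \<delta> * (enorm d y)\<^sup>2)) \<partial>leb d)
       = (H (\<lambda>i. \<xi> i - \<zeta> i) + H (\<lambda>i. \<xi> i - (- \<zeta> i))) / 2" for \<xi>
    proof -
      have ci: "integrable (leb d) (\<lambda>y. exp (- \<delta> * (enorm d y)\<^sup>2) * cos (einner d y v))" for v
        by (rule Bochner_Integration.integrable_bound[OF gi]) (auto simp: abs_mult intro!: mult_left_le)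
      have E: "cos (einner d \<xi> y) * (cos (einner d \<zeta> y) * exp (- \<delta> * (enorm d y)\<^sup>2)) =
        (exp (- \<delta> * (enorm d y)\<^sup>2) * cos (einner d y (\<lambda>i. \<xi> i - \<zeta> i)) + exp (- \<delta> * (enorm d y)\<^sup>2) * cos (einner d y (\<lambda>i. \<xi> i - (- \<zeta> i)))) / 2" for y
      proof -
        have e1: "einner d y (\<lambda>i. \<xi> i - (- \<zeta> i)) = einner d \<xi> y + einner d \<zeta> y"
          by (simp add: einner_def distrib_left sum.distrib mult.commute)
        have e2: "einner d y (\<lambda>i. \<xi> i - \<zeta> i) = einner d \<xi> y - einner d \<zeta> y"
          by (simp add: einner_diff_right einner_commute)
        show ?thesis unfolding e1 e2 by (simp add: cos_add cos_diff field_simps)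
      qed
      have "(\<integral>y. cos (einner d \<xi> y) * (cos (einner d \<zeta> y) * exp (- \<delta> * (enorm d y)\<^sup>2)) \<partial>leb d)
        = (\<integral>y. exp (- \<delta> * (enorm d y)\<^sup>2) * cos (einner d y (\<lambda>i. \<xi> i - \<zeta> i)) + exp (- \<delta> * (enorm d y)\<^sup>2) * cos (einner d y (\<lambda>i. \<xi> i - (- \<zeta> i))) \<partial>leb d) / 2"
        unfolding E by (rule integral_divide_zero)
      also have "\<dots> = (H (\<lambda>i. \<xi> i - \<zeta> i) + H (\<lambda>i. \<xi> i - (- \<zeta> i))) / 2"
        unfolding Bochner_Integration.integral_add[OF ci ci] gauss_cos(2)[OF \<delta>(1), of d] H_def ..
      finally show ?thesis .
    qed
    have aff: "(\<integral>\<xi>. \<phi> t \<xi> * H (\<lambda>i. \<xi> i - z i) \<partial>leb d) = (2 * pi) ^ d / pi powr (real d / 2) * N z n"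
      and affi: "integrable (leb d) (\<lambda>\<xi>. \<phi> t \<xi> * H (\<lambda>i. \<xi> i - z i))" for z
    proof -
      have Hm: "(\<lambda>\<xi>. H (\<lambda>i. \<xi> i - z i)) \<in> borel_measurable (leb d)"
        unfolding H_def enorm_sq by measurable
      show "integrable (leb d) (\<lambda>\<xi>. \<phi> t \<xi> * H (\<lambda>i. \<xi> i - z i))"
      proof (rule Bochner_Integration.integrable_bound)
        show "integrable (leb d) (\<lambda>\<xi>. \<phi> t \<xi> * (pi / \<delta>) powr (real d / 2))" using \<phi>_integrable[OF t] by simp
        show "AE \<xi> in leb d. norm (\<phi> t \<xi> * H (\<lambda>i. \<xi> i - z i)) \<le> norm (\<phi> t \<xi> * (pi / \<delta>) powr (real d / 2))"
          using \<phi>_pos[of t] \<delta> by (auto simp: H_def abs_mult mult_le_cancel_left1 intro!: mult_left_mono mult_left_le)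
      qed (use Hm in measurable)
      have "(\<integral>\<xi>. \<phi> t \<xi> * H (\<lambda>i. \<xi> i - z i) \<partial>leb d) = \<bar>c\<bar> ^ d * (\<integral>w. \<phi> t (affine_map d z c w) * H (\<lambda>i. affine_map d z c w i - z i) \<partial>leb d)"
        using c Hm by (intro integral_affine) auto
      also have "(\<lambda>w. \<phi> t (affine_map d z c w) * H (\<lambda>i. affine_map d z c w i - z i)) = (\<lambda>w. (pi / \<delta>) powr (real d / 2) * (\<phi> t (affine_map d z c w) * exp (- 1 * (enorm d w)\<^sup>2)))"
      proof
        fix w
        have "(enorm d (\<lambda>i. affine_map d z c w i - z i))\<^sup>2 = c\<^sup>2 * (enorm d w)\<^sup>2"
          by (simp add: enorm_sq affine_map_def power_mult_distrib sum_distrib_left)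
        then show "\<phi> t (affine_map d z c w) * H (\<lambda>i. affine_map d z c w i - z i) = (pi / \<delta>) powr (real d / 2) * (\<phi> t (affine_map d z c w) * exp (- 1 * (enorm d w)\<^sup>2))"
          using c by (simp add: H_def \<delta>(2))
      qed
      also have "\<bar>c\<bar> ^ d * (\<integral>w. (pi / \<delta>) powr (real d / 2) * (\<phi> t (affine_map d z c w) * exp (- 1 * (enorm d w)\<^sup>2)) \<partial>leb d)
         = (\<bar>c\<bar> ^ d * (pi / \<delta>) powr (real d / 2)) * N z n"
        by (simp add: N_def c_def)
      also have "\<bar>c\<bar> ^ d * (pi / \<delta>) powr (real d / 2) = (2 * pi) ^ d / pi powr (real d / 2)"
      proof -
        have sq: "(x\<^sup>2) powr (real d / 2) = x ^ d" if "x > 0" for x :: real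
        proof -
          have "(x\<^sup>2) powr (real d / 2) = (x powr 2) powr (real d / 2)" using that by simp
          also have "\<dots> = x powr real d" by (simp only: powr_powr) simp
          finally show ?thesis using that by (simp add: powr_realpow)
        qed
        have "\<bar>c\<bar> ^ d * (pi / \<delta>) powr (real d / 2) = (c\<^sup>2) powr (real d / 2) * (pi / \<delta>) powr (real d / 2)"
          using c by (simp add: sq)
        also have "\<dots> = (c\<^sup>2 * (pi / \<delta>)) powr (real d / 2)" using c \<delta> by (subst powr_mult) auto
        also have "c\<^sup>2 * (pi / \<delta>) = (2 * pi)\<^sup>2 / pi" using \<delta>(1) unfolding \<delta>(2)[symmetric] by (simp add: field_simps power2_eq_square)
        also have "((2 * pi)\<^sup>2 / pi) powr (real d / 2) = (2 * pi) ^ d / pi powr (real d / 2)"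
        proof -
          have "((2 * pi)\<^sup>2) powr (real d / 2) = (2 * pi) ^ d" by (rule sq) simp
          then show ?thesis by (simp only: powr_divide)
        qed
        finally show ?thesis .
      qed
      finally show "(\<integral>\<xi>. \<phi> t \<xi> * H (\<lambda>i. \<xi> i - z i) \<partial>leb d) = (2 * pi) ^ d / pi powr (real d / 2) * N z n" .
    qed
    have "(\<integral>y. p t y * cos (einner d \<zeta> y) * exp (- \<delta> * (enorm d y)\<^sup>2) \<partial>leb d) = (\<integral>y. (\<integral>\<xi>. f y \<xi> \<partial>leb d) / (2 * pi) ^ d \<partial>leb d)"
    proof (intro Bochner_Integration.integral_cong refl)
      fix y
      have "(\<integral>\<xi>. f y \<xi> \<partial>leb d) = (\<integral>\<xi>. \<phi> t \<xi> * cos (einner d \<xi> y) \<partial>leb d) * (cos (einner d \<zeta> y) * exp (- \<delta> * (enorm d y)\<^sup>2))"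
        unfolding f_def by (rule integral_mult_left_zero)
      then show "p t y * cos (einner d \<zeta> y) * exp (- \<delta> * (enorm d y)\<^sup>2) = (\<integral>\<xi>. f y \<xi> \<partial>leb d) / (2 * pi) ^ d"
        by (simp add: p_eq[OF t])
    qed
    also have "\<dots> = (\<integral>y. (\<integral>\<xi>. f y \<xi> \<partial>leb d) \<partial>leb d) / (2 * pi) ^ d" by simp
    also have "(\<integral>y. (\<integral>\<xi>. f y \<xi> \<partial>leb d) \<partial>leb d) = (\<integral>\<xi>. (\<integral>y. f y \<xi> \<partial>leb d) \<partial>leb d)"
      by (rule leb_pair.Fubini_integral[OF fi, symmetric])
    also have "\<dots> = (\<integral>\<xi>. (\<phi> t \<xi> * H (\<lambda>i. \<xi> i - \<zeta> i) + \<phi> t \<xi> * H (\<lambda>i. \<xi> i - (- \<zeta> i))) / 2 \<partial>leb d)"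
      unfolding f_def by (intro Bochner_Integration.integral_cong refl) (simp only: mult.assoc integral_mult_right_zero H, simp add: algebra_simps)
    also have "\<dots> = ((2 * pi) ^ d / pi powr (real d / 2) * N \<zeta> n + (2 * pi) ^ d / pi powr (real d / 2) * N (\<lambda>i. - \<zeta> i) n) / 2"
      using aff affi affi[of "\<lambda>i. - \<zeta> i"] aff[of "\<lambda>i. - \<zeta> i"] by (simp del: diff_minus_eq_add)
    also have "((2 * pi) ^ d / pi powr (real d / 2) * N \<zeta> n + (2 * pi) ^ d / pi powr (real d / 2) * N (\<lambda>i. - \<zeta> i) n) / 2 / (2 * pi) ^ d
      = (N \<zeta> n + N (\<lambda>i. - \<zeta> i) n) / 2 / pi powr (real d / 2)"
    proof -
      have "(B / A * x + B / A * y) / 2 / B = (x + y) / 2 / A" if "A \<noteq> 0" "B \<noteq> 0" for A B x y :: real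
        using that by (simp add: field_simps)
      then show ?thesis by simp
    qed
    finally show ?thesis unfolding \<delta>_def .
  qed
  have "\<phi> t (\<lambda>i. - \<zeta> i) = \<phi> t \<zeta>" by (simp add: \<phi>_def enorm_def L2_set_def)
  then have "(\<lambda>n. (N \<zeta> n + N (\<lambda>i. - \<zeta> i) n) / 2 / pi powr (real d / 2)) \<longlonglongrightarrow>
    (\<phi> t \<zeta> * pi powr (real d / 2) + \<phi> t \<zeta> * pi powr (real d / 2)) / 2 / pi powr (real d / 2)"
    using gauss_convolution_limit[OF t, of \<zeta>] gauss_convolution_limit[OF t, of "\<lambda>i. - \<zeta> i"] unfolding N_def
    by (intro tendsto_intros) auto
  then show ?thesis unfolding eq by simp
qed

text \<open>The damped integrals at frequency zero converge to
  \<open>\<phi> t (\<lambda>_. 0) = 1\<close>. Since \<open>p t\<close> is nonnegative, the damped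
  functions increase to it, and monotone convergence delivers integrability and mass
  together.\<close>

lemma p_integrable: "0 < t \<Longrightarrow> integrable (leb d) (p t)"
  and p_integral: "0 < t \<Longrightarrow> (\<integral>y. p t y \<partial>leb d) = 1"
proof -
  assume t: "0 < t"
  define \<delta> where "\<delta> n = (1 / (2 * real (Suc n)))\<^sup>2" for n
  have \<delta>: "\<delta> n > 0" "\<delta> (Suc n) \<le> \<delta> n" for n
    by (auto simp: \<delta>_def intro!: power_mono divide_left_mono)
  have \<delta>0: "\<delta> \<longlonglongrightarrow> 0" unfolding \<delta>_def by real_asymp
  define f where "f n y = p t y * exp (- \<delta> n * (enorm d y)\<^sup>2)" for n y
  have 1: "integrable (leb d) (f n)" for n
  proof (rule Bochner_Integration.integrable_bound)
    show "integrable (leb d) (\<lambda>y. (\<integral>\<xi>. \<phi> t \<xi> \<partial>leb d) / (2 * pi) ^ d * exp (- \<delta> n * (enorm d y)\<^sup>2))"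
      using gauss_cos(1)[OF \<delta>(1)] by simp
    show "f n \<in> borel_measurable (leb d)" unfolding f_def by measurable
    show "AE y in leb d. norm (f n y) \<le> norm ((\<integral>\<xi>. \<phi> t \<xi> \<partial>leb d) / (2 * pi) ^ d * exp (- \<delta> n * (enorm d y)\<^sup>2))"
    proof (rule AE_I2)
      fix y
      have "norm (f n y) = p t y * exp (- \<delta> n * (enorm d y)\<^sup>2)" using p_nonneg[OF t] by (simp add: f_def)
      also have "\<dots> \<le> (\<integral>\<xi>. \<phi> t \<xi> \<partial>leb d) / (2 * pi) ^ d * exp (- \<delta> n * (enorm d y)\<^sup>2)"
        using p_bound[OF t] by (intro mult_right_mono) auto
      also have "\<dots> \<le> norm \<dots>" unfolding real_norm_def by (rule abs_ge_self)
      finally show "norm (f n y) \<le> norm ((\<integral>\<xi>. \<phi> t \<xi> \<partial>leb d) / (2 * pi) ^ d * exp (- \<delta> n * (enorm d y)\<^sup>2))" .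
    qed
  qed
  have 2: "AE y in leb d. mono (\<lambda>n. f n y)"
    using p_nonneg[OF t] \<delta>(2) unfolding f_def incseq_Suc_iff[symmetric]
    by (intro AE_I2 incseq_SucI mult_left_mono) (auto intro!: mult_right_mono)
  have 3: "AE y in leb d. (\<lambda>n. f n y) \<longlonglongrightarrow> p t y"
  proof (rule AE_I2)
    fix y
    have "(\<lambda>n. f n y) \<longlonglongrightarrow> p t y * exp (- 0 * (enorm d y)\<^sup>2)"
      unfolding f_def by (intro tendsto_intros \<delta>0)
    then show "(\<lambda>n. f n y) \<longlonglongrightarrow> p t y" by simp
  qed
  have 4: "(\<lambda>n. integral\<^sup>L (leb d) (f n)) \<longlonglongrightarrow> 1"
  proof -
    have "\<phi> t (\<lambda>_. 0) = 1" using \<alpha>0 by (simp add: \<phi>_def enorm_def L2_set_def)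
    then show ?thesis using gauss_p_cos[OF t, of "\<lambda>_. 0"] unfolding f_def \<delta>_def by (simp add: einner_def)
  qed
  show "integrable (leb d) (p t)" "(\<integral>y. p t y \<partial>leb d) = 1"
    using integrable_monotone_convergence[OF 1 2 3 4] integral_monotone_convergence[OF 1 2 3 4] by auto
qed

text \<open>Once \<open>p t\<close> is known to be integrable, it dominates the damped integrands
  itself, and the limit computed in \<open>gauss_p_cos\<close> is identified by uniqueness.\<close>

lemma p_cos_integral:
  assumes t: "0 < t"
  shows "(\<integral>y. p t y * cos (einner d \<zeta> y) \<partial>leb d) = \<phi> t \<zeta>"
proof (rule LIMSEQ_unique)
  have mz: "(\<lambda>y. einner d \<zeta> y) \<in> borel_measurable (leb d)" unfolding einner_commute[of d \<zeta>] by measurable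
  show "(\<lambda>n. \<integral>y. p t y * cos (einner d \<zeta> y) * exp (- (1 / (2 * real (Suc n)))\<^sup>2 * (enorm d y)\<^sup>2) \<partial>leb d) \<longlonglongrightarrow> (\<integral>y. p t y * cos (einner d \<zeta> y) \<partial>leb d)"
  proof (rule integral_dominated_convergence[OF _ _ p_integrable[OF t]])
    show "AE y in leb d. (\<lambda>n. p t y * cos (einner d \<zeta> y) * exp (- (1 / (2 * real (Suc n)))\<^sup>2 * (enorm d y)\<^sup>2)) \<longlonglongrightarrow> p t y * cos (einner d \<zeta> y)"
    proof (rule AE_I2)
      fix y
      have "(\<lambda>n. (1 / (2 * real (Suc n)))\<^sup>2) \<longlonglongrightarrow> 0" by real_asymp
      then have "(\<lambda>n. p t y * cos (einner d \<zeta> y) * exp (- (1 / (2 * real (Suc n)))\<^sup>2 * (enorm d y)\<^sup>2)) \<longlonglongrightarrow> p t y * cos (einner d \<zeta> y) * exp (- 0 * (enorm d y)\<^sup>2)"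
        by (intro tendsto_intros)
      then show "(\<lambda>n. p t y * cos (einner d \<zeta> y) * exp (- (1 / (2 * real (Suc n)))\<^sup>2 * (enorm d y)\<^sup>2)) \<longlonglongrightarrow> p t y * cos (einner d \<zeta> y)" by simp
    qed
    show "AE y in leb d. norm (p t y * cos (einner d \<zeta> y) * exp (- (1 / (2 * real (Suc n)))\<^sup>2 * (enorm d y)\<^sup>2)) \<le> p t y" for n
    proof (rule AE_I2)
      fix y
      have "\<bar>cos (einner d \<zeta> y)\<bar> * exp (- (1 / (2 * real (Suc n)))\<^sup>2 * (enorm d y)\<^sup>2) \<le> 1 * 1" by (intro mult_mono) auto
      then show "norm (p t y * cos (einner d \<zeta> y) * exp (- (1 / (2 * real (Suc n)))\<^sup>2 * (enorm d y)\<^sup>2)) \<le> p t y"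
        using p_nonneg[OF t, of y] by (simp add: abs_mult mult.assoc mult_left_le)
    qed
  qed (use mz in measurable)
qed (rule gauss_p_cos[OF t])

lemma p_minus: "p t (\<lambda>i. - y i) = p t y" if "0 < t"
proof -
  have "einner d \<xi> (\<lambda>i. - y i) = - einner d \<xi> y" for \<xi> by (simp add: einner_def sum_negf)
  then show ?thesis by (simp add: p_eq[OF that])
qed

lemma p_sin_integral:
  assumes t: "0 < t"
  shows "(\<integral>y. p t y * sin (einner d \<zeta> y) \<partial>leb d) = 0"
proof -
  have mz: "(\<lambda>y. einner d \<zeta> y) \<in> borel_measurable (leb d)" unfolding einner_commute[of d \<zeta>] by measurable
  have "(\<integral>y. p t y * sin (einner d \<zeta> y) \<partial>leb d) = \<bar>-1\<bar> ^ d * (\<integral>y. p t (affine_map d (\<lambda>_. 0) (-1) y) * sin (einner d \<zeta> (affine_map d (\<lambda>_. 0) (-1) y)) \<partial>leb d)"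
    using mz by (intro integral_affine) auto
  also have "\<dots> = (\<integral>y. - (p t y * sin (einner d \<zeta> y)) \<partial>leb d)"
  proof -
    have "p t (affine_map d (\<lambda>_. 0) (-1) y) = p t y" for y
      using p_minus[OF t, of y] stable_density_cong[of d "affine_map d (\<lambda>_. 0) (-1) y" "\<lambda>i. - y i" \<alpha> t] by (simp add: affine_map_def)
    moreover have "einner d \<zeta> (affine_map d (\<lambda>_. 0) (-1) y) = - einner d \<zeta> y" for y
      unfolding einner_commute[of d \<zeta>] einner_affine by (simp add: einner_def)
    ultimately show ?thesis by simp
  qed
  finally show ?thesis by simp
qed

text \<open>Only one factor is expanded as a Fourier integral. The other is integrated against the
  resulting cosine and contributes \<open>\<phi> s\<close>, while the sine part vanishes by
  symmetry; then \<open>\<phi> s * \<phi> t = \<phi> (s + t)\<close>.\<close>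

lemma p_convolution:
  assumes s: "0 < s" and t: "0 < t"
  shows "(\<integral>w. p s w * p t (\<lambda>i. y i - w i) \<partial>leb d) = p (s + t) y"
proof -
  define f where "f w \<xi> = p s w * (\<phi> t \<xi> * cos (einner d \<xi> y - einner d \<xi> w))" for w \<xi>
  have [measurable]: "case_prod f \<in> borel_measurable (leb d \<Otimes>\<^sub>M leb d)" unfolding f_def by measurable
  have fi: "integrable (leb d \<Otimes>\<^sub>M leb d) (case_prod f)"
  proof (rule integrable_leb_pair_prodI[where F = "p s" and G = "\<phi> t"])
    show "\<bar>f w \<xi>\<bar> \<le> p s w * \<phi> t \<xi>" for w \<xi>
      unfolding f_def using p_nonneg[OF s, of w] \<phi>_pos[of t \<xi>]
      by (auto simp: abs_mult intro!: mult_left_mono mult_left_le)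
  qed (use s t p_integrable p_nonneg \<phi>_integrable \<phi>_pos in \<open>auto intro: less_imp_le\<close>)
  have inner: "(\<integral>w. f w \<xi> \<partial>leb d) = \<phi> (s + t) \<xi> * cos (einner d \<xi> y)" for \<xi>
  proof -
    have mx: "(\<lambda>y. einner d \<xi> y) \<in> borel_measurable (leb d)" unfolding einner_commute[of d \<xi>] by measurable
    have i1: "integrable (leb d) (\<lambda>w. p s w * cos (einner d \<xi> w))" "integrable (leb d) (\<lambda>w. p s w * sin (einner d \<xi> w))"
      using mx p_nonneg[OF s]
      by (auto intro!: Bochner_Integration.integrable_bound[OF p_integrable[OF s]] AE_I2 mult_left_le simp: abs_mult)
    have "(\<integral>w. f w \<xi> \<partial>leb d) = (\<integral>w. \<phi> t \<xi> * cos (einner d \<xi> y) * (p s w * cos (einner d \<xi> w)) + \<phi> t \<xi> * sin (einner d \<xi> y) * (p s w * sin (einner d \<xi> w)) \<partial>leb d)"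
      by (simp add: f_def cos_diff algebra_simps)
    also have "\<dots> = \<phi> t \<xi> * cos (einner d \<xi> y) * \<phi> s \<xi>"
      using i1 by (simp add: p_cos_integral[OF s] p_sin_integral[OF s])
    also have "\<dots> = \<phi> (s + t) \<xi> * cos (einner d \<xi> y)"
      by (simp add: \<phi>_def exp_add[symmetric] algebra_simps)
    finally show ?thesis .
  qed
  have "(\<integral>w. p s w * p t (\<lambda>i. y i - w i) \<partial>leb d) = (\<integral>w. (\<integral>\<xi>. f w \<xi> \<partial>leb d) / (2 * pi) ^ d \<partial>leb d)"
    by (intro Bochner_Integration.integral_cong refl) (simp add: p_eq[OF t] f_def einner_diff_right)
  also have "\<dots> = (\<integral>\<xi>. (\<integral>w. f w \<xi> \<partial>leb d) \<partial>leb d) / (2 * pi) ^ d"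
    by (simp add: leb_pair.Fubini_integral[OF fi, symmetric])
  also have "\<dots> = p (s + t) y" unfolding inner using s t by (simp add: p_eq)
  finally show ?thesis .
qed

end

section \<open>A reverse Poincare inequality for stable laws\<close>

text \<open>Nonnegativity of the integral of \<open>(k a b - u a - u b + m)^2\<close>, where
  \<open>u a + u b - m\<close> is the orthogonal projection of \<open>k\<close> onto sums of
  functions of one variable. In terms of variances it says that \<open>k\<close> has at least twice
  the variance of its conditional mean \<open>u\<close>.\<close>

lemma (in prob_space) hoeffding_projection:
  fixes k :: "'a \<Rightarrow> 'a \<Rightarrow> real"
  assumes k [measurable]: "case_prod k \<in> borel_measurable (M \<Otimes>\<^sub>M M)"
    and B: "\<And>a b. \<bar>k a b\<bar> \<le> B" and sym: "\<And>a b. k a b = k b a"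
  shows "2 * (\<integral>a. (\<integral>b. k a b \<partial>M)\<^sup>2 \<partial>M) \<le> (\<integral>a. (\<integral>b. (k a b)\<^sup>2 \<partial>M) \<partial>M) + (\<integral>a. (\<integral>b. k a b \<partial>M) \<partial>M)\<^sup>2"
proof -
  interpret P: pair_prob_space M M by unfold_locales
  define u where "u a = (\<integral>b. k a b \<partial>M)" for a
  define m where "m = (\<integral>a. u a \<partial>M)"
  have B0: "0 \<le> B" using B[of undefined undefined] by linarith
  have [measurable]: "u \<in> borel_measurable M" unfolding u_def by measurable
  have uB: "\<bar>u a\<bar> \<le> B" for a
  proof -
    have "\<bar>u a\<bar> \<le> (\<integral>b. \<bar>k a b\<bar> \<partial>M)" unfolding u_def by (rule integral_abs_bound)
    also have "\<dots> \<le> B"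
    proof (cases "integrable M (\<lambda>b. \<bar>k a b\<bar>)")
      case True
      then have "(\<integral>b. \<bar>k a b\<bar> \<partial>M) \<le> (\<integral>b. B \<partial>M)" using B by (intro integral_mono) auto
      then show ?thesis by (simp add: prob_space)
    qed (use B0 in \<open>simp add: not_integrable_integral_eq\<close>)
    finally show ?thesis .
  qed
  have intP: "integrable (M \<Otimes>\<^sub>M M) f" if "f \<in> borel_measurable (M \<Otimes>\<^sub>M M)" "\<And>z. \<bar>f z\<bar> \<le> C" for f :: "'a \<times> 'a \<Rightarrow> real" and C
    by (rule P.P.integrable_const_bound[where B = C]) (use that in auto)
  have ik: "integrable (M \<Otimes>\<^sub>M M) (\<lambda>z. k (fst z) (snd z))"
    by (rule intP[of _ B]) (use B in auto)
  have ikk: "integrable (M \<Otimes>\<^sub>M M) (\<lambda>z. (k (fst z) (snd z))\<^sup>2)"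
    by (rule intP[of _ "B\<^sup>2"]) (use B B0 abs_le_square_iff[of _ B] in auto)
  have mB: "\<bar>x * y\<bar> \<le> B * B" if "\<bar>x\<bar> \<le> B" "\<bar>y\<bar> \<le> B" for x y
    using that B0 by (simp add: abs_mult mult_mono)
  have iku1: "integrable (M \<Otimes>\<^sub>M M) (\<lambda>z. k (fst z) (snd z) * u (fst z))"
    and iku2: "integrable (M \<Otimes>\<^sub>M M) (\<lambda>z. k (fst z) (snd z) * u (snd z))"
    and iuu: "integrable (M \<Otimes>\<^sub>M M) (\<lambda>z. u (fst z) * u (snd z))"
    and iuu1: "integrable (M \<Otimes>\<^sub>M M) (\<lambda>z. u (fst z) * u (fst z))"
    and iuu2: "integrable (M \<Otimes>\<^sub>M M) (\<lambda>z. u (snd z) * u (snd z))"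
    by (rule intP[of _ "B * B"], measurable, intro mB B uB)+
  have iu1: "integrable (M \<Otimes>\<^sub>M M) (\<lambda>z. u (fst z))"
    and iu2: "integrable (M \<Otimes>\<^sub>M M) (\<lambda>z. u (snd z))"
    by (rule intP[of _ B], measurable, intro uB)+
  define K where "K = (\<integral>a. (\<integral>b. (k a b)\<^sup>2 \<partial>M) \<partial>M)"
  define U where "U = (\<integral>a. u a * u a \<partial>M)"
  have K: "(\<integral>z. (k (fst z) (snd z))\<^sup>2 \<partial>(M \<Otimes>\<^sub>M M)) = K"
    using P.integral_fst'[OF ikk] by (simp add: K_def)
  have E1: "(\<integral>z. k (fst z) (snd z) \<partial>(M \<Otimes>\<^sub>M M)) = m"
    using P.integral_fst'[OF ik] by (simp add: m_def u_def)
  have E2: "(\<integral>z. k (fst z) (snd z) * u (fst z) \<partial>(M \<Otimes>\<^sub>M M)) = U"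
    using P.integral_fst'[OF iku1] by (simp add: U_def) (simp add: u_def)
  have E3: "(\<integral>z. k (fst z) (snd z) * u (snd z) \<partial>(M \<Otimes>\<^sub>M M)) = U"
  proof -
    have i: "integrable (M \<Otimes>\<^sub>M M) (case_prod (\<lambda>a b. k a b * u b))" using iku2 by (simp add: case_prod_unfold)
    have "(\<integral>z. k (fst z) (snd z) * u (snd z) \<partial>(M \<Otimes>\<^sub>M M)) = (\<integral>b. (\<integral>a. k a b * u b \<partial>M) \<partial>M)"
      using P.integral_snd[OF i] by (simp add: case_prod_unfold)
    also have "\<dots> = (\<integral>b. u b * u b \<partial>M)"
    proof -
      have "(\<integral>a. k a b \<partial>M) = u b" for b
        unfolding u_def by (rule Bochner_Integration.integral_cong[OF refl]) (rule sym)
      then show ?thesis by simp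
    qed
    finally show ?thesis by (simp add: U_def)
  qed
  have E4: "(\<integral>z. u (fst z) * u (snd z) \<partial>(M \<Otimes>\<^sub>M M)) = m * m"
    using P.integral_fst'[OF iuu] by (simp add: m_def)
  have E5: "(\<integral>z. u (fst z) \<partial>(M \<Otimes>\<^sub>M M)) = m" "(\<integral>z. u (snd z) \<partial>(M \<Otimes>\<^sub>M M)) = m"
    "(\<integral>z. u (fst z) * u (fst z) \<partial>(M \<Otimes>\<^sub>M M)) = U" "(\<integral>z. u (snd z) * u (snd z) \<partial>(M \<Otimes>\<^sub>M M)) = U"
    using P.integral_fst'[OF iu1] P.integral_fst'[OF iu2] P.integral_fst'[OF iuu1] P.integral_fst'[OF iuu2]
    by (simp_all add: m_def U_def prob_space)
  have "0 \<le> (\<integral>z. (k (fst z) (snd z) - u (fst z) - u (snd z) + m)\<^sup>2 \<partial>(M \<Otimes>\<^sub>M M))"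
    by (rule Bochner_Integration.integral_nonneg) simp
  also have "(\<lambda>z. (k (fst z) (snd z) - u (fst z) - u (snd z) + m)\<^sup>2) =
     (\<lambda>z. (k (fst z) (snd z))\<^sup>2 + u (fst z) * u (fst z) + u (snd z) * u (snd z) + m * m
       - 2 * (k (fst z) (snd z) * u (fst z)) - 2 * (k (fst z) (snd z) * u (snd z)) + 2 * m * k (fst z) (snd z)
       + 2 * (u (fst z) * u (snd z)) - 2 * m * u (fst z) - 2 * m * u (snd z))"
    by (simp add: fun_eq_iff power2_eq_square algebra_simps)
  also have "(\<integral>z. \<dots> z \<partial>(M \<Otimes>\<^sub>M M)) = K + U + U + m * m - 2 * U - 2 * U + 2 * m * m + 2 * (m * m) - 2 * m * m - 2 * m * m"
    using ikk iku1 iku2 iuu iu1 iu2 iuu1 iuu2 ik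
    by (simp add: K E1 E2 E3 E4 E5 P.P.prob_space)
  finally have "2 * U \<le> K + m * m" by simp
  then show ?thesis by (simp add: K_def U_def m_def u_def power2_eq_square)
qed

lemma measurable_enorm_diff [measurable (raw)]:
  assumes [measurable]: "f \<in> measurable M (leb d)" "g \<in> measurable M (leb d)"
  shows "(\<lambda>x. enorm d (\<lambda>i. f x i - g x i)) \<in> borel_measurable M"
  unfolding enorm_def L2_set_def using measurable_diff_leb[OF assms] by measurable

lemma frac_const_nonneg: "0 < \<theta> \<Longrightarrow> 0 \<le> frac_const d \<theta>"
  unfolding frac_const_def by (intro divide_nonneg_nonneg mult_nonneg_nonneg Gamma_real_nonneg) auto

lemma enorm_diff_eq_0:
  assumes "y \<in> space (leb d)" "x \<in> space (leb d)"
  shows "enorm d (\<lambda>i. y i - x i) = 0 \<longleftrightarrow> y = x"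
proof
  assume "enorm d (\<lambda>i. y i - x i) = 0"
  then have "\<And>i. i \<in> {..<d} \<Longrightarrow> y i = x i" by (simp add: enorm_eq_0)
  then show "y = x"
    using assms by (intro extensionalityI[of _ "{..<d}"]) (auto simp: space_PiM PiE_iff)
qed (simp add: enorm_eq_0)

section \<open>Transition operators of the stable semigroup and conditional variances\<close>

context stable_kernel
begin

text \<open>Keeping the times above \<open>t / 2\<close> supplies the single majorant
  \<open>\<phi> (t / 2)\<close>.\<close>

lemma p_tendsto:
  assumes t: "0 < t" and \<tau>: "\<And>n. t / 2 \<le> \<tau> n" "\<tau> \<longlonglongrightarrow> t"
  shows "(\<lambda>n. p (\<tau> n) y) \<longlonglongrightarrow> p t y"
proof -
  have t2: "0 < t / 2" and \<tau>0: "0 < \<tau> n" for n using t \<tau>(1)[of n] by auto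
  have "(\<lambda>n. \<integral>\<xi>. \<phi> (\<tau> n) \<xi> * cos (einner d \<xi> y) \<partial>leb d) \<longlonglongrightarrow> (\<integral>\<xi>. \<phi> t \<xi> * cos (einner d \<xi> y) \<partial>leb d)"
  proof (rule integral_dominated_convergence[OF _ _ \<phi>_integrable[OF t2]])
    show "AE \<xi> in leb d. (\<lambda>n. \<phi> (\<tau> n) \<xi> * cos (einner d \<xi> y)) \<longlonglongrightarrow> \<phi> t \<xi> * cos (einner d \<xi> y)"
      unfolding \<phi>_def by (intro AE_I2 tendsto_intros \<tau>)
    show "AE \<xi> in leb d. norm (\<phi> (\<tau> n) \<xi> * cos (einner d \<xi> y)) \<le> \<phi> (t / 2) \<xi>" for n
    proof (rule AE_I2)
      fix \<xi>
      have "t / 2 * enorm d \<xi> powr \<alpha> \<le> \<tau> n * enorm d \<xi> powr \<alpha>" by (intro mult_right_mono \<tau>) simp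
      then have "\<phi> (\<tau> n) \<xi> \<le> \<phi> (t / 2) \<xi>" unfolding \<phi>_def by simp
      then have "\<phi> (\<tau> n) \<xi> * \<bar>cos (einner d \<xi> y)\<bar> \<le> \<phi> (t / 2) \<xi> * 1"
        using \<phi>_pos[of "t/2" \<xi>] by (intro mult_mono) auto
      then show "norm (\<phi> (\<tau> n) \<xi> * cos (einner d \<xi> y)) \<le> \<phi> (t / 2) \<xi>"
        using \<phi>_pos[of "\<tau> n" \<xi>] by (simp add: abs_mult)
    qed
  qed measurable
  then show ?thesis unfolding p_eq[OF t] p_eq[OF \<tau>0] by (intro tendsto_divide tendsto_const) auto
qed

text \<open>The transition operator as a Bochner integral, used for bounded \<open>g\<close>;
  \<open>T\<close> below extends the operator at time \<open>\<eta>\<close> to nonnegative extended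
  functions.\<close>

definition Q :: "real \<Rightarrow> ((nat \<Rightarrow> real) \<Rightarrow> real) \<Rightarrow> (nat \<Rightarrow> real) \<Rightarrow> real" where
  "Q t g x = (\<integral>y. g y * p t (\<lambda>i. y i - x i) \<partial>leb d)"

lemma p_diff_affine: "p t (\<lambda>i. affine_map d x 1 a i - x i) = p t a"
  by (rule stable_density_cong) (simp add: affine_map_def)

lemma p_diff_measurable [measurable]: "(\<lambda>y. p t (\<lambda>i. y i - x i)) \<in> borel_measurable (leb d)"
proof -
  have "(\<lambda>y. p t (\<lambda>i. affine_map d (\<lambda>i. - x i) 1 y i)) \<in> borel_measurable (leb d)" by measurable
  also have "(\<lambda>y. p t (\<lambda>i. affine_map d (\<lambda>i. - x i) 1 y i)) = (\<lambda>y. p t (\<lambda>i. y i - x i))"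
    by (intro ext stable_density_cong) (simp add: affine_map_def)
  finally show ?thesis .
qed

lemma Q_alt:
  assumes [measurable]: "g \<in> borel_measurable (leb d)"
  shows "Q t g x = (\<integral>a. g (affine_map d x 1 a) * p t a \<partial>leb d)"
  unfolding Q_def using integral_affine[of 1 "\<lambda>y. g y * p t (\<lambda>i. y i - x i)" d x] by (simp add: p_diff_affine)

lemma p_shift:
  assumes t: "0 < t"
  shows "integrable (leb d) (\<lambda>y. p t (\<lambda>i. y i - x i))" "(\<integral>y. p t (\<lambda>i. y i - x i) \<partial>leb d) = 1"
  using integrable_affine_iff[of 1 "\<lambda>y. p t (\<lambda>i. y i - x i)" d x] integral_affine[of 1 "\<lambda>y. p t (\<lambda>i. y i - x i)" d x]
    p_integrable[OF t] p_integral[OF t] by (simp_all add: p_diff_affine)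

lemma p_shift_nn:
  assumes t: "0 < t"
  shows "(\<integral>\<^sup>+y. ennreal (p t (\<lambda>i. y i - x i)) \<partial>leb d) = 1"
  using p_shift[OF t, of x] p_nonneg[OF t] by (simp add: nn_integral_eq_integral)

lemma p_shift_nn':
  assumes t: "0 < t" and y: "y \<in> space (leb d)"
  shows "(\<integral>\<^sup>+x. ennreal (p t (\<lambda>i. y i - x i)) \<partial>leb d) = 1"
proof -
  have "p t (\<lambda>i. y i - x i) = p t (\<lambda>i. x i - y i)" for x using p_minus[OF t, of "\<lambda>i. x i - y i"] by simp
  then show ?thesis using p_shift_nn[OF t, of y] by simp
qed

lemma Q_integrable:
  assumes t: "0 < t" and [measurable]: "g \<in> borel_measurable (leb d)" and B: "\<And>y. \<bar>g y\<bar> \<le> B"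
  shows "integrable (leb d) (\<lambda>y. g y * p t (\<lambda>i. y i - x i))" "integrable (leb d) (\<lambda>a. g (affine_map d x 1 a) * p t a)"
proof -
  have B0: "0 \<le> B" using B[of undefined] by linarith
  show "integrable (leb d) (\<lambda>y. g y * p t (\<lambda>i. y i - x i))"
    by (rule Bochner_Integration.integrable_bound[of _ "\<lambda>y. B * p t (\<lambda>i. y i - x i)"])
       (use p_shift(1)[OF t, of x] p_nonneg[OF t] B B0 in \<open>auto simp: abs_mult intro!: mult_right_mono\<close>)
  then show "integrable (leb d) (\<lambda>a. g (affine_map d x 1 a) * p t a)"
    using integrable_affine_iff[of 1 "\<lambda>y. g y * p t (\<lambda>i. y i - x i)" d x] by (simp add: p_diff_affine)
qed

lemma Q_measurable [measurable]:
  assumes [measurable]: "g \<in> borel_measurable (leb d)"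
  shows "Q t g \<in> borel_measurable (leb d)"
  unfolding Q_def by measurable

lemma Q_bound:
  assumes t: "0 < t" and [measurable]: "g \<in> borel_measurable (leb d)" and B: "\<And>y. \<bar>g y\<bar> \<le> B"
  shows "\<bar>Q t g x\<bar> \<le> B"
proof -
  have "\<bar>Q t g x\<bar> \<le> (\<integral>y. \<bar>g y * p t (\<lambda>i. y i - x i)\<bar> \<partial>leb d)" unfolding Q_def by (rule integral_abs_bound)
  also have "\<dots> \<le> (\<integral>y. B * p t (\<lambda>i. y i - x i) \<partial>leb d)"
  proof (rule integral_mono)
    show "integrable (leb d) (\<lambda>y. \<bar>g y * p t (\<lambda>i. y i - x i)\<bar>)"
      by (rule integrable_abs[OF Q_integrable(1)[OF t assms(2) B]])
    show "integrable (leb d) (\<lambda>y. B * p t (\<lambda>i. y i - x i))" using p_shift(1)[OF t, of x] by simp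
    show "\<bar>g y * p t (\<lambda>i. y i - x i)\<bar> \<le> B * p t (\<lambda>i. y i - x i)" for y
      using p_nonneg[OF t, of "\<lambda>i. y i - x i"] B[of y] by (simp add: abs_mult mult_right_mono)
  qed
  also have "\<dots> = B" by (simp add: p_shift(2)[OF t])
  finally show ?thesis .
qed

text \<open>Scheffe's lemma: densities of equal mass that converge pointwise converge in
  \<open>L^1\<close>, and a bounded measurable \<open>g\<close> only costs the factor
  \<open>B\<close>.\<close>

lemma Q_tendsto:
  assumes t: "0 < t" and \<tau>: "\<And>n. t / 2 \<le> \<tau> n" "\<tau> \<longlonglongrightarrow> t"
    and [measurable]: "g \<in> borel_measurable (leb d)" and B: "\<And>y. \<bar>g y\<bar> \<le> B"
  shows "(\<lambda>n. Q (\<tau> n) g x) \<longlonglongrightarrow> Q t g x"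
proof -
  have B0: "0 \<le> B" using B[of undefined] by linarith
  have \<tau>0: "0 < \<tau> n" for n using t \<tau>(1)[of n] by auto
  have nn1: "(\<integral>\<^sup>+a. ennreal (norm (p s a)) \<partial>leb d) = 1" if "0 < s" for s
    using p_integrable[OF that] p_integral[OF that] p_nonneg[OF that] by (simp add: nn_integral_eq_integral)
  have lim: "(\<lambda>n. \<integral>\<^sup>+a. ennreal (norm (p (\<tau> n) a - p t a)) \<partial>leb d) \<longlonglongrightarrow> 0"
    using p_tendsto[OF t \<tau>] p_integrable[OF t] nn1[OF t] nn1[OF \<tau>0] by (intro Scheffe_lemma2) auto
  have le: "ennreal \<bar>Q (\<tau> n) g x - Q t g x\<bar> \<le> ennreal B * (\<integral>\<^sup>+a. ennreal (norm (p (\<tau> n) a - p t a)) \<partial>leb d)" for n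
  proof -
    note i = Q_integrable(2)[OF t assms(4) B, of x] Q_integrable(2)[OF \<tau>0 assms(4) B, of x n]
    have "Q (\<tau> n) g x - Q t g x = (\<integral>a. g (affine_map d x 1 a) * p (\<tau> n) a - g (affine_map d x 1 a) * p t a \<partial>leb d)"
      using i by (simp add: Q_alt)
    then have "ennreal \<bar>Q (\<tau> n) g x - Q t g x\<bar> \<le> (\<integral>\<^sup>+a. ennreal (norm (g (affine_map d x 1 a) * p (\<tau> n) a - g (affine_map d x 1 a) * p t a)) \<partial>leb d)"
      using integral_norm_bound_ennreal[OF Bochner_Integration.integrable_diff[OF i(2) i(1)]] by simp
    also have "\<dots> \<le> (\<integral>\<^sup>+a. ennreal B * ennreal (norm (p (\<tau> n) a - p t a)) \<partial>leb d)"
      using B B0 by (intro nn_integral_mono) (auto simp: right_diff_distrib[symmetric] abs_mult ennreal_mult[symmetric] intro!: mult_right_mono)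
    also have "\<dots> = ennreal B * (\<integral>\<^sup>+a. ennreal (norm (p (\<tau> n) a - p t a)) \<partial>leb d)"
      by (rule nn_integral_cmult) measurable
    finally show ?thesis .
  qed
  have "(\<lambda>n. ennreal B * (\<integral>\<^sup>+a. ennreal (norm (p (\<tau> n) a - p t a)) \<partial>leb d)) \<longlonglongrightarrow> ennreal B * 0"
    by (rule ennreal_tendsto_cmult[OF _ lim]) simp
  then have up: "(\<lambda>n. ennreal B * (\<integral>\<^sup>+a. ennreal (norm (p (\<tau> n) a - p t a)) \<partial>leb d)) \<longlonglongrightarrow> 0" by simp
  have "(\<lambda>n. ennreal \<bar>Q (\<tau> n) g x - Q t g x\<bar>) \<longlonglongrightarrow> 0"
    by (rule tendsto_sandwich[OF _ _ tendsto_const up]) (use le in auto)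
  then have "(\<lambda>n. ennreal \<bar>Q (\<tau> n) g x - Q t g x\<bar>) \<longlonglongrightarrow> ennreal 0" by simp
  then have "(\<lambda>n. \<bar>Q (\<tau> n) g x - Q t g x\<bar>) \<longlonglongrightarrow> 0"
    by (subst (asm) tendsto_ennreal_iff) auto
  then show ?thesis by (simp add: LIM_zero_cancel tendsto_rabs_zero_iff)
qed

lemma Q_Q:
  assumes s: "0 < s" and t: "0 < t"
    and [measurable]: "g \<in> borel_measurable (leb d)" and B: "\<And>y. \<bar>g y\<bar> \<le> B"
  shows "Q s (Q t g) x = Q (s + t) g x"
proof -
  have B0: "0 \<le> B" using B[of undefined] by linarith
  define f where "f y z = g z * p t (\<lambda>i. z i - y i) * p s (\<lambda>i. y i - x i)" for y z
  have [measurable]: "case_prod f \<in> borel_measurable (leb d \<Otimes>\<^sub>M leb d)" unfolding f_def by measurable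
  have fi: "integrable (leb d \<Otimes>\<^sub>M leb d) (case_prod f)"
  proof (rule integrable_leb_pairI[where F = "\<lambda>y. B * p s (\<lambda>i. y i - x i)"])
    fix y
    have "(\<integral>\<^sup>+z. ennreal \<bar>f y z\<bar> \<partial>leb d) \<le> (\<integral>\<^sup>+z. ennreal (B * p s (\<lambda>i. y i - x i)) * ennreal (p t (\<lambda>i. z i - y i)) \<partial>leb d)"
      using B B0 p_nonneg[OF s] p_nonneg[OF t]
      by (intro nn_integral_mono) (auto simp: f_def abs_mult ennreal_mult[symmetric] mult_ac intro!: mult_right_mono)
    also have "\<dots> = ennreal (B * p s (\<lambda>i. y i - x i))" by (simp add: nn_integral_cmult p_shift_nn[OF t])
    finally show "(\<integral>\<^sup>+z. ennreal \<bar>f y z\<bar> \<partial>leb d) \<le> ennreal (B * p s (\<lambda>i. y i - x i))" .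
  qed (use p_shift(1)[OF s, of x] B0 p_nonneg[OF s] in auto)
  have inner: "(\<integral>y. f y z \<partial>leb d) = g z * p (s + t) (\<lambda>i. z i - x i)" for z
  proof -
    have pp: "(\<lambda>y. p s (\<lambda>i. y i - x i) * p t (\<lambda>i. z i - y i)) \<in> borel_measurable (leb d)"
    proof -
      have "p t (\<lambda>i. z i - y i) = p t (\<lambda>i. y i - z i)" for y using p_minus[OF t, of "\<lambda>i. y i - z i"] by simp
      then show ?thesis by simp
    qed
    have "(\<integral>y. f y z \<partial>leb d) = g z * (\<integral>y. p s (\<lambda>i. y i - x i) * p t (\<lambda>i. z i - y i) \<partial>leb d)"
      unfolding f_def by (subst integral_mult_right_zero[symmetric]) (simp add: mult_ac)
    also have "(\<integral>y. p s (\<lambda>i. y i - x i) * p t (\<lambda>i. z i - y i) \<partial>leb d) = (\<integral>w. p s w * p t (\<lambda>i. z i - affine_map d x 1 w i) \<partial>leb d)"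
      using integral_affine[OF _ pp, of 1 x] by (simp add: p_diff_affine)
    also have "(\<lambda>w. p t (\<lambda>i. z i - affine_map d x 1 w i)) = (\<lambda>w. p t (\<lambda>i. (z i - x i) - w i))"
      by (intro ext stable_density_cong) (simp add: affine_map_def)
    finally show ?thesis by (simp add: p_convolution[OF s t])
  qed
  have "Q s (Q t g) x = (\<integral>y. (\<integral>z. f y z \<partial>leb d) \<partial>leb d)"
    unfolding Q_def f_def by simp
  also have "\<dots> = (\<integral>z. (\<integral>y. f y z \<partial>leb d) \<partial>leb d)"
    by (rule leb_pair.Fubini_integral[OF fi, symmetric])
  also have "\<dots> = Q (s + t) g x" unfolding inner Q_def ..
  finally show ?thesis .
qed

text \<open>The variance of \<open>g\<close> under the law with density \<open>p t\<close> centred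
  at \<open>x\<close>. This form suits the semigroup property; \<open>V_variance\<close> gives the
  centred one.\<close>

definition V :: "real \<Rightarrow> ((nat \<Rightarrow> real) \<Rightarrow> real) \<Rightarrow> (nat \<Rightarrow> real) \<Rightarrow> real" where
  "V t g x = Q t (\<lambda>y. (g y)\<^sup>2) x - (Q t g x)\<^sup>2"

lemma V_variance:
  assumes t: "0 < t" and [measurable]: "g \<in> borel_measurable (leb d)" and B: "\<And>y. \<bar>g y\<bar> \<le> B"
  shows "integrable (leb d) (\<lambda>y. (g y - Q t g x)\<^sup>2 * p t (\<lambda>i. y i - x i))"
    and "V t g x = (\<integral>y. (g y - Q t g x)\<^sup>2 * p t (\<lambda>i. y i - x i) \<partial>leb d)"
proof -
  define m where "m = Q t g x"
  have gB2: "\<bar>(g y)\<^sup>2\<bar> \<le> B\<^sup>2" for y using B[of y] by (simp add: abs_le_square_iff[symmetric])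
  have i1: "integrable (leb d) (\<lambda>y. (g y)\<^sup>2 * p t (\<lambda>i. y i - x i))"
    by (rule Q_integrable(1)[OF t _ gB2]) measurable
  note i2 = Q_integrable(1)[OF t assms(2) B, of x] and i3 = p_shift(1)[OF t, of x]
  have e: "(\<lambda>y. (g y - m)\<^sup>2 * p t (\<lambda>i. y i - x i)) = (\<lambda>y. (g y)\<^sup>2 * p t (\<lambda>i. y i - x i)
     - 2 * m * (g y * p t (\<lambda>i. y i - x i)) + m\<^sup>2 * p t (\<lambda>i. y i - x i))"
    by (simp add: fun_eq_iff power2_eq_square algebra_simps)
  show "integrable (leb d) (\<lambda>y. (g y - Q t g x)\<^sup>2 * p t (\<lambda>i. y i - x i))"
    unfolding m_def[symmetric] e using i1 i2 i3 by simp
  have "(\<integral>y. (g y - m)\<^sup>2 * p t (\<lambda>i. y i - x i) \<partial>leb d) = Q t (\<lambda>y. (g y)\<^sup>2) x - 2 * m * m + m\<^sup>2 * 1"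
    unfolding e using i1 i2 i3 by (simp add: Q_def[of t g] Q_def[of t "\<lambda>y. (g y)\<^sup>2"] m_def p_shift(2)[OF t])
  then show "V t g x = (\<integral>y. (g y - Q t g x)\<^sup>2 * p t (\<lambda>i. y i - x i) \<partial>leb d)"
    unfolding V_def m_def by (simp add: power2_eq_square)
qed

lemma V_nonneg:
  assumes "0 < t" "g \<in> borel_measurable (leb d)" "\<And>y. \<bar>g y\<bar> \<le> B"
  shows "0 \<le> V t g x"
  unfolding V_variance(2)[OF assms] using p_nonneg[OF assms(1)]
  by (intro Bochner_Integration.integral_nonneg) auto

text \<open>The Hoeffding projection is applied to \<open>g (x + a + b)\<close> with independent
  increments \<open>a\<close> and \<open>b\<close> of density \<open>p t\<close>. The full variance
  is then \<open>V (2 * t) g x\<close>, and averaging out one increment replaces \<open>g\<close> by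
  \<open>Q t g\<close>.\<close>

lemma V_double:
  assumes t: "0 < t" and [measurable]: "g \<in> borel_measurable (leb d)" and B: "\<And>y. \<bar>g y\<bar> \<le> B"
  shows "2 * V t (Q t g) x \<le> V (2 * t) g x"
proof -
  have B2: "\<bar>(g y)\<^sup>2\<bar> \<le> B\<^sup>2" for y using B[of y] by (simp add: abs_le_square_iff[symmetric])
  define N where "N = density (leb d) (\<lambda>a. ennreal (p t a))"
  have N: "(\<integral>a. f a \<partial>N) = (\<integral>a. f a * p t a \<partial>leb d)" if "f \<in> borel_measurable (leb d)" for f :: "_ \<Rightarrow> real"
    using that p_nonneg[OF t] unfolding N_def by (subst integral_real_density) (auto simp: mult.commute)
  have sN [measurable_cong]: "sets N = sets (leb d)" by (simp add: N_def)
  interpret N: prob_space N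
    by (rule prob_spaceI)
       (use p_integrable[OF t] p_integral[OF t] p_nonneg[OF t] in \<open>simp add: N_def emeasure_density nn_integral_eq_integral cong: nn_integral_cong_simp\<close>)
  define k where "k a b = g (affine_map d x 1 (affine_map d a 1 b))" for a b
  have ka: "k a b = g (affine_map d (affine_map d x 1 a) 1 b)" for a b
    unfolding k_def by (rule arg_cong[where f = g]) (auto simp: affine_map_def)
  have ksym: "k a b = k b a" for a b
    unfolding k_def by (rule arg_cong[where f = g]) (auto simp: affine_map_def)
  have aff2: "(\<lambda>z. affine_map d (fst z) 1 (snd z)) \<in> measurable (leb d \<Otimes>\<^sub>M leb d) (leb d)"
    unfolding affine_map_def by measurable
  have km [measurable]: "case_prod k \<in> borel_measurable (leb d \<Otimes>\<^sub>M leb d)"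
    unfolding k_def case_prod_beta using aff2 by measurable
  have kmN: "case_prod k \<in> borel_measurable (N \<Otimes>\<^sub>M N)"
    using km by (simp add: measurable_cong_sets[OF sets_pair_measure_cong[OF sN sN] refl])
  have kb: "(\<lambda>b. k a b) \<in> borel_measurable (leb d)" for a
    unfolding k_def by measurable
  have Qk: "(\<integral>b. k a b \<partial>N) = Q t g (affine_map d x 1 a)" for a
  proof -
    have "(\<integral>b. k a b \<partial>N) = (\<integral>b. k a b * p t b \<partial>leb d)" by (rule N[OF kb])
    then show ?thesis by (simp add: Q_alt ka)
  qed
  have Qk2: "(\<integral>b. (k a b)\<^sup>2 \<partial>N) = Q t (\<lambda>y. (g y)\<^sup>2) (affine_map d x 1 a)" for a
  proof -
    have "(\<integral>b. (k a b)\<^sup>2 \<partial>N) = (\<integral>b. (k a b)\<^sup>2 * p t b \<partial>leb d)" by (intro N borel_measurable_power kb)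
    then show ?thesis by (simp add: Q_alt ka)
  qed
  have kB: "\<bar>k a b\<bar> \<le> B" for a b unfolding k_def by (rule B)
  have *: "2 * (\<integral>a. (Q t g (affine_map d x 1 a))\<^sup>2 \<partial>N) \<le> (\<integral>a. Q t (\<lambda>y. (g y)\<^sup>2) (affine_map d x 1 a) \<partial>N) + (\<integral>a. Q t g (affine_map d x 1 a) \<partial>N)\<^sup>2"
    using N.hoeffding_projection[OF kmN kB ksym] unfolding Qk Qk2 .
  have QQ: "Q t (Q t g) x = Q (2 * t) g x" "Q t (Q t (\<lambda>y. (g y)\<^sup>2)) x = Q (2 * t) (\<lambda>y. (g y)\<^sup>2) x"
    using Q_Q[OF t t assms(2) B] Q_Q[OF t t _ B2] by auto
  have "2 * Q t (\<lambda>y. (Q t g y)\<^sup>2) x \<le> Q t (Q t (\<lambda>y. (g y)\<^sup>2)) x + (Q t (Q t g) x)\<^sup>2"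
    using * by (simp add: N Q_alt[of "Q t g"] Q_alt[of "\<lambda>y. (Q t g y)\<^sup>2"] Q_alt[of "Q t (\<lambda>y. (g y)\<^sup>2)"])
  then show ?thesis unfolding V_def QQ by simp
qed

text \<open>The induction hypothesis for \<open>Q (2 ^ Suc m * t) g\<close> handles one half of the
  time, and \<open>V_double\<close> compares the two halves. Restricting to powers of two reduces
  everything to projections in two variables and still reaches arbitrarily short increments.\<close>

lemma V_dyadic:
  assumes t: "0 < t" and [measurable]: "g \<in> borel_measurable (leb d)" and B: "\<And>y. \<bar>g y\<bar> \<le> B"
  shows "2 ^ Suc m * V t (Q ((2 ^ Suc m - 1) * t) g) x \<le> V (2 ^ Suc m * t) g x"
  using assms
proof (induction m arbitrary: g)
  case 0
  then show ?case using V_double[of t g B x] by simp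
next
  case (Suc m)
  let ?T = "2 ^ Suc m * t"
  have T: "0 < ?T" using t by simp
  have pos: "0 < (2 ^ Suc m - 1) * t" using t by (simp add: one_less_power del: power_Suc)
  have QQ: "Q ((2 ^ Suc m - 1) * t) (Q ?T g) = Q ((2 ^ Suc (Suc m) - 1) * t) g"
  proof
    fix z
    show "Q ((2 ^ Suc m - 1) * t) (Q ?T g) z = Q ((2 ^ Suc (Suc m) - 1) * t) g z"
      unfolding Q_Q[OF pos T Suc.prems(2,3)] by (simp add: algebra_simps)
  qed
  have "2 ^ Suc m * V t (Q ((2 ^ Suc m - 1) * t) (Q ?T g)) x \<le> V ?T (Q ?T g) x"
    by (rule Suc.IH[OF t Q_measurable[OF Suc.prems(2)] Q_bound[OF T Suc.prems(2,3)]])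
  then have "2 * (2 ^ Suc m * V t (Q ((2 ^ Suc (Suc m) - 1) * t) g) x) \<le> 2 * V ?T (Q ?T g) x"
    unfolding QQ by simp
  also have "\<dots> \<le> V (2 * ?T) g x" by (rule V_double[OF T Suc.prems(2,3)])
  finally show ?case by (simp add: mult.assoc)
qed

text \<open>With \<open>\<eta>\<close> cut into \<open>2 ^ Suc m\<close> pieces of length
  \<open>t m\<close>, \<open>V_dyadic\<close> bounds the integral of
  \<open>\<eta> * (gm m y - f x)^2 * p (t m) (y - x) / t m\<close> by \<open>V \<eta> g x\<close>.
  As \<open>m\<close> grows, \<open>gm m\<close> tends to \<open>Q \<eta> g\<close> and the quotient
  to the jump kernel, so Fatou's lemma yields the energy density at \<open>x\<close>.\<close>

lemma carre_du_champ_le: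
  assumes \<eta>: "0 < \<eta>" and [measurable]: "g \<in> borel_measurable (leb d)" and B: "\<And>y. \<bar>g y\<bar> \<le> B"
    and x: "x \<in> space (leb d)"
  shows "ennreal (\<eta> * frac_const d \<alpha>) *
      (\<integral>\<^sup>+y. ennreal ((Q \<eta> g y - Q \<eta> g x)\<^sup>2 / enorm d (\<lambda>i. y i - x i) powr (real d + \<alpha>)) \<partial>leb d)
    \<le> ennreal (V \<eta> g x)"
proof -
  note c0 = frac_const_nonneg[OF \<alpha>0, of d]
  define t where "t m = \<eta> / 2 ^ Suc m" for m
  have t0: "0 < t m" for m using \<eta> by (simp add: t_def)
  have t_eq1: "2 ^ Suc m * t m = \<eta>" for m
    by (simp add: t_def)
  then have t_eq: "2 ^ Suc m * t m = \<eta>" "(2 ^ Suc m - 1) * t m = \<eta> - t m" for m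
    by (auto simp only: left_diff_distrib mult_1)
  have t_half: "t m \<le> \<eta> / 2" for m
    using \<eta> unfolding t_def by (intro divide_left_mono) auto
  have t_lim: "t \<longlonglongrightarrow> 0" unfolding t_def by real_asymp
  define f where "f = Q \<eta> g"
  define gm where "gm m = Q (\<eta> - t m) g" for m
  have [measurable]: "f \<in> borel_measurable (leb d)" "gm m \<in> borel_measurable (leb d)" for m
    unfolding f_def gm_def by measurable
  have \<eta>t: "0 < \<eta> - t m" for m using t_half[of m] \<eta> by linarith
  have gmB: "\<bar>gm m y\<bar> \<le> B" for m y unfolding gm_def by (rule Q_bound[OF \<eta>t assms(2) B])
  have gm_lim: "(\<lambda>m. gm m y) \<longlonglongrightarrow> f y" for y
    unfolding gm_def f_def
  proof (rule Q_tendsto[OF \<eta> _ _ assms(2) B])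
    show "\<eta> / 2 \<le> \<eta> - t m" for m using t_half[of m] by simp
    show "(\<lambda>m. \<eta> - t m) \<longlonglongrightarrow> \<eta>" using tendsto_diff[OF tendsto_const[of \<eta>] t_lim] by simp
  qed
  \<comment> \<open>The semigroup property makes the centre of the small-time variance equal to
    \<open>f x\<close> for every \<open>m\<close>, so the limit is a squared increment of
    \<open>f\<close>.\<close>
  have Qf: "Q (t m) (gm m) x = f x" for m
    unfolding gm_def f_def using Q_Q[OF t0 \<eta>t assms(2) B] by simp
  have V_eq: "V (t m) (gm m) x = (\<integral>y. (gm m y - f x)\<^sup>2 * p (t m) (\<lambda>i. y i - x i) \<partial>leb d)"
    and V_int: "integrable (leb d) (\<lambda>y. (gm m y - f x)\<^sup>2 * p (t m) (\<lambda>i. y i - x i))" for m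
    using V_variance[where t = "t m" and g = "gm m" and B = B and x = x] t0[of m] gmB[of m] unfolding Qf by simp_all
  define u where "u m y = ennreal (\<eta> * (gm m y - f x)\<^sup>2 * (p (t m) (\<lambda>i. y i - x i) / t m))" for m y
  have [measurable]: "u m \<in> borel_measurable (leb d)" for m unfolding u_def by measurable
  have u_le: "(\<integral>\<^sup>+y. u m y \<partial>leb d) \<le> ennreal (V \<eta> g x)" for m
  proof -
    have "u m y = ennreal (2 ^ Suc m) * ennreal ((gm m y - f x)\<^sup>2 * p (t m) (\<lambda>i. y i - x i))" for y
      unfolding u_def using t0[of m] \<eta> p_nonneg[OF t0, of m]
      by (subst ennreal_mult[symmetric]) (auto simp: t_def field_simps)
    then have "(\<integral>\<^sup>+y. u m y \<partial>leb d) = ennreal (2 ^ Suc m) * (\<integral>\<^sup>+y. ennreal ((gm m y - f x)\<^sup>2 * p (t m) (\<lambda>i. y i - x i)) \<partial>leb d)"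
      by (simp add: nn_integral_cmult)
    also have "\<dots> = ennreal (2 ^ Suc m * V (t m) (gm m) x)"
    proof -
      have "(\<integral>\<^sup>+y. ennreal ((gm m y - f x)\<^sup>2 * p (t m) (\<lambda>i. y i - x i)) \<partial>leb d) = ennreal (V (t m) (gm m) x)"
        unfolding V_eq by (rule nn_integral_eq_integral[OF V_int]) (use p_nonneg[OF t0, of m] in auto)
      moreover have "0 \<le> V (t m) (gm m) x"
        unfolding V_eq using p_nonneg[OF t0, of m] by (intro Bochner_Integration.integral_nonneg) auto
      ultimately show ?thesis by (subst ennreal_mult) auto
    qed
    also have "\<dots> \<le> ennreal (V \<eta> g x)"
      using V_dyadic[OF t0 assms(2) B, of m m x] unfolding t_eq gm_def by (rule ennreal_leI)
    finally show ?thesis .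
  qed
  have "ennreal (\<eta> * frac_const d \<alpha>) *
      (\<integral>\<^sup>+y. ennreal ((f y - f x)\<^sup>2 / enorm d (\<lambda>i. y i - x i) powr (real d + \<alpha>)) \<partial>leb d)
    = (\<integral>\<^sup>+y. ennreal (\<eta> * frac_const d \<alpha>) * (ennreal ((f y - f x)\<^sup>2 / enorm d (\<lambda>i. y i - x i) powr (real d + \<alpha>))) \<partial>leb d)"
  proof (rule nn_integral_cmult[symmetric])
    have [measurable]: "(\<lambda>y. enorm d (\<lambda>i. y i - x i)) \<in> borel_measurable (leb d)"
      using x by (intro measurable_enorm_diff) auto
    show "(\<lambda>y. ennreal ((f y - f x)\<^sup>2 / enorm d (\<lambda>i. y i - x i) powr (real d + \<alpha>))) \<in> borel_measurable (leb d)"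
      by measurable
  qed
  also have "\<dots> \<le> (\<integral>\<^sup>+y. liminf (\<lambda>m. u m y) \<partial>leb d)"
  proof (rule nn_integral_mono)
    fix y assume y: "y \<in> space (leb d)"
    show "ennreal (\<eta> * frac_const d \<alpha>) * (ennreal ((f y - f x)\<^sup>2 / enorm d (\<lambda>i. y i - x i) powr (real d + \<alpha>)))
      \<le> liminf (\<lambda>m. u m y)"
    proof (cases "y = x")
      case False
      define z where "z = (\<lambda>i. y i - x i)"
      have "enorm d z \<noteq> 0"
        using False enorm_diff_eq_0[OF y x] unfolding z_def by simp
      then have z: "0 < enorm d z" using enorm_nonneg[of d z] by linarith
      have "filterlim t (at_right 0) sequentially"
        using t_lim t0 by (intro tendsto_imp_filterlim_at_right) auto
      then have pl: "(\<lambda>m. p (t m) z / t m) \<longlonglongrightarrow> frac_const d \<alpha> / enorm d z powr (real d + \<alpha>)"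
        by (rule filterlim_compose[OF stable_density_small_time[OF d1 \<alpha>0 \<alpha>2 z]])
      have "(\<lambda>m. u m y) \<longlonglongrightarrow> ennreal (\<eta> * (f y - f x)\<^sup>2 * (frac_const d \<alpha> / enorm d z powr (real d + \<alpha>)))"
        unfolding u_def z_def[symmetric]
        by (intro tendsto_ennrealI tendsto_mult tendsto_power tendsto_diff tendsto_const gm_lim pl)
      then have "liminf (\<lambda>m. u m y) = ennreal (\<eta> * (f y - f x)\<^sup>2 * (frac_const d \<alpha> / enorm d z powr (real d + \<alpha>)))"
        by (intro lim_imp_Liminf) auto
      also have "\<dots> = ennreal (\<eta> * frac_const d \<alpha>) * ennreal ((f y - f x)\<^sup>2 / enorm d z powr (real d + \<alpha>))"
        using \<eta> c0 by (subst ennreal_mult[symmetric]) (auto simp: mult_ac)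
      finally show ?thesis by (simp add: z_def)
    qed simp
  qed
  also have "\<dots> \<le> liminf (\<lambda>m. \<integral>\<^sup>+y. u m y \<partial>leb d)"
    by (rule nn_integral_liminf) measurable
  also have "\<dots> \<le> ennreal (V \<eta> g x)"
    using u_le by (intro Liminf_le) auto
  finally show ?thesis by (simp add: f_def)
qed

end

section \<open>Contraction of the proximal sampler\<close>

text \<open>Multiplication of extended nonnegative reals is discontinuous at \<open>0\<close> times
  \<open>top\<close>, so the limit is taken through suprema of increasing sequences, with which
  multiplication commutes.\<close>

lemma ennreal_LIMSEQ_square:
  fixes a :: "nat \<Rightarrow> ennreal"
  assumes inc: "incseq a" and lim: "a \<longlonglongrightarrow> L"
  shows "(\<lambda>n. (a n)\<^sup>2) \<longlonglongrightarrow> L\<^sup>2"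
proof -
  have L: "L = (SUP n. a n)" using LIMSEQ_unique[OF lim LIMSEQ_SUP[OF inc]] .
  define S where "S = (SUP n. (a n)\<^sup>2)"
  have S: "(\<lambda>n. (a n)\<^sup>2) \<longlonglongrightarrow> S"
    unfolding S_def using inc by (intro LIMSEQ_SUP) (auto simp: incseq_def intro!: power_mono)
  have le: "a n * a k \<le> S" for n k
  proof -
    have "a n * a k \<le> (a (max n k))\<^sup>2"
      unfolding power2_eq_square using inc by (intro mult_mono) (auto simp: incseq_def)
    also have "\<dots> \<le> S" unfolding S_def by (rule SUP_upper) simp
    finally show ?thesis .
  qed
  have 1: "L * a k \<le> S" for k
    unfolding L SUP_mult_right_ennreal by (rule SUP_least) (rule le)
  have "a k * L \<le> S" for k using 1[of k] by (simp add: mult.commute)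
  then have "(SUP k. a k) * L \<le> S" unfolding SUP_mult_right_ennreal by (intro SUP_least) auto
  then have "L\<^sup>2 \<le> S" using L by (simp add: power2_eq_square)
  moreover have "S \<le> L\<^sup>2"
    unfolding S_def L by (intro SUP_least power_mono SUP_upper) auto
  ultimately show ?thesis using S by simp
qed

lemma ennreal_tendsto_mult_right:
  fixes a :: "nat \<Rightarrow> ennreal"
  assumes "a \<longlonglongrightarrow> L" "c < top"
  shows "(\<lambda>n. a n * c) \<longlonglongrightarrow> L * c"
  using ennreal_tendsto_cmult[OF assms(2,1)] by (simp add: mult.commute)

text \<open>The diagonal contributes nothing because \<open>0 / 0 = 0\<close>.\<close>

lemma frac_energy_alt:
  "frac_energy d \<theta> \<mu> f = ennreal (frac_const d \<theta>) *
     (\<integral>\<^sup>+y. (\<integral>\<^sup>+x. ennreal ((f x - f y)\<^sup>2 / enorm d (\<lambda>i. x i - y i) powr (real d + \<theta>)) \<partial>leb d)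
            * ennreal (\<mu> y) \<partial>leb d)"
proof -
  have "ennreal ((f x - f y)\<^sup>2 / enorm d (\<lambda>i. x i - y i) powr (real d + \<theta>)) * indicator {z. z \<noteq> y} x
    = ennreal ((f x - f y)\<^sup>2 / enorm d (\<lambda>i. x i - y i) powr (real d + \<theta>))" for x y
    by (auto simp: indicator_def)
  then show ?thesis unfolding frac_energy_def by simp
qed

locale proximal = stable_kernel +
  fixes \<pi> :: "(nat \<Rightarrow> real) \<Rightarrow> real" and \<eta> C :: real
  assumes \<pi>_meas [measurable]: "\<pi> \<in> borel_measurable (leb d)"
    and \<pi>_pos: "\<And>x. 0 < \<pi> x"
    and \<pi>_int: "(\<integral>\<^sup>+x. ennreal (\<pi> x) \<partial>leb d) = 1"
    and \<eta>: "0 < \<eta>"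
    and FPI: "fractional_poincare d \<alpha> \<pi> C"
begin

abbreviation M\<pi> :: "(nat \<Rightarrow> real) measure" where "M\<pi> \<equiv> density (leb d) (\<lambda>x. ennreal (\<pi> x))"

lemma C_pos: "0 < C" using FPI by (simp add: fractional_poincare_def)

lemma prob_M\<pi>: "prob_space M\<pi>"
  by (rule prob_spaceI) (simp add: emeasure_density \<pi>_int cong: nn_integral_cong_simp)

lemma energy_Q_le:
  assumes [measurable]: "g \<in> borel_measurable (leb d)" and B: "\<And>y. \<bar>g y\<bar> \<le> B"
  shows "ennreal \<eta> * frac_energy d \<alpha> \<pi> (Q \<eta> g) \<le> (\<integral>\<^sup>+x. ennreal (V \<eta> g x) * ennreal (\<pi> x) \<partial>leb d)"
proof -
  define inner where "inner y = (\<integral>\<^sup>+x. ennreal ((Q \<eta> g x - Q \<eta> g y)\<^sup>2 / enorm d (\<lambda>i. x i - y i) powr (real d + \<alpha>)) \<partial>leb d)" for y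
  have [measurable]: "inner \<in> borel_measurable (leb d)"
    unfolding inner_def by measurable
  have "ennreal \<eta> * frac_energy d \<alpha> \<pi> (Q \<eta> g) = ennreal (\<eta> * frac_const d \<alpha>) * (\<integral>\<^sup>+y. inner y * ennreal (\<pi> y) \<partial>leb d)"
    unfolding frac_energy_alt inner_def using \<eta> frac_const_nonneg[OF \<alpha>0, of d] by (simp add: ennreal_mult mult.assoc)
  also have "\<dots> = (\<integral>\<^sup>+y. (ennreal (\<eta> * frac_const d \<alpha>) * inner y) * ennreal (\<pi> y) \<partial>leb d)"
    by (simp add: nn_integral_cmult[symmetric] mult.assoc)
  also have "\<dots> \<le> (\<integral>\<^sup>+x. ennreal (V \<eta> g x) * ennreal (\<pi> x) \<partial>leb d)"
    unfolding inner_def using carre_du_champ_le[OF \<eta> assms] by (intro nn_integral_mono mult_right_mono) auto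
  finally show ?thesis .
qed

text \<open>This is \<open>(1 + \<eta> / C) Var (Q \<eta> g) \<le> Var g\<close>, the variances being taken under \<open>\<pi>\<close> and under its convolution
  with \<open>p \<eta>\<close>; both sides are moved so that no subtraction of extended reals occurs.\<close>

lemma contraction_bounded:
  assumes g [measurable]: "g \<in> borel_measurable (leb d)" and g0: "\<And>y. 0 \<le> g y" and gB: "\<And>y. g y \<le> B"
  shows "ennreal (1 + \<eta> / C) * (\<integral>\<^sup>+x. ennreal ((Q \<eta> g x)\<^sup>2) * ennreal (\<pi> x) \<partial>leb d) + (\<integral>\<^sup>+x. ennreal (Q \<eta> g x) * ennreal (\<pi> x) \<partial>leb d)\<^sup>2
    \<le> (\<integral>\<^sup>+x. ennreal (Q \<eta> (\<lambda>y. (g y)\<^sup>2) x) * ennreal (\<pi> x) \<partial>leb d) + ennreal (1 + \<eta> / C) * (\<integral>\<^sup>+x. ennreal (Q \<eta> g x) * ennreal (\<pi> x) \<partial>leb d)\<^sup>2"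
proof -
  interpret M\<pi>: prob_space M\<pi> by (rule prob_M\<pi>)
  have B: "\<bar>g y\<bar> \<le> B" for y using g0 gB by simp
  have B0: "0 \<le> B" using B[of undefined] by linarith
  have B2: "\<bar>(g y)\<^sup>2\<bar> \<le> B\<^sup>2" for y using B[of y] by (simp add: abs_le_square_iff[symmetric])
  define f where "f = Q \<eta> g"
  define f2 where "f2 = Q \<eta> (\<lambda>y. (g y)\<^sup>2)"
  have [measurable]: "f \<in> borel_measurable (leb d)" "f2 \<in> borel_measurable (leb d)" unfolding f_def f2_def by measurable
  have fB: "\<bar>f x\<bar> \<le> B" for x unfolding f_def by (rule Q_bound[OF \<eta> g B])
  have f2B: "\<bar>f2 x\<bar> \<le> B\<^sup>2" for x unfolding f2_def by (rule Q_bound[OF \<eta> _ B2]) measurable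
  have f0: "0 \<le> f x" for x unfolding f_def Q_def using g0 p_nonneg[OF \<eta>] by (intro Bochner_Integration.integral_nonneg) auto
  have f20: "0 \<le> f2 x" for x unfolding f2_def Q_def using p_nonneg[OF \<eta>] by (intro Bochner_Integration.integral_nonneg) auto
  have if1: "integrable M\<pi> f" by (rule M\<pi>.integrable_const_bound[where B = B]) (use fB in auto)
  have iff: "integrable M\<pi> (\<lambda>x. (f x)\<^sup>2)"
    by (rule M\<pi>.integrable_const_bound[where B = "B\<^sup>2"]) (use fB abs_le_square_iff[of _ B] B0 in auto)
  have if2: "integrable M\<pi> f2" by (rule M\<pi>.integrable_const_bound[where B = "B\<^sup>2"]) (use f2B in auto)
  have nn: "(\<integral>\<^sup>+x. ennreal (h x) * ennreal (\<pi> x) \<partial>leb d) = ennreal (\<integral>x. h x \<partial>M\<pi>)"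
    if "integrable M\<pi> h" "\<And>x. 0 \<le> h x" "h \<in> borel_measurable (leb d)" for h
  proof -
    have "ennreal (\<integral>x. h x \<partial>M\<pi>) = (\<integral>\<^sup>+x. ennreal (h x) \<partial>M\<pi>)"
      using that by (intro nn_integral_eq_integral[symmetric]) auto
    also have "\<dots> = (\<integral>\<^sup>+x. ennreal (\<pi> x) * ennreal (h x) \<partial>leb d)" using that by (subst nn_integral_density) auto
    finally show ?thesis by (simp add: mult.commute)
  qed
  define S where "S = (\<integral>x. (f x)\<^sup>2 \<partial>M\<pi>)"
  define S2 where "S2 = (\<integral>x. f2 x \<partial>M\<pi>)"
  define m where "m = (\<integral>x. f x \<partial>M\<pi>)"
  have Vf: "V \<eta> g x = f2 x - (f x)\<^sup>2" for x by (simp add: V_def f_def f2_def)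
  have EV: "(\<integral>\<^sup>+x. ennreal (V \<eta> g x) * ennreal (\<pi> x) \<partial>leb d) = ennreal (S2 - S)"
  proof -
    have "(\<integral>\<^sup>+x. ennreal (V \<eta> g x) * ennreal (\<pi> x) \<partial>leb d) = ennreal (\<integral>x. V \<eta> g x \<partial>M\<pi>)"
      by (rule nn) (use if2 iff V_nonneg[OF \<eta> g B] in \<open>auto simp: Vf\<close>)
    also have "(\<integral>x. V \<eta> g x \<partial>M\<pi>) = S2 - S" unfolding Vf S2_def S_def using if2 iff by simp
    finally show ?thesis .
  qed
  have en: "ennreal \<eta> * frac_energy d \<alpha> \<pi> f \<le> ennreal (S2 - S)"
    using energy_Q_le[OF g B] unfolding EV f_def .
  \<comment> \<open>The variance bound forces the energy of \<open>f\<close> to be finite. Hence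
    \<open>f\<close> lies in the domain of the Dirichlet form, and the Poincare inequality may be
    applied to it.\<close>
  have fin: "frac_energy d \<alpha> \<pi> f < \<infinity>"
  proof (rule ccontr)
    assume "\<not> frac_energy d \<alpha> \<pi> f < \<infinity>"
    then have "frac_energy d \<alpha> \<pi> f = \<infinity>"
      unfolding infinity_ennreal_def using top.not_eq_extremum[of "frac_energy d \<alpha> \<pi> f"] by blast
    with en \<eta> show False by (simp add: ennreal_mult_top top_unique)
  qed
  have dom: "f \<in> frac_domain d \<alpha> \<pi>" unfolding frac_domain_def using iff fin by simp
  have var: "M\<pi>.variance f = S - m\<^sup>2" unfolding S_def m_def by (rule M\<pi>.variance_eq[OF if1 iff])
  have "ennreal (S - m\<^sup>2) \<le> ennreal C * frac_energy d \<alpha> \<pi> f"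
    using FPI dom unfolding fractional_poincare_def var[symmetric] by blast
  then have "ennreal \<eta> * ennreal (S - m\<^sup>2) \<le> ennreal \<eta> * (ennreal C * frac_energy d \<alpha> \<pi> f)" by (rule mult_left_mono) simp
  also have "\<dots> = ennreal C * (ennreal \<eta> * frac_energy d \<alpha> \<pi> f)" by (simp add: mult_ac)
  also have "\<dots> \<le> ennreal C * ennreal (S2 - S)" by (rule mult_left_mono[OF en]) simp
  finally have le: "ennreal (\<eta> * (S - m\<^sup>2)) \<le> ennreal (C * (S2 - S))"
    using \<eta> C_pos by (simp add: ennreal_mult')
  have "0 \<le> S2 - S"
  proof -
    have "0 \<le> (\<integral>x. V \<eta> g x \<partial>M\<pi>)" using V_nonneg[OF \<eta> g B] by (intro Bochner_Integration.integral_nonneg) auto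
    also have "\<dots> = S2 - S" unfolding Vf S2_def S_def using if2 iff by simp
    finally show ?thesis .
  qed
  then have "\<eta> * (S - m\<^sup>2) \<le> C * (S2 - S)" using le C_pos by (subst (asm) ennreal_le_iff) auto
  then have "(\<eta> / C) * (S - m\<^sup>2) \<le> S2 - S" using C_pos by (simp add: field_simps)
  then have real: "(1 + \<eta> / C) * S + m\<^sup>2 \<le> S2 + (1 + \<eta> / C) * m\<^sup>2" by (simp add: algebra_simps)
  have pos: "0 \<le> S" "0 \<le> S2" "0 \<le> m" "0 \<le> 1 + \<eta> / C"
    unfolding S_def S2_def m_def using f0 f20 \<eta> C_pos by (auto intro!: Bochner_Integration.integral_nonneg)
  have "ennreal (1 + \<eta> / C) * ennreal S + (ennreal m)\<^sup>2 \<le> ennreal S2 + ennreal (1 + \<eta> / C) * (ennreal m)\<^sup>2"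
  proof -
    have l: "ennreal (1 + \<eta> / C) * ennreal a + (ennreal m)\<^sup>2 = ennreal ((1 + \<eta> / C) * a + m\<^sup>2)" if "0 \<le> a" for a
      unfolding ennreal_power[OF pos(3)] ennreal_mult[OF pos(4) that, symmetric]
      using pos that by (intro ennreal_plus[symmetric] mult_nonneg_nonneg) auto
    have r: "ennreal S2 + ennreal (1 + \<eta> / C) * (ennreal m)\<^sup>2 = ennreal (S2 + (1 + \<eta> / C) * m\<^sup>2)"
      unfolding ennreal_power[OF pos(3)] ennreal_mult[OF pos(4) zero_le_power2, symmetric]
      using pos by (intro ennreal_plus[symmetric] mult_nonneg_nonneg) auto
    show ?thesis unfolding l[OF pos(1)] r by (rule ennreal_leI[OF real])
  qed
  moreover have "(\<integral>\<^sup>+x. ennreal (f x) * ennreal (\<pi> x) \<partial>leb d) = ennreal m"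
    unfolding m_def by (rule nn[OF if1 f0]) measurable
  moreover have "(\<integral>\<^sup>+x. ennreal ((f x)\<^sup>2) * ennreal (\<pi> x) \<partial>leb d) = ennreal S"
    unfolding S_def by (rule nn[OF iff]) auto
  moreover have "(\<integral>\<^sup>+x. ennreal (f2 x) * ennreal (\<pi> x) \<partial>leb d) = ennreal S2"
    unfolding S2_def by (rule nn[OF if2 f20]) measurable
  ultimately show ?thesis unfolding f_def f2_def by (simp only:)
qed

text \<open>\<open>Q \<eta>\<close> for extended nonnegative functions: density ratios along the
  sampler are in general neither bounded nor known to be finite everywhere.\<close>

definition T :: "((nat \<Rightarrow> real) \<Rightarrow> ennreal) \<Rightarrow> (nat \<Rightarrow> real) \<Rightarrow> ennreal" where
  "T g x = (\<integral>\<^sup>+y. g y * ennreal (p \<eta> (\<lambda>i. y i - x i)) \<partial>leb d)"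

lemma T_measurable [measurable]:
  assumes [measurable]: "g \<in> borel_measurable (leb d)"
  shows "T g \<in> borel_measurable (leb d)"
proof -
  have "(\<lambda>z. ennreal (p \<eta> (\<lambda>i. snd z i - fst z i))) \<in> borel_measurable (leb d \<Otimes>\<^sub>M leb d)"
    by (intro measurable_compose[OF measurable_stable_diff measurable_ennreal] measurable_fst measurable_snd)
  moreover have "(\<lambda>z. g (snd z)) \<in> borel_measurable (leb d \<Otimes>\<^sub>M leb d)"
    by (rule measurable_compose[OF measurable_snd assms])
  ultimately have "(\<lambda>z. g (snd z) * ennreal (p \<eta> (\<lambda>i. snd z i - fst z i))) \<in> borel_measurable (leb d \<Otimes>\<^sub>M leb d)"
    by (rule borel_measurable_times_ennreal[rotated])
  then show ?thesis
    unfolding T_def by (intro leb.borel_measurable_nn_integral) (simp add: case_prod_unfold)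
qed

lemma T_ennreal:
  assumes [measurable]: "g \<in> borel_measurable (leb d)" and "\<And>y. 0 \<le> g y" "\<And>y. g y \<le> B"
  shows "T (\<lambda>y. ennreal (g y)) x = ennreal (Q \<eta> g x)"
proof -
  have B: "\<bar>g y\<bar> \<le> B" for y using assms by simp
  have "T (\<lambda>y. ennreal (g y)) x = (\<integral>\<^sup>+y. ennreal (g y * p \<eta> (\<lambda>i. y i - x i)) \<partial>leb d)"
    unfolding T_def by (intro nn_integral_cong ennreal_mult[symmetric] assms p_nonneg \<eta>)
  also have "\<dots> = ennreal (Q \<eta> g x)"
    unfolding Q_def by (intro nn_integral_eq_integral Q_integrable[OF \<eta> assms(1) B] AE_I2 mult_nonneg_nonneg assms p_nonneg \<eta>)
  finally show ?thesis .
qed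

text \<open>Truncation at level \<open>n\<close> and monotone convergence remove the boundedness.
  The squared mean occurs on both sides: on the left it converges to \<open>1\<close>, on the right
  it is bounded by \<open>1\<close>, so no difference of limits has to be formed.\<close>

lemma contraction:
  assumes g [measurable]: "g \<in> borel_measurable (leb d)"
    and m: "(\<integral>\<^sup>+x. T g x * ennreal (\<pi> x) \<partial>leb d) = 1"
  shows "ennreal (1 + \<eta> / C) * (\<integral>\<^sup>+x. (T g x)\<^sup>2 * ennreal (\<pi> x) \<partial>leb d) + 1
    \<le> (\<integral>\<^sup>+x. T (\<lambda>y. (g y)\<^sup>2) x * ennreal (\<pi> x) \<partial>leb d) + ennreal (1 + \<eta> / C)"
proof -
  define gn where "gn n y = min (g y) (of_nat n)" for n y
  have gn_meas [measurable]: "gn n \<in> borel_measurable (leb d)" for n unfolding gn_def by measurable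
  have gn_lim: "(\<lambda>n. gn n y) \<longlonglongrightarrow> g y" for y
  proof -
    have "(\<lambda>n. min (g y) (of_nat n)) \<longlonglongrightarrow> min (g y) top"
      by (intro tendsto_min tendsto_const of_nat_tendsto_top_ennreal)
    then show ?thesis by (simp add: gn_def min_def)
  qed
  have gn_mono: "incseq (\<lambda>n y. gn n y)"
    unfolding gn_def by (auto simp: incseq_def le_fun_def intro: min.coboundedI2 intro!: min.mono)
  have fin: "gn n y < top" for n y unfolding gn_def by (simp add: min_less_iff_disj ennreal_of_nat_eq_real_of_nat)
  define gr where "gr n y = enn2real (gn n y)" for n y
  have [measurable]: "gr n \<in> borel_measurable (leb d)" for n unfolding gr_def by measurable
  have gr: "ennreal (gr n y) = gn n y" for n y unfolding gr_def using fin[of n y] by simp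
  have gr0: "0 \<le> gr n y" and grB: "gr n y \<le> real n" for n y
  proof -
    show "0 \<le> gr n y" by (simp add: gr_def)
    have "gn n y \<le> ennreal (real n)" unfolding gn_def by (simp add: ennreal_of_nat_eq_real_of_nat)
    then show "gr n y \<le> real n" unfolding gr_def by (intro enn2real_leI) auto
  qed
  have TQ: "T (gn n) x = ennreal (Q \<eta> (gr n) x)" for n x
    using T_ennreal[of "gr n" "real n" x] gr0 grB by (simp add: gr)
  have TQ2: "T (\<lambda>y. (gn n y)\<^sup>2) x = ennreal (Q \<eta> (\<lambda>y. (gr n y)\<^sup>2) x)" for n x
  proof -
    have "T (\<lambda>y. ennreal ((gr n y)\<^sup>2)) x = ennreal (Q \<eta> (\<lambda>y. (gr n y)\<^sup>2) x)"
      using gr0 grB by (intro T_ennreal[of _ "(real n)\<^sup>2"]) (auto intro!: power_mono)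
    then show ?thesis by (simp add: gr[symmetric] ennreal_power gr0)
  qed
  have Tmono: "T a x \<le> T b x" if "\<And>y. a y \<le> b y" for a b x
    unfolding T_def using that by (intro nn_integral_mono mult_right_mono) auto
  have Tinc: "incseq (\<lambda>n. T (gn n) x)" for x
    using gn_mono by (auto simp: incseq_def le_fun_def intro!: Tmono)
  have Tlim: "(\<lambda>n. T (gn n) x) \<longlonglongrightarrow> T g x" for x
    unfolding T_def
  proof (rule nn_integral_LIMSEQ)
    show "incseq (\<lambda>n y. gn n y * ennreal (p \<eta> (\<lambda>i. y i - x i)))"
      using gn_mono by (auto simp: incseq_def le_fun_def intro!: mult_right_mono)
    show "(\<lambda>n. gn n y * ennreal (p \<eta> (\<lambda>i. y i - x i))) \<longlonglongrightarrow> g y * ennreal (p \<eta> (\<lambda>i. y i - x i))" for y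
      by (intro ennreal_tendsto_mult_right gn_lim) auto
  qed (intro borel_measurable_times_ennreal measurable_compose[OF p_diff_measurable measurable_ennreal] gn_meas)
  have m_le: "(\<integral>\<^sup>+x. T (gn n) x * ennreal (\<pi> x) \<partial>leb d) \<le> 1" for n
    unfolding m[symmetric] by (intro nn_integral_mono mult_right_mono Tmono) (auto simp: gn_def)
  have sq_lim: "(\<lambda>n. \<integral>\<^sup>+x. (T (gn n) x)\<^sup>2 * ennreal (\<pi> x) \<partial>leb d) \<longlonglongrightarrow> (\<integral>\<^sup>+x. (T g x)\<^sup>2 * ennreal (\<pi> x) \<partial>leb d)"
  proof (rule nn_integral_LIMSEQ)
    show "incseq (\<lambda>n x. (T (gn n) x)\<^sup>2 * ennreal (\<pi> x))"
      using Tinc by (auto simp: incseq_def le_fun_def intro!: mult_right_mono power_mono)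
    show "(\<lambda>n. (T (gn n) x)\<^sup>2 * ennreal (\<pi> x)) \<longlonglongrightarrow> (T g x)\<^sup>2 * ennreal (\<pi> x)" for x
      by (intro ennreal_tendsto_mult_right ennreal_LIMSEQ_square Tlim Tinc) auto
  qed (unfold power2_eq_square, intro borel_measurable_times_ennreal T_measurable gn_meas measurable_compose[OF \<pi>_meas measurable_ennreal])
  have m_lim: "(\<lambda>n. \<integral>\<^sup>+x. T (gn n) x * ennreal (\<pi> x) \<partial>leb d) \<longlonglongrightarrow> 1"
    unfolding m[symmetric]
  proof (rule nn_integral_LIMSEQ)
    show "incseq (\<lambda>n x. T (gn n) x * ennreal (\<pi> x))"
      using Tinc by (auto simp: incseq_def le_fun_def intro!: mult_right_mono)
    show "(\<lambda>n. T (gn n) x * ennreal (\<pi> x)) \<longlonglongrightarrow> T g x * ennreal (\<pi> x)" for x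
      by (intro ennreal_tendsto_mult_right Tlim) auto
  qed (intro borel_measurable_times_ennreal T_measurable gn_meas measurable_compose[OF \<pi>_meas measurable_ennreal])
  have le: "ennreal (1 + \<eta> / C) * (\<integral>\<^sup>+x. (T (gn n) x)\<^sup>2 * ennreal (\<pi> x) \<partial>leb d) + (\<integral>\<^sup>+x. T (gn n) x * ennreal (\<pi> x) \<partial>leb d)\<^sup>2
    \<le> (\<integral>\<^sup>+x. T (\<lambda>y. (g y)\<^sup>2) x * ennreal (\<pi> x) \<partial>leb d) + ennreal (1 + \<eta> / C)" for n
  proof -
    have Q0: "0 \<le> Q \<eta> (gr n) x" for x
      unfolding Q_def using gr0 p_nonneg[OF \<eta>] by (intro Bochner_Integration.integral_nonneg) auto
    have "ennreal (1 + \<eta> / C) * (\<integral>\<^sup>+x. (T (gn n) x)\<^sup>2 * ennreal (\<pi> x) \<partial>leb d) + (\<integral>\<^sup>+x. T (gn n) x * ennreal (\<pi> x) \<partial>leb d)\<^sup>2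
      \<le> (\<integral>\<^sup>+x. T (\<lambda>y. (gn n y)\<^sup>2) x * ennreal (\<pi> x) \<partial>leb d) + ennreal (1 + \<eta> / C) * (\<integral>\<^sup>+x. T (gn n) x * ennreal (\<pi> x) \<partial>leb d)\<^sup>2"
      using contraction_bounded[of "gr n" "real n"] gr0 grB unfolding TQ TQ2 by (simp add: ennreal_power Q0)
    also have "\<dots> \<le> (\<integral>\<^sup>+x. T (\<lambda>y. (g y)\<^sup>2) x * ennreal (\<pi> x) \<partial>leb d) + ennreal (1 + \<eta> / C) * 1\<^sup>2"
      using m_le by (intro add_mono mult_left_mono power_mono nn_integral_mono mult_right_mono Tmono) (auto simp: gn_def)
    finally show ?thesis by simp
  qed
  have m_inc: "incseq (\<lambda>n. \<integral>\<^sup>+x. T (gn n) x * ennreal (\<pi> x) \<partial>leb d)"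
    using Tinc by (auto simp: incseq_def intro!: nn_integral_mono mult_right_mono)
  have "(\<lambda>n. ennreal (1 + \<eta> / C) * (\<integral>\<^sup>+x. (T (gn n) x)\<^sup>2 * ennreal (\<pi> x) \<partial>leb d) + (\<integral>\<^sup>+x. T (gn n) x * ennreal (\<pi> x) \<partial>leb d)\<^sup>2)
    \<longlonglongrightarrow> ennreal (1 + \<eta> / C) * (\<integral>\<^sup>+x. (T g x)\<^sup>2 * ennreal (\<pi> x) \<partial>leb d) + 1\<^sup>2"
    by (intro tendsto_add ennreal_tendsto_cmult ennreal_LIMSEQ_square sq_lim m_lim m_inc) auto
  from LIMSEQ_le_const2[OF this] le show ?thesis by auto
qed

end

section \<open>Composition with kernels given by densities\<close>

lemma space_leb_nonempty: "space (leb d) \<noteq> {}"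
  by (simp add: space_PiM PiE_eq_empty_iff)

text \<open>Unit mass makes the kernel a measurable map into the subprobability measures, where the
  composite can be evaluated on sets; Tonelli's theorem then moves the integral over the starting
  point inside.\<close>

lemma bind_density_kernel:
  fixes k :: "(nat \<Rightarrow> real) \<Rightarrow> (nat \<Rightarrow> real) \<Rightarrow> ennreal"
  assumes r [measurable]: "r \<in> borel_measurable (leb d)"
    and k [measurable]: "case_prod k \<in> borel_measurable (leb d \<Otimes>\<^sub>M leb d)"
    and k1: "\<And>x. x \<in> space (leb d) \<Longrightarrow> (\<integral>\<^sup>+y. k x y \<partial>leb d) = 1"
  shows "Giry_Monad.bind (density (leb d) r) (\<lambda>x. density (leb d) (k x)) = density (leb d) (\<lambda>y. \<integral>\<^sup>+x. r x * k x y \<partial>leb d)"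
proof -
  have kx: "k x \<in> borel_measurable (leb d)" if "x \<in> space (leb d)" for x
    using measurable_compose[OF measurable_Pair1'[OF that] k] by simp
  have ky: "(\<lambda>x. k x y) \<in> borel_measurable (leb d)" if "y \<in> space (leb d)" for y
    using measurable_compose[OF measurable_Pair2'[OF that] k] by simp
  have em: "emeasure (density (leb d) (k x)) A = (\<integral>\<^sup>+y. k x y * indicator A y \<partial>leb d)"
    if "x \<in> space (leb d)" "A \<in> sets (leb d)" for x A
    using kx[OF that(1)] that(2) by (rule emeasure_density)
  have K: "(\<lambda>x. density (leb d) (k x)) \<in> measurable (density (leb d) r) (subprob_algebra (leb d))"
  proof (rule measurable_subprob_algebra)
    fix x assume "x \<in> space (density (leb d) r)"
    then have x: "x \<in> space (leb d)" by simp
    have "prob_space (density (leb d) (k x))"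
      by (rule prob_spaceI) (simp add: em[OF x] k1[OF x] cong: nn_integral_cong_simp)
    then show "subprob_space (density (leb d) (k x))" by (rule prob_space_imp_subprob_space)
  next
    fix A assume A [measurable]: "A \<in> sets (leb d)"
    have "(\<lambda>x. \<integral>\<^sup>+y. k x y * indicator A y \<partial>leb d) \<in> borel_measurable (leb d)" by measurable
    then have "(\<lambda>x. emeasure (density (leb d) (k x)) A) \<in> borel_measurable (leb d)"
      by (rule measurable_cong[THEN iffD2, rotated]) (rule em[OF _ A])
    then show "(\<lambda>x. emeasure (density (leb d) (k x)) A) \<in> borel_measurable (density (leb d) r)" by simp
  qed simp
  show ?thesis
  proof (rule measure_eqI)
    show "sets (Giry_Monad.bind (density (leb d) r) (\<lambda>x. density (leb d) (k x))) = sets (density (leb d) (\<lambda>y. \<integral>\<^sup>+x. r x * k x y \<partial>leb d))"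
      using space_leb_nonempty by (subst sets_bind[where N = "leb d"]) auto
    fix A assume "A \<in> sets (Giry_Monad.bind (density (leb d) r) (\<lambda>x. density (leb d) (k x)))"
    then have A [measurable]: "A \<in> sets (leb d)"
      using space_leb_nonempty by (subst (asm) sets_bind[where N = "leb d"]) auto
    have m1: "(\<lambda>x. emeasure (density (leb d) (k x)) A) \<in> borel_measurable (leb d)"
      using measurable_emeasure_kernel[OF K A] by simp
    have "emeasure (Giry_Monad.bind (density (leb d) r) (\<lambda>x. density (leb d) (k x))) A = (\<integral>\<^sup>+x. emeasure (density (leb d) (k x)) A \<partial>density (leb d) r)"
      using space_leb_nonempty by (intro emeasure_bind[OF _ K A]) simp
    also have "\<dots> = (\<integral>\<^sup>+x. r x * emeasure (density (leb d) (k x)) A \<partial>leb d)"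
      by (rule nn_integral_density[OF r m1])
    also have "\<dots> = (\<integral>\<^sup>+x. (\<integral>\<^sup>+y. r x * k x y * indicator A y \<partial>leb d) \<partial>leb d)"
      using kx by (intro nn_integral_cong) (simp add: em[OF _ A] nn_integral_cmult[symmetric] mult.assoc)
    also have "\<dots> = (\<integral>\<^sup>+y. (\<integral>\<^sup>+x. r x * k x y * indicator A y \<partial>leb d) \<partial>leb d)"
      by (rule leb_pair.Fubini') measurable
    also have "\<dots> = (\<integral>\<^sup>+y. (\<integral>\<^sup>+x. r x * k x y \<partial>leb d) * indicator A y \<partial>leb d)"
      using ky by (intro nn_integral_cong) (simp add: nn_integral_multc)
    also have "\<dots> = emeasure (density (leb d) (\<lambda>y. \<integral>\<^sup>+x. r x * k x y \<partial>leb d)) A"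
      by (rule emeasure_density[symmetric]) measurable
    finally show "emeasure (Giry_Monad.bind (density (leb d) r) (\<lambda>x. density (leb d) (k x))) A = emeasure (density (leb d) (\<lambda>y. \<integral>\<^sup>+x. r x * k x y \<partial>leb d)) A" .
  qed
qed

section \<open>One sampler step in terms of density ratios\<close>

context proximal
begin

text \<open>The normalising constant of the backward kernel at \<open>y\<close>, and at the same
  time the density of the intermediate sample when the current one has law
  \<open>\<pi>\<close>.\<close>

definition \<pi>Y :: "(nat \<Rightarrow> real) \<Rightarrow> real" where
  "\<pi>Y y = (\<integral>z. \<pi> z * p \<eta> (\<lambda>i. y i - z i) \<partial>leb d)"

lemma p_diff_measurable2: "y \<in> space (leb d) \<Longrightarrow> (\<lambda>x. p \<eta> (\<lambda>i. y i - x i)) \<in> borel_measurable (leb d)"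
  by (rule measurable_stable_diff) auto

lemma \<pi>p_nonneg: "0 \<le> \<pi> z * p \<eta> w"
  using \<pi>_pos[of z] p_nonneg[OF \<eta>, of w] by simp

lemma \<pi>_integrable: "integrable (leb d) \<pi>"
  using \<pi>_int \<pi>_pos by (intro integrableI_nonneg) (auto intro: less_imp_le)

lemma \<pi>p_integrable:
  assumes y: "y \<in> space (leb d)"
  shows "integrable (leb d) (\<lambda>z. \<pi> z * p \<eta> (\<lambda>i. y i - z i))"
proof (rule Bochner_Integration.integrable_bound)
  define K where "K = (\<integral>\<xi>. \<phi> \<eta> \<xi> \<partial>leb d) / (2 * pi) ^ d"
  show "integrable (leb d) (\<lambda>z. \<pi> z * K)" using \<pi>_integrable by simp
  show "AE z in leb d. norm (\<pi> z * p \<eta> (\<lambda>i. y i - z i)) \<le> norm (\<pi> z * K)"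
  proof (rule AE_I2)
    fix z
    have "p \<eta> (\<lambda>i. y i - z i) \<le> \<bar>K\<bar>" using p_bound[OF \<eta>, of "\<lambda>i. y i - z i"] unfolding K_def by linarith
    then show "norm (\<pi> z * p \<eta> (\<lambda>i. y i - z i)) \<le> norm (\<pi> z * K)"
      using \<pi>_pos[of z] p_nonneg[OF \<eta>, of "\<lambda>i. y i - z i"] by (simp add: abs_mult)
  qed
qed (use p_diff_measurable2[OF y] in measurable)

lemma \<pi>Y_ennreal:
  assumes y: "y \<in> space (leb d)"
  shows "ennreal (\<pi>Y y) = (\<integral>\<^sup>+z. ennreal (\<pi> z * p \<eta> (\<lambda>i. y i - z i)) \<partial>leb d)"
  unfolding \<pi>Y_def by (intro nn_integral_eq_integral[symmetric] \<pi>p_integrable y AE_I2 \<pi>p_nonneg)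

text \<open>If the integral vanished, then, \<open>\<pi>\<close> being positive, the stable kernel
  at \<open>y\<close> would vanish almost everywhere; but its mass is \<open>1\<close>.\<close>

lemma \<pi>Y_pos:
  assumes y: "y \<in> space (leb d)"
  shows "0 < \<pi>Y y"
proof -
  note [measurable] = p_diff_measurable2[OF y]
  have "\<pi>Y y \<noteq> 0"
  proof
    assume "\<pi>Y y = 0"
    then have "(\<integral>\<^sup>+z. ennreal (\<pi> z * p \<eta> (\<lambda>i. y i - z i)) \<partial>leb d) = 0" using \<pi>Y_ennreal[OF y] by simp
    then have "AE z in leb d. ennreal (\<pi> z * p \<eta> (\<lambda>i. y i - z i)) = 0"
      by (subst (asm) nn_integral_0_iff_AE) measurable
    then have "AE z in leb d. ennreal (p \<eta> (\<lambda>i. y i - z i)) = 0"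
    proof eventually_elim
      case (elim z)
      then have "\<pi> z * p \<eta> (\<lambda>i. y i - z i) \<le> 0" by (simp add: ennreal_eq_0_iff)
      then show ?case using \<pi>_pos[of z] by (simp add: mult_le_0_iff ennreal_eq_0_iff)
    qed
    then have "(\<integral>\<^sup>+z. ennreal (p \<eta> (\<lambda>i. y i - z i)) \<partial>leb d) = 0"
      by (subst nn_integral_0_iff_AE) measurable
    then show False using p_shift_nn'[OF \<eta> y] by simp
  qed
  moreover have "0 \<le> \<pi>Y y" unfolding \<pi>Y_def
    by (intro Bochner_Integration.integral_nonneg \<pi>p_nonneg)
  ultimately show ?thesis by simp
qed

lemma measurable_\<pi>Y [measurable]: "\<pi>Y \<in> borel_measurable (leb d)"
  unfolding \<pi>Y_def by measurable

text \<open>If the current law has ratio \<open>h\<close> to \<open>\<pi>\<close>, the intermediate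
  law has ratio \<open>hY h\<close> to \<open>\<pi>Y\<close>: a conditional expectation of
  \<open>h\<close> given \<open>y\<close>.\<close>

definition hY :: "((nat \<Rightarrow> real) \<Rightarrow> ennreal) \<Rightarrow> (nat \<Rightarrow> real) \<Rightarrow> ennreal" where
  "hY h y = (\<integral>\<^sup>+x. h x * ennreal (\<pi> x) * ennreal (p \<eta> (\<lambda>i. y i - x i)) \<partial>leb d) / ennreal (\<pi>Y y)"

lemma hY_measurable [measurable]:
  assumes [measurable]: "h \<in> borel_measurable (leb d)"
  shows "hY h \<in> borel_measurable (leb d)"
  unfolding hY_def by measurable

lemma hY_mult:
  assumes y: "y \<in> space (leb d)"
  shows "hY h y * ennreal (\<pi>Y y) = (\<integral>\<^sup>+x. h x * ennreal (\<pi> x) * ennreal (p \<eta> (\<lambda>i. y i - x i)) \<partial>leb d)"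
  unfolding hY_def using \<pi>Y_pos[OF y] by (simp add: ennreal_divide_times ennreal_times_divide[symmetric])

text \<open>\<open>T\<close> and \<open>hY\<close> are the two conditional expectations of the joint
  law with density \<open>\<pi> x * p \<eta> (y - x)\<close>; integrating either over its marginal
  recovers the integral of its argument.\<close>

lemma T_integral:
  assumes [measurable]: "g \<in> borel_measurable (leb d)"
  shows "(\<integral>\<^sup>+x. T g x * ennreal (\<pi> x) \<partial>leb d) = (\<integral>\<^sup>+y. g y * ennreal (\<pi>Y y) \<partial>leb d)"
proof -
  have "(\<integral>\<^sup>+x. T g x * ennreal (\<pi> x) \<partial>leb d) = (\<integral>\<^sup>+x. (\<integral>\<^sup>+y. g y * ennreal (\<pi> x * p \<eta> (\<lambda>i. y i - x i)) \<partial>leb d) \<partial>leb d)"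
  proof (rule nn_integral_cong)
    fix x
    have "T g x * ennreal (\<pi> x) = (\<integral>\<^sup>+y. g y * ennreal (p \<eta> (\<lambda>i. y i - x i)) * ennreal (\<pi> x) \<partial>leb d)"
      unfolding T_def
      by (intro nn_integral_multc[symmetric] borel_measurable_times_ennreal measurable_compose[OF p_diff_measurable measurable_ennreal] assms)
    also have "\<dots> = (\<integral>\<^sup>+y. g y * ennreal (\<pi> x * p \<eta> (\<lambda>i. y i - x i)) \<partial>leb d)"
      using \<pi>_pos[of x] p_nonneg[OF \<eta>] by (intro nn_integral_cong) (simp add: ennreal_mult mult_ac)
    finally show "T g x * ennreal (\<pi> x) = (\<integral>\<^sup>+y. g y * ennreal (\<pi> x * p \<eta> (\<lambda>i. y i - x i)) \<partial>leb d)" .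
  qed
  also have "\<dots> = (\<integral>\<^sup>+y. (\<integral>\<^sup>+x. g y * ennreal (\<pi> x * p \<eta> (\<lambda>i. y i - x i)) \<partial>leb d) \<partial>leb d)"
    by (rule leb_pair.Fubini') measurable
  also have "\<dots> = (\<integral>\<^sup>+y. g y * ennreal (\<pi>Y y) \<partial>leb d)"
    using p_diff_measurable2 by (intro nn_integral_cong) (simp add: nn_integral_cmult \<pi>Y_ennreal)
  finally show ?thesis .
qed

lemma hY_integral:
  assumes [measurable]: "h \<in> borel_measurable (leb d)"
  shows "(\<integral>\<^sup>+y. hY h y * ennreal (\<pi>Y y) \<partial>leb d) = (\<integral>\<^sup>+x. h x * ennreal (\<pi> x) \<partial>leb d)"
proof -
  have "(\<integral>\<^sup>+y. hY h y * ennreal (\<pi>Y y) \<partial>leb d) = (\<integral>\<^sup>+y. (\<integral>\<^sup>+x. h x * ennreal (\<pi> x) * ennreal (p \<eta> (\<lambda>i. y i - x i)) \<partial>leb d) \<partial>leb d)"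
    by (intro nn_integral_cong hY_mult)
  also have "\<dots> = (\<integral>\<^sup>+x. (\<integral>\<^sup>+y. h x * ennreal (\<pi> x) * ennreal (p \<eta> (\<lambda>i. y i - x i)) \<partial>leb d) \<partial>leb d)"
    by (rule leb_pair.Fubini') measurable
  also have "\<dots> = (\<integral>\<^sup>+x. h x * ennreal (\<pi> x) \<partial>leb d)"
    by (intro nn_integral_cong) (simp add: nn_integral_cmult p_shift_nn[OF \<eta>])
  finally show ?thesis .
qed

lemma hY_square:
  assumes [measurable]: "h \<in> borel_measurable (leb d)"
  shows "(\<integral>\<^sup>+y. (hY h y)\<^sup>2 * ennreal (\<pi>Y y) \<partial>leb d) \<le> (\<integral>\<^sup>+x. (h x)\<^sup>2 * ennreal (\<pi> x) \<partial>leb d)"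
proof -
  have "(\<integral>\<^sup>+y. (hY h y)\<^sup>2 * ennreal (\<pi>Y y) \<partial>leb d) \<le> (\<integral>\<^sup>+y. hY (\<lambda>x. (h x)\<^sup>2) y * ennreal (\<pi>Y y) \<partial>leb d)"
  proof (rule nn_integral_mono)
    fix y assume y: "y \<in> space (leb d)"
    note [measurable] = p_diff_measurable2[OF y]
    define w where "w x = \<pi> x * p \<eta> (\<lambda>i. y i - x i)" for x
    have [measurable]: "w \<in> borel_measurable (leb d)" unfolding w_def by measurable
    have w0: "0 \<le> w x" for x unfolding w_def by (rule \<pi>p_nonneg)
    have \<pi>Yw: "ennreal (\<pi>Y y) = (\<integral>\<^sup>+x. ennreal (w x) \<partial>leb d)" unfolding \<pi>Y_ennreal[OF y] w_def ..
    have w_eq: "ennreal (\<pi> x) * ennreal (p \<eta> (\<lambda>i. y i - x i)) = ennreal (w x)" for x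
      unfolding w_def using \<pi>_pos p_nonneg[OF \<eta>] by (simp add: ennreal_mult less_imp_le)
    have sq: "(ennreal (sqrt (w x)))\<^sup>2 = ennreal (w x)" for x using w0 by (simp add: ennreal_power)
    have hw: "hY h' y * ennreal (\<pi>Y y) = (\<integral>\<^sup>+x. h' x * ennreal (w x) \<partial>leb d)" for h'
      unfolding hY_mult[OF y] by (simp add: mult.assoc w_eq)
    \<comment> \<open>Splitting the weight as \<open>sqrt w * sqrt w\<close> gives the conditional
      Jensen inequality with a surplus factor \<open>\<pi>Y y\<close>, which is positive and finite
      and hence cancels.\<close>
    have "(\<integral>\<^sup>+x. h x * ennreal (w x) \<partial>leb d)\<^sup>2 = (\<integral>\<^sup>+x. (h x * ennreal (sqrt (w x))) * ennreal (sqrt (w x)) \<partial>leb d)\<^sup>2"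
      using sq by (simp add: mult.assoc power2_eq_square)
    also have "\<dots> \<le> (\<integral>\<^sup>+x. (h x * ennreal (sqrt (w x)))\<^sup>2 \<partial>leb d) * (\<integral>\<^sup>+x. (ennreal (sqrt (w x)))\<^sup>2 \<partial>leb d)"
      by (rule Cauchy_Schwarz_nn_integral) measurable
    also have "\<dots> = (\<integral>\<^sup>+x. (h x)\<^sup>2 * ennreal (w x) \<partial>leb d) * ennreal (\<pi>Y y)"
      unfolding sq power_mult_distrib \<pi>Yw ..
    finally have "(hY h y * ennreal (\<pi>Y y))\<^sup>2 \<le> hY (\<lambda>x. (h x)\<^sup>2) y * ennreal (\<pi>Y y) * ennreal (\<pi>Y y)"
      unfolding hw .
    then have "ennreal (\<pi>Y y) * ((hY h y)\<^sup>2 * ennreal (\<pi>Y y)) \<le> ennreal (\<pi>Y y) * (hY (\<lambda>x. (h x)\<^sup>2) y * ennreal (\<pi>Y y))"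
      by (simp add: power_mult_distrib power2_eq_square mult_ac)
    then show "(hY h y)\<^sup>2 * ennreal (\<pi>Y y) \<le> hY (\<lambda>x. (h x)\<^sup>2) y * ennreal (\<pi>Y y)"
      using \<pi>Y_pos[OF y] by (subst (asm) ennreal_mult_le_mult_iff) auto
  qed
  also have "\<dots> = (\<integral>\<^sup>+x. (h x)\<^sup>2 * ennreal (\<pi> x) \<partial>leb d)" by (rule hY_integral) measurable
  finally show ?thesis .
qed

text \<open>Bayes' formula: the backward density is
  \<open>\<pi> x * p \<eta> (y - x) / \<pi>Y y\<close>, so the factor \<open>\<pi> x\<close> comes
  out and what remains is \<open>T\<close> applied to the intermediate ratio.\<close>

lemma sampler_step:
  assumes [measurable]: "h \<in> borel_measurable (leb d)"
  shows "Giry_Monad.bind (Giry_Monad.bind (density (leb d) (\<lambda>x. h x * ennreal (\<pi> x))) (forward_kernel d \<alpha> \<eta>)) (backward_kernel d \<alpha> \<eta> \<pi>)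
    = density (leb d) (\<lambda>x. T (hY h) x * ennreal (\<pi> x))"
proof -
  define kf where "kf x y = ennreal (p \<eta> (\<lambda>i. y i - x i))" for x y
  define kb where "kb y x = ennreal (\<pi> x * p \<eta> (\<lambda>i. y i - x i) / \<pi>Y y)" for y x
  have f: "forward_kernel d \<alpha> \<eta> = (\<lambda>x. density (leb d) (kf x))"
    by (rule ext) (simp add: forward_kernel_def stable_trans_def kf_def[abs_def])
  have b: "backward_kernel d \<alpha> \<eta> \<pi> = (\<lambda>y. density (leb d) (kb y))"
    by (rule ext) (simp add: backward_kernel_def prob_normalize_def stable_trans_def kb_def[abs_def] \<pi>Y_def)
  have [measurable]: "case_prod kf \<in> borel_measurable (leb d \<Otimes>\<^sub>M leb d)" unfolding kf_def by measurable
  have [measurable]: "case_prod kb \<in> borel_measurable (leb d \<Otimes>\<^sub>M leb d)" unfolding kb_def by measurable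
  have kb_eq: "kb y x = ennreal (\<pi> x * p \<eta> (\<lambda>i. y i - x i)) / ennreal (\<pi>Y y)" if "y \<in> space (leb d)" for x y
    unfolding kb_def using \<pi>Y_pos[OF that] \<pi>_pos[of x] p_nonneg[OF \<eta>] by (intro divide_ennreal[symmetric]) (auto intro!: mult_nonneg_nonneg less_imp_le)
  have kb1: "(\<integral>\<^sup>+x. kb y x \<partial>leb d) = 1" if y: "y \<in> space (leb d)" for y
  proof -
    note [measurable] = p_diff_measurable2[OF y]
    have "(\<integral>\<^sup>+x. kb y x \<partial>leb d) = ennreal (\<pi>Y y) / ennreal (\<pi>Y y)"
      unfolding kb_eq[OF y] \<pi>Y_ennreal[OF y] by (rule nn_integral_divide) measurable
    then show ?thesis using \<pi>Y_pos[OF y] by (simp add: divide_ennreal)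
  qed
  have "Giry_Monad.bind (density (leb d) (\<lambda>x. h x * ennreal (\<pi> x))) (forward_kernel d \<alpha> \<eta>)
     = density (leb d) (\<lambda>y. \<integral>\<^sup>+x. h x * ennreal (\<pi> x) * kf x y \<partial>leb d)"
    unfolding f by (rule bind_density_kernel) (auto simp: kf_def p_shift_nn[OF \<eta>])
  also have "Giry_Monad.bind \<dots> (backward_kernel d \<alpha> \<eta> \<pi>)
     = density (leb d) (\<lambda>x. \<integral>\<^sup>+y. (\<integral>\<^sup>+x. h x * ennreal (\<pi> x) * kf x y \<partial>leb d) * kb y x \<partial>leb d)"
    unfolding b by (rule bind_density_kernel) (auto simp: kb1)
  also have "\<dots> = density (leb d) (\<lambda>x. T (hY h) x * ennreal (\<pi> x))"
  proof (rule density_cong)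
    have "(\<integral>\<^sup>+y. (\<integral>\<^sup>+x. h x * ennreal (\<pi> x) * kf x y \<partial>leb d) * kb y x \<partial>leb d) = T (hY h) x * ennreal (\<pi> x)" for x
    proof -
      have "(\<integral>\<^sup>+y. (\<integral>\<^sup>+x. h x * ennreal (\<pi> x) * kf x y \<partial>leb d) * kb y x \<partial>leb d) = (\<integral>\<^sup>+y. hY h y * ennreal (p \<eta> (\<lambda>i. y i - x i)) * ennreal (\<pi> x) \<partial>leb d)"
      proof (rule nn_integral_cong)
        fix y assume y: "y \<in> space (leb d)"
        show "(\<integral>\<^sup>+x. h x * ennreal (\<pi> x) * kf x y \<partial>leb d) * kb y x = hY h y * ennreal (p \<eta> (\<lambda>i. y i - x i)) * ennreal (\<pi> x)"
          unfolding kb_eq[OF y] hY_def kf_def using \<pi>_pos[of x] p_nonneg[OF \<eta>]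
          by (simp add: ennreal_mult less_imp_le ennreal_times_divide ennreal_divide_times mult_ac divide_ennreal_def)
      qed
      also have "\<dots> = T (hY h) x * ennreal (\<pi> x)" unfolding T_def by (rule nn_integral_multc) measurable
      finally show ?thesis .
    qed
    then show "AE x in leb d. (\<integral>\<^sup>+y. (\<integral>\<^sup>+x. h x * ennreal (\<pi> x) * kf x y \<partial>leb d) * kb y x \<partial>leb d) = T (hY h) x * ennreal (\<pi> x)" by simp
  qed measurable
  finally show ?thesis .
qed

text \<open>The invariant bounds the second moment of the ratio, that is one plus the divergence.
  With \<open>q = 1 + \<eta> / C\<close>, the inequality \<open>q * X' + 1 \<le> X + q\<close> is
  the additive form of \<open>X' - 1 \<le> (X - 1) / q\<close>.\<close>

lemma sampler_density:
  assumes h0 [measurable]: "h0 \<in> borel_measurable (leb d)"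
    and m0: "(\<integral>\<^sup>+x. h0 x * ennreal (\<pi> x) \<partial>leb d) = 1"
    and X0: "(\<integral>\<^sup>+x. (h0 x)\<^sup>2 * ennreal (\<pi> x) \<partial>leb d) \<le> ennreal (1 + D)" and D: "0 \<le> D"
  shows "\<exists>h \<in> borel_measurable (leb d).
     sampler_law d \<alpha> \<eta> \<pi> (density (leb d) (\<lambda>x. h0 x * ennreal (\<pi> x))) k = density (leb d) (\<lambda>x. h x * ennreal (\<pi> x)) \<and>
     (\<integral>\<^sup>+x. h x * ennreal (\<pi> x) \<partial>leb d) = 1 \<and>
     (\<integral>\<^sup>+x. (h x)\<^sup>2 * ennreal (\<pi> x) \<partial>leb d) \<le> ennreal (1 + D / (1 + \<eta> / C) ^ k)"
proof (induction k)
  case 0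
  then show ?case using assms by auto
next
  case (Suc k)
  define q where "q = 1 + \<eta> / C"
  have q: "1 < q" using \<eta> C_pos by (simp add: q_def)
  obtain h where [measurable]: "h \<in> borel_measurable (leb d)"
    and law: "sampler_law d \<alpha> \<eta> \<pi> (density (leb d) (\<lambda>x. h0 x * ennreal (\<pi> x))) k = density (leb d) (\<lambda>x. h x * ennreal (\<pi> x))"
    and m: "(\<integral>\<^sup>+x. h x * ennreal (\<pi> x) \<partial>leb d) = 1"
    and X: "(\<integral>\<^sup>+x. (h x)\<^sup>2 * ennreal (\<pi> x) \<partial>leb d) \<le> ennreal (1 + D / q ^ k)"
    using Suc.IH unfolding q_def by blast
  have m': "(\<integral>\<^sup>+x. T (hY h) x * ennreal (\<pi> x) \<partial>leb d) = 1"
    by (simp add: T_integral hY_integral m)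
  define X' where "X' = (\<integral>\<^sup>+x. (T (hY h) x)\<^sup>2 * ennreal (\<pi> x) \<partial>leb d)"
  have "ennreal q * X' + 1 \<le> (\<integral>\<^sup>+x. T (\<lambda>y. (hY h y)\<^sup>2) x * ennreal (\<pi> x) \<partial>leb d) + ennreal q"
    unfolding X'_def q_def by (rule contraction[OF _ m']) measurable
  also have "(\<integral>\<^sup>+x. T (\<lambda>y. (hY h y)\<^sup>2) x * ennreal (\<pi> x) \<partial>leb d) = (\<integral>\<^sup>+y. (hY h y)\<^sup>2 * ennreal (\<pi>Y y) \<partial>leb d)"
    by (rule T_integral) measurable
  also have "\<dots> \<le> (\<integral>\<^sup>+x. (h x)\<^sup>2 * ennreal (\<pi> x) \<partial>leb d)" by (rule hY_square) measurable
  also note X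
  finally have le: "ennreal q * X' + 1 \<le> ennreal (1 + D / q ^ k) + ennreal q" by (simp add: add_right_mono)
  also have "\<dots> = ennreal (1 + D / q ^ k + q)" using q D by (subst ennreal_plus) auto
  finally have le: "ennreal q * X' + 1 \<le> ennreal (1 + D / q ^ k + q)" .
  \<comment> \<open>Finiteness of the new second moment is secured before the constants are
    rearranged in the reals.\<close>
  have "X' < top"
  proof (rule ccontr)
    assume "\<not> X' < top"
    then have "X' = top" using top.not_eq_extremum[of X'] by blast
    with le q show False by (simp add: ennreal_mult_top top_unique)
  qed
  then obtain r where r: "X' = ennreal r" "0 \<le> r" by (cases X') auto
  have "ennreal (q * r + 1) \<le> ennreal (1 + D / q ^ k + q)"
    using le q r(2) unfolding r(1) by (simp add: ennreal_mult ennreal_plus)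
  moreover have "0 \<le> 1 + D / q ^ k + q" using q D by simp
  ultimately have "q * r + 1 \<le> 1 + D / q ^ k + q" by (subst (asm) ennreal_le_iff) auto
  moreover have "q * (1 + D / q ^ Suc k) = q + D / q ^ k" using q by (simp add: field_simps)
  ultimately have "q * r \<le> q * (1 + D / q ^ Suc k)" by linarith
  then have "r \<le> 1 + D / q ^ Suc k" using q by (subst (asm) mult_le_cancel_left_pos) auto
  then have "X' \<le> ennreal (1 + D / q ^ Suc k)" unfolding r(1) by (rule ennreal_leI)
  then show ?case
    unfolding sampler_law.simps law sampler_step[OF \<open>h \<in> borel_measurable (leb d)\<close>] X'_def q_def
    using m' by (intro bexI[of _ "T (hY h)"]) auto
qed

text \<open>Unit mass makes \<open>h\<close> finite almost everywhere, so it may be replaced by a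
  real ratio \<open>hr\<close>. The divergence is read off from
  \<open>(hr - 1)^2 + 2 * hr = hr^2 + 1\<close>, integrated in this additive form, after which
  \<open>2\<close> is cancelled.\<close>

lemma chi_square_density:
  assumes h [measurable]: "h \<in> borel_measurable (leb d)"
    and m: "(\<integral>\<^sup>+x. h x * ennreal (\<pi> x) \<partial>leb d) = 1"
    and X: "(\<integral>\<^sup>+x. (h x)\<^sup>2 * ennreal (\<pi> x) \<partial>leb d) \<le> ennreal (1 + \<epsilon>)" and \<epsilon>: "0 \<le> \<epsilon>"
  shows "chi_square_accurate (leb d) \<epsilon> (density (leb d) (\<lambda>x. h x * ennreal (\<pi> x))) \<pi>"
proof -
  define hr where "hr x = enn2real (h x)" for x
  have [measurable]: "hr \<in> borel_measurable (leb d)" unfolding hr_def by measurable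
  have hr0: "0 \<le> hr x" for x by (simp add: hr_def)
  have "AE x in leb d. h x * ennreal (\<pi> x) \<noteq> \<infinity>"
    using m by (intro nn_integral_noteq_infinite) auto
  then have fin: "AE x in leb d. h x = ennreal (hr x)"
  proof eventually_elim
    case (elim x)
    then have "h x \<noteq> top" using \<pi>_pos[of x] by (auto simp: ennreal_top_mult)
    then show ?case by (simp add: hr_def less_top)
  qed
  have m': "(\<integral>\<^sup>+x. ennreal (hr x) * ennreal (\<pi> x) \<partial>leb d) = 1"
    unfolding m[symmetric] by (rule nn_integral_cong_AE) (use fin in eventually_elim, simp)
  have X': "(\<integral>\<^sup>+x. (ennreal (hr x))\<^sup>2 * ennreal (\<pi> x) \<partial>leb d) \<le> ennreal (1 + \<epsilon>)"
  proof -
    have "(\<integral>\<^sup>+x. (ennreal (hr x))\<^sup>2 * ennreal (\<pi> x) \<partial>leb d) = (\<integral>\<^sup>+x. (h x)\<^sup>2 * ennreal (\<pi> x) \<partial>leb d)"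
      by (rule nn_integral_cong_AE) (use fin in eventually_elim, simp)
    then show ?thesis using X by simp
  qed
  define c where "c = (\<integral>\<^sup>+x. ennreal ((hr x - 1)\<^sup>2) * ennreal (\<pi> x) \<partial>leb d)"
  have "c + 2 = c + 2 * (\<integral>\<^sup>+x. ennreal (hr x) * ennreal (\<pi> x) \<partial>leb d)" by (simp add: m')
  also have "\<dots> = (\<integral>\<^sup>+x. ennreal ((hr x - 1)\<^sup>2) * ennreal (\<pi> x) + 2 * (ennreal (hr x) * ennreal (\<pi> x)) \<partial>leb d)"
    unfolding c_def by (subst nn_integral_add) (auto simp: nn_integral_cmult)
  also have "\<dots> = (\<integral>\<^sup>+x. (ennreal (hr x))\<^sup>2 * ennreal (\<pi> x) + ennreal (\<pi> x) \<partial>leb d)"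
  proof (rule nn_integral_cong)
    fix x
    have "ennreal ((hr x - 1)\<^sup>2) * ennreal (\<pi> x) + 2 * (ennreal (hr x) * ennreal (\<pi> x)) = ennreal ((hr x - 1)\<^sup>2 * \<pi> x + 2 * (hr x * \<pi> x))"
      using hr0[of x] \<pi>_pos[of x] by (simp add: ennreal_mult ennreal_plus less_imp_le)
    also have "(hr x - 1)\<^sup>2 * \<pi> x + 2 * (hr x * \<pi> x) = (hr x)\<^sup>2 * \<pi> x + \<pi> x" by (simp add: power2_eq_square algebra_simps)
    also have "ennreal \<dots> = (ennreal (hr x))\<^sup>2 * ennreal (\<pi> x) + ennreal (\<pi> x)"
      using hr0[of x] \<pi>_pos[of x] by (simp add: ennreal_mult ennreal_plus less_imp_le ennreal_power)
    finally show "ennreal ((hr x - 1)\<^sup>2) * ennreal (\<pi> x) + 2 * (ennreal (hr x) * ennreal (\<pi> x)) = (ennreal (hr x))\<^sup>2 * ennreal (\<pi> x) + ennreal (\<pi> x)" .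
  qed
  also have "\<dots> = (\<integral>\<^sup>+x. (ennreal (hr x))\<^sup>2 * ennreal (\<pi> x) \<partial>leb d) + 1"
    by (subst nn_integral_add) (auto simp: \<pi>_int)
  also have "\<dots> \<le> ennreal (1 + \<epsilon>) + 1" using X' by (rule add_right_mono)
  also have "\<dots> = ennreal \<epsilon> + 2" using \<epsilon> by (simp add: ennreal_plus add.commute add.left_commute one_add_one[symmetric] del: one_add_one)
  finally have c: "c \<le> ennreal \<epsilon>" by (simp add: ennreal_add_left_cancel_le add.commute)
  show ?thesis unfolding chi_square_accurate_def
  proof (intro exI[of _ "\<lambda>x. hr x * \<pi> x"] conjI allI)
    show "0 \<le> hr x * \<pi> x" for x using hr0[of x] \<pi>_pos[of x] by simp
    show "density (leb d) (\<lambda>x. h x * ennreal (\<pi> x)) = density (leb d) (\<lambda>x. ennreal (hr x * \<pi> x))"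
      by (rule density_cong) (use fin hr0 \<pi>_pos in \<open>auto simp: ennreal_mult less_imp_le elim!: eventually_mono\<close>)
    have "chi_square (leb d) (\<lambda>x. hr x * \<pi> x) \<pi> = c"
      unfolding chi_square_def c_def using \<pi>_pos by (intro nn_integral_cong) (simp add: ennreal_mult less_imp_le less_imp_neq[symmetric])
    then show "chi_square (leb d) (\<lambda>x. hr x * \<pi> x) \<pi> \<le> ennreal \<epsilon>" using c by simp
  qed measurable
qed

end

section \<open>The generalized Cauchy target\<close>

text \<open>The Gamma integral is restricted to arguments \<open>a + s\<close> with
  \<open>0 < s\<close>, where the power is at least \<open>a powr a\<close>, and
  \<open>exp (- s)\<close> integrates to \<open>1\<close>. This is short of Stirling's formula by a
  factor of order \<open>sqrt a\<close>.\<close>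

lemma Gamma_plus1_ge:
  fixes a :: real
  assumes "0 < a"
  shows "a powr a * exp (- a) \<le> Gamma (a + 1)"
proof -
  have "ennreal (a powr a * exp (- a)) = ennreal (a powr a * exp (- a)) * (\<integral>\<^sup>+s. ennreal (indicator {0<..} s * s powr (1 - 1) * exp (- 1 * s)) \<partial>lborel)"
    by (subst nn_integral_Gamma_scaled) auto
  also have "\<dots> = (\<integral>\<^sup>+s. ennreal (a powr a * exp (- a)) * ennreal (indicator {0<..} s * s powr (1 - 1) * exp (- 1 * s)) \<partial>lborel)"
    by (rule nn_integral_cmult[symmetric]) measurable
  also have "\<dots> \<le> (\<integral>\<^sup>+s. ennreal (indicator {0..} (a + 1 * s) * (a + 1 * s) powr (a + 1 - 1) / exp (a + 1 * s)) \<partial>lborel)"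
  proof (rule nn_integral_mono)
    fix s :: real
    show "ennreal (a powr a * exp (- a)) * ennreal (indicator {0<..} s * s powr (1 - 1) * exp (- 1 * s))
      \<le> ennreal (indicator {0..} (a + 1 * s) * (a + 1 * s) powr (a + 1 - 1) / exp (a + 1 * s))"
    proof (cases "s > 0")
      case True
      have "a powr a \<le> (a + s) powr a" using True assms by (intro powr_mono2) auto
      then have "a powr a * exp (- (a + s)) \<le> (a + s) powr a * exp (- (a + s))" by (intro mult_right_mono) auto
      moreover have "exp (- a) * exp (- s) = exp (- (a + s))" by (simp add: exp_add[symmetric])
      ultimately have "a powr a * exp (- a) * exp (- s) \<le> (a + s) powr a * exp (- (a + s))"
        by (simp only: mult.assoc)
      then have "a powr a * exp (- a) * exp (- s) \<le> (a + s) powr a / exp (a + s)"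
        by (simp only: exp_minus divide_inverse)
      then show ?thesis using True assms by (simp add: ennreal_mult[symmetric] ennreal_leI)
    qed simp
  qed
  also have "\<dots> = ennreal \<bar>1\<bar> * (\<integral>\<^sup>+s. ennreal (indicator {0..} (a + 1 * s) * (a + 1 * s) powr (a + 1 - 1) / exp (a + 1 * s)) \<partial>lborel)"
    by simp
  also have "\<dots> = (\<integral>\<^sup>+t. ennreal (indicator {0..} t * t powr (a + 1 - 1) / exp t) \<partial>lborel)"
    by (rule nn_integral_real_affine[symmetric]) auto
  also have "\<dots> = ennreal (Gamma (a + 1))"
    using assms by (intro Gamma_conv_nn_integral_real[symmetric]) simp
  finally show ?thesis
    using assms Gamma_real_pos[of "a + 1"] by (subst (asm) ennreal_le_iff) auto
qed

lemma cauchy_weight: "exp (- cauchy_potential d \<nu> x) = (1 + (enorm d x)\<^sup>2) powr (- ((real d + \<nu>) / 2))"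
proof -
  have "1 + (enorm d x)\<^sup>2 > 0" by (simp add: add_pos_nonneg)
  then show ?thesis by (simp add: cauchy_potential_def powr_def)
qed

definition cauchy_norm :: "nat \<Rightarrow> real \<Rightarrow> real" where
  "cauchy_norm d \<nu> = pi powr (real d / 2) * Gamma (\<nu> / 2) / Gamma ((real d + \<nu>) / 2)"

lemma cauchy_norm_pos: "0 < \<nu> \<Longrightarrow> 0 < cauchy_norm d \<nu>"
  unfolding cauchy_norm_def by (intro divide_pos_pos mult_pos_pos Gamma_real_pos) (auto simp: add_nonneg_pos)

lemma nn_integral_cauchy_weight:
  assumes "0 < \<nu>"
  shows "(\<integral>\<^sup>+x. ennreal ((1 + (enorm d x)\<^sup>2) powr (- ((real d + \<nu>) / 2))) \<partial>leb d) = ennreal (cauchy_norm d \<nu>)"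
proof -
  have eq: "(real d + \<nu>) / 2 - real d / 2 = \<nu> / 2" by (simp add: field_simps)
  show ?thesis unfolding cauchy_norm_def eq[symmetric] by (rule nn_integral_cauchy) (use assms in simp)
qed

lemma cauchy_density_eq:
  assumes "0 < \<nu>"
  shows "cauchy_density d \<nu> x = (1 + (enorm d x)\<^sup>2) powr (- ((real d + \<nu>) / 2)) / cauchy_norm d \<nu>"
proof -
  have "(\<integral>x. (1 + (enorm d x)\<^sup>2) powr (- ((real d + \<nu>) / 2)) \<partial>leb d) = cauchy_norm d \<nu>"
    using nn_integral_cauchy_weight[OF assms, of d] cauchy_norm_pos[OF assms, of d]
    by (subst integral_eq_nn_integral) auto
  then show ?thesis by (simp add: cauchy_density_def prob_normalize_def cauchy_weight)
qed

lemma cauchy_density_pos: "0 < \<nu> \<Longrightarrow> 0 < cauchy_density d \<nu> x"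
proof -
  assume \<nu>: "0 < \<nu>"
  have "0 < 1 + (enorm d x)\<^sup>2" by (simp add: add_pos_nonneg)
  then have "0 < (1 + (enorm d x)\<^sup>2) powr (- ((real d + \<nu>) / 2))" by simp
  then show ?thesis
    unfolding cauchy_density_eq[OF \<nu>] by (intro divide_pos_pos cauchy_norm_pos[OF \<nu>])
qed

lemma measurable_cauchy_density [measurable]: "cauchy_density d \<nu> \<in> borel_measurable (leb d)"
  unfolding cauchy_density_def prob_normalize_def cauchy_potential_def by measurable

lemma nn_integral_cauchy_density_mult:
  assumes "0 < \<nu>" and [measurable]: "g \<in> borel_measurable (leb d)"
  shows "(\<integral>\<^sup>+x. g x * ennreal (cauchy_density d \<nu> x) \<partial>leb d)
    = (\<integral>\<^sup>+x. g x * ennreal ((1 + (enorm d x)\<^sup>2) powr (- ((real d + \<nu>) / 2))) \<partial>leb d) * ennreal (1 / cauchy_norm d \<nu>)"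
proof -
  have "ennreal (cauchy_density d \<nu> x) = ennreal ((1 + (enorm d x)\<^sup>2) powr (- ((real d + \<nu>) / 2))) * ennreal (1 / cauchy_norm d \<nu>)" for x
    using cauchy_norm_pos[OF assms(1), of d] by (subst ennreal_mult[symmetric]) (auto simp: cauchy_density_eq[OF assms(1)])
  then show ?thesis by (simp add: nn_integral_multc[symmetric] mult.assoc)
qed

lemma nn_integral_cauchy_density:
  assumes "0 < \<nu>"
  shows "(\<integral>\<^sup>+x. ennreal (cauchy_density d \<nu> x) \<partial>leb d) = 1"
  using nn_integral_cauchy_density_mult[OF assms, of "\<lambda>_. 1" d] nn_integral_cauchy_weight[OF assms, of d] cauchy_norm_pos[OF assms, of d]
  by (simp add: ennreal_mult[symmetric])

lemma gaussian_density_pos: "0 < gaussian_density d x"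
  by (simp add: gaussian_density_def)

lemma measurable_gaussian_density [measurable]: "gaussian_density d \<in> borel_measurable (leb d)"
  unfolding gaussian_density_def by measurable

lemma nn_integral_gauss_half:
  "(\<integral>\<^sup>+x. ennreal (exp (- (enorm d x)\<^sup>2 / 2)) \<partial>leb d) = ennreal ((2 * pi) powr (real d / 2))"
  using gauss_nn[of "1/2" d] by (simp add: mult.commute)

lemma nn_integral_gaussian_density: "(\<integral>\<^sup>+x. ennreal (gaussian_density d x) \<partial>leb d) = 1"
proof -
  have "(\<integral>\<^sup>+x. ennreal (gaussian_density d x) \<partial>leb d) = (\<integral>\<^sup>+x. ennreal ((2 * pi) powr (- real d / 2)) * ennreal (exp (- (enorm d x)\<^sup>2 / 2)) \<partial>leb d)"
    by (simp add: gaussian_density_def ennreal_mult)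
  also have "\<dots> = ennreal ((2 * pi) powr (- real d / 2) * (2 * pi) powr (real d / 2))"
    by (subst nn_integral_cmult, measurable, simp only: nn_integral_gauss_half, rule ennreal_mult[symmetric]) auto
  finally show ?thesis by (simp add: powr_add[symmetric])
qed

text \<open>With \<open>a = (d + \<nu>) / 2\<close> the weight \<open>(1 + \<bar>x\<bar>\<^sup>2)\<^sup>a\<close> is at most \<open>(2 a)\<^sup>a exp ((1 + \<bar>x\<bar>\<^sup>2) / 2 - a)\<close>.
  This loses only a factor of order \<open>\<surd>d\<close>, and a linear bound in \<open>d\<close> is the largest one
  that \<open>log (d / \<epsilon>)\<close> absorbs uniformly when \<open>\<epsilon>\<close> is of order \<open>d\<close>.\<close>

lemma initial_chi_square:
  assumes \<nu>: "0 < \<nu>" and d: "1 \<le> d"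
  shows "(\<integral>\<^sup>+x. ennreal ((gaussian_density d x)\<^sup>2 / cauchy_density d \<nu> x) \<partial>leb d)
    \<le> ennreal (Gamma (\<nu> / 2) * exp (1 / 2) * 2 powr (\<nu> / 2) * ((1 + \<nu>) / 2) * real d)"
proof -
  define a where "a = (real d + \<nu>) / 2"
  have a: "a > 0" using \<nu> by (simp add: a_def add_nonneg_pos)
  define Z where "Z = cauchy_norm d \<nu>"
  have Z: "Z > 0" unfolding Z_def by (rule cauchy_norm_pos[OF \<nu>])
  define c where "c = Z * (2 * pi) powr (- real d) * ((2 * a) powr a * exp (1 / 2 - a))"
  have c0: "0 \<le> c" using Z by (simp add: c_def)
  have pw: "(gaussian_density d x)\<^sup>2 / cauchy_density d \<nu> x \<le> c * exp (- (enorm d x)\<^sup>2 / 2)" for x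
  proof -
    define w where "w = 1 + (enorm d x)\<^sup>2"
    have w: "w > 0" by (simp add: w_def add_pos_nonneg)
    \<comment> \<open>From \<open>z \<le> exp (z - 1)\<close> at \<open>z = w / (2 * a)\<close>,
      sharp at \<open>w = 2 * a\<close>, the maximiser of \<open>w powr a * exp (- w / 2)\<close>.
      The rate \<open>1 / 2\<close> leaves half of the exponent of the squared Gaussian for
      integration.\<close>
    have "w / (2 * a) \<le> exp (w / (2 * a) - 1)" using exp_ge_add_one_self[of "w / (2 * a) - 1"] by simp
    then have "w \<le> 2 * a * exp (w / (2 * a) - 1)" using a by (simp add: field_simps)
    then have "w powr a \<le> (2 * a * exp (w / (2 * a) - 1)) powr a" using a w by (intro powr_mono2) auto
    also have "\<dots> = (2 * a) powr a * exp (w / 2 - a)"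
    proof -
      have "exp (w / (2 * a) - 1) powr a = exp (w / 2 - a)" using a by (simp add: powr_def field_simps)
      then show ?thesis using a by (simp add: powr_mult)
    qed
    finally have wp: "w powr a \<le> (2 * a) powr a * exp (w / 2 - a)" .
    have g2: "(gaussian_density d x)\<^sup>2 = (2 * pi) powr (- real d) * exp (- (enorm d x)\<^sup>2)"
    proof -
      have "((2 * pi) powr (- real d / 2))\<^sup>2 = (2 * pi) powr (- real d)"
        by (simp add: power2_eq_square powr_add[symmetric])
      moreover have "(exp (- (enorm d x)\<^sup>2 / 2))\<^sup>2 = exp (- (enorm d x)\<^sup>2)"
        by (simp add: power2_eq_square exp_add[symmetric])
      ultimately show ?thesis by (simp add: gaussian_density_def power_mult_distrib)
    qed
    have "(gaussian_density d x)\<^sup>2 / cauchy_density d \<nu> x = (2 * pi) powr (- real d) * exp (- (enorm d x)\<^sup>2) * (Z * w powr a)"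
      unfolding g2 cauchy_density_eq[OF \<nu>] a_def[symmetric] Z_def[symmetric] w_def[symmetric]
      using w by (simp add: powr_minus field_simps)
    also have "\<dots> \<le> (2 * pi) powr (- real d) * exp (- (enorm d x)\<^sup>2) * (Z * ((2 * a) powr a * exp (w / 2 - a)))"
      using wp Z by (intro mult_left_mono) auto
    also have "\<dots> = Z * (2 * pi) powr (- real d) * (2 * a) powr a * (exp (- (enorm d x)\<^sup>2) * exp (w / 2 - a))"
      by (simp add: mult_ac)
    also have "exp (- (enorm d x)\<^sup>2) * exp (w / 2 - a) = exp (1 / 2 - a) * exp (- (enorm d x)\<^sup>2 / 2)"
      unfolding exp_add[symmetric] by (simp add: w_def field_simps)
    finally show ?thesis by (simp add: c_def mult_ac)
  qed
  have "(\<integral>\<^sup>+x. ennreal ((gaussian_density d x)\<^sup>2 / cauchy_density d \<nu> x) \<partial>leb d) \<le> (\<integral>\<^sup>+x. ennreal c * ennreal (exp (- (enorm d x)\<^sup>2 / 2)) \<partial>leb d)"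
    using pw c0 by (intro nn_integral_mono) (simp add: ennreal_mult[symmetric] ennreal_leI)
  also have "\<dots> = ennreal (c * (2 * pi) powr (real d / 2))"
    by (subst nn_integral_cmult, measurable, simp only: nn_integral_gauss_half, rule ennreal_mult[symmetric, OF c0]) simp
  also have "\<dots> \<le> ennreal (Gamma (\<nu> / 2) * exp (1 / 2) * 2 powr (\<nu> / 2) * ((1 + \<nu>) / 2) * real d)"
  proof (rule ennreal_leI)
    have Ga: "Gamma a > 0" and Gn: "Gamma (\<nu> / 2) > 0" using a \<nu> by (auto intro!: Gamma_real_pos)
    have pp: "(2 * pi) powr (- real d) * (2 * pi) powr (real d / 2) = 2 powr (- real d / 2) / pi powr (real d / 2)"
    proof -
      have "(2 * pi) powr (- real d) * (2 * pi) powr (real d / 2) = (2 * pi) powr (- real d / 2)"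
        unfolding powr_add[symmetric] by simp
      also have "\<dots> = 2 powr (- real d / 2) * pi powr (- real d / 2)" by (simp add: powr_mult)
      also have "pi powr (- real d / 2) = 1 / pi powr (real d / 2)" by (simp add: powr_minus_divide)
      finally show ?thesis by simp
    qed
    have "c * (2 * pi) powr (real d / 2) = Z * ((2 * pi) powr (- real d) * (2 * pi) powr (real d / 2)) * ((2 * a) powr a * exp (1 / 2 - a))"
      by (simp add: c_def mult_ac)
    also have "\<dots> = Gamma (\<nu> / 2) / Gamma a * 2 powr (- real d / 2) * ((2 * a) powr a * exp (1 / 2 - a))"
      unfolding pp Z_def cauchy_norm_def a_def[symmetric] by simp
    also have "(2 * a) powr a * exp (1 / 2 - a) = 2 powr a * exp (1 / 2) * (a powr a * exp (- a))"
    proof -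
      have "exp (1 / 2 - a) = exp (1 / 2) * exp (- a)" by (simp add: exp_add[symmetric])
      moreover have "(2 * a) powr a = 2 powr a * a powr a" using a by (simp add: powr_mult)
      ultimately show ?thesis by (simp only: mult_ac)
    qed
    also have "Gamma (\<nu> / 2) / Gamma a * 2 powr (- real d / 2) * (2 powr a * exp (1 / 2) * (a powr a * exp (- a)))
      = Gamma (\<nu> / 2) * exp (1 / 2) * (2 powr (- real d / 2) * 2 powr a) * ((a powr a * exp (- a)) / Gamma a)"
      by simp
    also have "2 powr (- real d / 2) * 2 powr a = 2 powr (\<nu> / 2)"
      unfolding powr_add[symmetric] by (simp add: a_def field_simps)
    \<comment> \<open>All powers with exponent proportional to \<open>d\<close> have cancelled; this
      quotient is the sole remaining dependence on the dimension.\<close>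
    also have "(a powr a * exp (- a)) / Gamma a \<le> a"
    proof -
      have "a \<notin> \<int>\<^sub>\<le>\<^sub>0" using a by (auto elim!: nonpos_Ints_cases)
      then have "Gamma (a + 1) = a * Gamma a" by (rule Gamma_plus1)
      then show ?thesis using Gamma_plus1_ge[OF a] Ga by (simp add: field_simps)
    qed
    also have "a \<le> (1 + \<nu>) / 2 * real d"
    proof -
      have "\<nu> * 1 \<le> \<nu> * real d" using d \<nu> by (intro mult_left_mono) auto
      then show ?thesis by (simp add: a_def field_simps)
    qed
    finally show "c * (2 * pi) powr (real d / 2) \<le> Gamma (\<nu> / 2) * exp (1 / 2) * 2 powr (\<nu> / 2) * ((1 + \<nu>) / 2) * real d"
      using Gn by (simp add: mult.assoc mult_left_mono)
  qed
  finally show ?thesis .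
qed

section \<open>A lower bound for the Poincare constant, uniform in the dimension\<close>

definition unit0 :: "nat \<Rightarrow> real" where "unit0 i = (if i = 0 then 1 else 0)"

lemma einner_unit0: "1 \<le> d \<Longrightarrow> einner d x (\<lambda>i. c * unit0 i) = c * x 0"
proof -
  assume d: "1 \<le> d"
  have "einner d x (\<lambda>i. c * unit0 i) = (\<Sum>i<d. if i = 0 then c * x 0 else 0)"
    unfolding einner_def unit0_def by (intro sum.cong) auto
  then show ?thesis using d by (simp add: sum.delta)
qed

lemma enorm_unit0: "1 \<le> d \<Longrightarrow> (enorm d (\<lambda>i. c * unit0 i))\<^sup>2 = c\<^sup>2"
proof -
  assume d: "1 \<le> d"
  have "(enorm d (\<lambda>i. c * unit0 i))\<^sup>2 = (\<Sum>i<d. if i = 0 then c\<^sup>2 else 0)"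
    unfolding enorm_sq unit0_def by (intro sum.cong) auto
  then show ?thesis using d by (simp add: sum.delta)
qed

lemma measurable_coord0: "1 \<le> d \<Longrightarrow> (\<lambda>x. x 0) \<in> borel_measurable (leb d)"
  by (rule measurable_component_leb) simp

lemma nn_integral_gauss_1_cos:
  assumes d: "1 \<le> d" and u: "0 < u"
  shows "(\<integral>\<^sup>+x. ennreal (exp (- u * (enorm d x)\<^sup>2) * (1 - cos (c * x 0))) \<partial>leb d)
    = ennreal ((pi / u) powr (real d / 2) * (1 - exp (- c\<^sup>2 / (4 * u))))"
proof -
  note [measurable] = measurable_coord0[OF d]
  note g = gauss_cos(1)[OF u, of d]
  have gc: "integrable (leb d) (\<lambda>x. exp (- u * (enorm d x)\<^sup>2) * cos (c * x 0))"
    by (rule Bochner_Integration.integrable_bound[OF g]) (auto simp: abs_mult intro!: mult_left_le)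
  have "(\<integral>x. exp (- u * (enorm d x)\<^sup>2) * cos (c * x 0) \<partial>leb d) = (pi / u) powr (real d / 2) * exp (- c\<^sup>2 / (4 * u))"
    using gauss_cos(2)[OF u, of d "\<lambda>i. c * unit0 i"] unfolding einner_unit0[OF d] enorm_unit0[OF d] .
  then have "(\<integral>x. exp (- u * (enorm d x)\<^sup>2) * (1 - cos (c * x 0)) \<partial>leb d) = (pi / u) powr (real d / 2) * (1 - exp (- c\<^sup>2 / (4 * u)))"
    using g gc gauss_cos(3)[OF u, of d] by (simp add: right_diff_distrib)
  moreover have "integrable (leb d) (\<lambda>x. exp (- u * (enorm d x)\<^sup>2) * (1 - cos (c * x 0)))"
    using g gc by (simp add: right_diff_distrib)
  ultimately show ?thesis by (subst nn_integral_eq_integral) auto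
qed

text \<open>\<open>frac_const\<close> normalises the jump kernel so that its Fourier symbol is
  \<open>|\<xi>|^\<alpha>\<close>; this is the value at a unit vector, hence free of the dimension.
  The kernel is unfolded into heat kernels, the Gaussian cosine integral contributes
  \<open>1 - exp (- u)\<close>, and the same constant \<open>W\<close> appears on both
  sides.\<close>

lemma nn_integral_levy_1_cos:
  assumes d: "1 \<le> d" and \<alpha>: "0 < \<alpha>" "\<alpha> < 2"
  shows "ennreal (frac_const d \<alpha>) * (\<integral>\<^sup>+z. ennreal ((1 - cos (z 0)) / enorm d z powr (real d + \<alpha>)) \<partial>leb d) = 1"
proof -
  note [measurable] = measurable_coord0[OF d]
  define W where "W = Gamma (1 - \<alpha> / 2) / (\<alpha> / 2)"
  have "0 < Gamma (1 - \<alpha> / 2)" using \<alpha> by (intro Gamma_real_pos) simp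
  then have W: "0 < W" using \<alpha> by (simp add: W_def)
  note c0 = frac_const_nonneg[OF \<alpha>(1), of d]
  have [measurable]: "(\<lambda>z. heat d (fst z) (snd z)) \<in> borel_measurable (lborel \<Otimes>\<^sub>M leb d)"
    unfolding heat_def by measurable
  have "(ennreal (frac_const d \<alpha>) * (\<integral>\<^sup>+z. ennreal ((1 - cos (z 0)) / enorm d z powr (real d + \<alpha>)) \<partial>leb d)) * ennreal W
    = (\<integral>\<^sup>+z. ennreal (1 - cos (z 0)) * ennreal (frac_const d \<alpha> / enorm d z powr (real d + \<alpha>) * W) \<partial>leb d)"
  proof -
    define F where "F z = ennreal ((1 - cos (z 0)) / enorm d z powr (real d + \<alpha>))" for z
    have [measurable]: "F \<in> borel_measurable (leb d)" unfolding F_def by measurable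
    have "ennreal (frac_const d \<alpha>) * (\<integral>\<^sup>+z. F z \<partial>leb d) * ennreal W = (\<integral>\<^sup>+z. ennreal (frac_const d \<alpha>) * F z \<partial>leb d) * ennreal W"
      by (subst nn_integral_cmult) auto
    also have "\<dots> = (\<integral>\<^sup>+z. ennreal (frac_const d \<alpha>) * F z * ennreal W \<partial>leb d)"
      by (rule nn_integral_multc[symmetric]) measurable
    also have "\<dots> = (\<integral>\<^sup>+z. ennreal (1 - cos (z 0)) * ennreal (frac_const d \<alpha> / enorm d z powr (real d + \<alpha>) * W) \<partial>leb d)"
    proof (rule nn_integral_cong)
      fix z :: "nat \<Rightarrow> real"
      have "ennreal (frac_const d \<alpha>) * F z * ennreal W = ennreal (frac_const d \<alpha> * ((1 - cos (z 0)) / enorm d z powr (real d + \<alpha>)) * W)"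
      proof -
        have "0 \<le> (1 - cos (z 0)) / enorm d z powr (real d + \<alpha>)" by simp
        then show ?thesis
          unfolding F_def using c0 W by (subst ennreal_mult, simp, simp, subst ennreal_mult) auto
      qed
      also have "\<dots> = ennreal ((1 - cos (z 0)) * (frac_const d \<alpha> / enorm d z powr (real d + \<alpha>) * W))"
        by (rule arg_cong[where f = ennreal]) simp
      also have "\<dots> = ennreal (1 - cos (z 0)) * ennreal (frac_const d \<alpha> / enorm d z powr (real d + \<alpha>) * W)"
        using c0 W by (intro ennreal_mult) auto
      finally show "ennreal (frac_const d \<alpha>) * F z * ennreal W = ennreal (1 - cos (z 0)) * ennreal (frac_const d \<alpha> / enorm d z powr (real d + \<alpha>) * W)" .
    qed
    finally show ?thesis unfolding F_def .
  qed
  also have "\<dots> = (\<integral>\<^sup>+z. (\<integral>\<^sup>+u. ennreal (1 - cos (z 0)) * ennreal (indicator {0<..} u * heat d u z * u powr (- 1 - \<alpha> / 2)) \<partial>lborel) \<partial>leb d)"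
  proof (rule nn_integral_cong_AE)
    show "AE z in leb d. ennreal (1 - cos (z 0)) * ennreal (frac_const d \<alpha> / enorm d z powr (real d + \<alpha>) * W)
      = (\<integral>\<^sup>+u. ennreal (1 - cos (z 0)) * ennreal (indicator {0<..} u * heat d u z * u powr (- 1 - \<alpha> / 2)) \<partial>lborel)"
      using AE_enorm_neq_0[OF d]
    proof eventually_elim
      case (elim z)
      then have "0 < enorm d z" using enorm_nonneg[of d z] by linarith
      from nn_integral_heat_levy[OF \<alpha> this] show ?case
        unfolding W_def heat_def by (subst nn_integral_cmult) auto
    qed
  qed
  also have "\<dots> = (\<integral>\<^sup>+u. (\<integral>\<^sup>+z. ennreal (1 - cos (z 0)) * ennreal (indicator {0<..} u * heat d u z * u powr (- 1 - \<alpha> / 2)) \<partial>leb d) \<partial>lborel)"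
    by (rule lborel_leb.Fubini') (simp add: case_prod_unfold)
  also have "\<dots> = (\<integral>\<^sup>+u. ennreal (indicator {0<..} u * (1 - exp (- 1 * u)) * u powr (- 1 - \<alpha> / 2)) \<partial>lborel)"
  proof (rule nn_integral_cong)
    fix u :: real
    show "(\<integral>\<^sup>+z. ennreal (1 - cos (z 0)) * ennreal (indicator {0<..} u * heat d u z * u powr (- 1 - \<alpha> / 2)) \<partial>leb d)
      = ennreal (indicator {0<..} u * (1 - exp (- 1 * u)) * u powr (- 1 - \<alpha> / 2))"
    proof (cases "u > 0")
      case True
      define v where "v = 1 / (4 * u)"
      have v: "v > 0" using True by (simp add: v_def)
      define A where "A = (4 * pi * u) powr (- real d / 2) * u powr (- 1 - \<alpha> / 2)"
      have A0: "0 \<le> A" by (simp add: A_def)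
      have "heat d u z = (4 * pi * u) powr (- real d / 2) * exp (- v * (enorm d z)\<^sup>2)" for z
        by (simp add: heat_def v_def)
      then have "ennreal (1 - cos (z 0)) * ennreal (indicator {0<..} u * heat d u z * u powr (- 1 - \<alpha> / 2))
         = ennreal A * ennreal (exp (- v * (enorm d z)\<^sup>2) * (1 - cos (1 * z 0)))" for z
        using True A0 by (simp add: ennreal_mult[symmetric] A_def mult_ac)
      then have "(\<integral>\<^sup>+z. ennreal (1 - cos (z 0)) * ennreal (indicator {0<..} u * heat d u z * u powr (- 1 - \<alpha> / 2)) \<partial>leb d)
        = ennreal A * (\<integral>\<^sup>+z. ennreal (exp (- v * (enorm d z)\<^sup>2) * (1 - cos (1 * z 0))) \<partial>leb d)"
        by (simp only:) (rule nn_integral_cmult, measurable)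
      also have "\<dots> = ennreal A * ennreal ((pi / v) powr (real d / 2) * (1 - exp (- 1\<^sup>2 / (4 * v))))"
        unfolding nn_integral_gauss_1_cos[OF d v] ..
      also have "\<dots> = ennreal (A * ((pi / v) powr (real d / 2) * (1 - exp (- 1\<^sup>2 / (4 * v)))))"
        using A0 True v by (intro ennreal_mult[symmetric]) auto
      also have "A * ((pi / v) powr (real d / 2) * (1 - exp (- 1\<^sup>2 / (4 * v)))) = (1 - exp (- 1 * u)) * u powr (- 1 - \<alpha> / 2)"
      proof -
        have "pi / v = 4 * pi * u" "- 1\<^sup>2 / (4 * v) = - 1 * u" using True by (auto simp: v_def)
        moreover have "(4 * pi * u) powr (- real d / 2) * (4 * pi * u) powr (real d / 2) = 1"
          using True unfolding powr_add[symmetric] by simp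
        ultimately show ?thesis unfolding A_def by (simp add: mult_ac)
      qed
      finally show ?thesis using True by simp
    qed simp
  qed
  also have "\<dots> = ennreal W"
    using nn_integral_levy[of "\<alpha> / 2" 1] \<alpha> by (simp add: W_def)
  finally have eq: "(ennreal (frac_const d \<alpha>) * (\<integral>\<^sup>+z. ennreal ((1 - cos (z 0)) / enorm d z powr (real d + \<alpha>)) \<partial>leb d)) * ennreal W = ennreal W" (is "?X * _ = _") .
  have "?X = ?X * ennreal W * ennreal (1 / W)" using W by (simp add: mult.assoc ennreal_mult[symmetric])
  also have "\<dots> = 1" unfolding eq using W by (simp add: ennreal_mult[symmetric])
  finally show ?thesis .
qed

text \<open>After a translation, \<open>(sin (y + z) - sin y)^2 \<le> 2 * (1 - cos z)\<close> bounds
  the inner integral by twice the symbol at a unit vector, whatever the point \<open>y\<close> and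
  the dimension.\<close>

lemma energy_sin_le:
  assumes d: "1 \<le> d" and \<alpha>: "0 < \<alpha>" "\<alpha> < 2" and \<mu> [measurable]: "\<mu> \<in> borel_measurable (leb d)"
    and \<mu>1: "(\<integral>\<^sup>+x. ennreal (\<mu> x) \<partial>leb d) = 1"
  shows "frac_energy d \<alpha> \<mu> (\<lambda>x. sin (x 0)) \<le> 2"
proof -
  note [measurable] = measurable_coord0[OF d]
  define inner where "inner y = (\<integral>\<^sup>+x. ennreal ((sin (x 0) - sin (y 0))\<^sup>2 / enorm d (\<lambda>i. x i - y i) powr (real d + \<alpha>)) \<partial>leb d)" for y
  have im: "inner \<in> borel_measurable (leb d)" unfolding inner_def by measurable
  have inner_le: "ennreal (frac_const d \<alpha>) * inner y \<le> 2" if y: "y \<in> space (leb d)" for y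
  proof -
    have [measurable]: "(\<lambda>x. enorm d (\<lambda>i. x i - y i)) \<in> borel_measurable (leb d)"
      using y by (intro measurable_enorm_diff) auto
    have "inner y = ennreal (\<bar>1\<bar> ^ d) * (\<integral>\<^sup>+z. ennreal ((sin (affine_map d y 1 z 0) - sin (y 0))\<^sup>2 / enorm d (\<lambda>i. affine_map d y 1 z i - y i) powr (real d + \<alpha>)) \<partial>leb d)"
      unfolding inner_def by (rule nn_integral_affine) auto
    also have "\<dots> \<le> (\<integral>\<^sup>+z. 2 * ennreal ((1 - cos (z 0)) / enorm d z powr (real d + \<alpha>)) \<partial>leb d)"
    proof (simp, rule nn_integral_mono)
      fix z
      have e: "enorm d (\<lambda>i. affine_map d y 1 z i - y i) = enorm d z" by (rule enorm_cong) (simp add: affine_map_def)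
      have "(sin (affine_map d y 1 z 0) - sin (y 0))\<^sup>2 \<le> 2 * (1 - cos (z 0))"
      proof -
        have a0: "affine_map d y 1 z 0 = y 0 + z 0" using d by (simp add: affine_map_def)
        have "sin (y 0 + z 0) - sin (y 0) = 2 * sin (z 0 / 2) * cos ((2 * y 0 + z 0) / 2)"
          by (subst sin_diff_sin) (simp add: algebra_simps)
        then have "(sin (y 0 + z 0) - sin (y 0))\<^sup>2 = 4 * (sin (z 0 / 2))\<^sup>2 * (cos ((2 * y 0 + z 0) / 2))\<^sup>2"
          by (simp add: power_mult_distrib)
        also have "\<dots> \<le> 4 * (sin (z 0 / 2))\<^sup>2 * 1" by (intro mult_left_mono) (auto simp: abs_square_le_1)
        also have "\<dots> = 2 * (1 - cos (z 0))" using cos_double_sin[of "z 0 / 2"] by simp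
        finally show ?thesis unfolding a0 .
      qed
      then have "(sin (affine_map d y 1 z 0) - sin (y 0))\<^sup>2 / enorm d z powr (real d + \<alpha>) \<le> 2 * ((1 - cos (z 0)) / enorm d z powr (real d + \<alpha>))"
        by (simp add: divide_right_mono)
      then show "ennreal ((sin (affine_map d y 1 z 0) - sin (y 0))\<^sup>2 / enorm d (\<lambda>i. affine_map d y 1 z i - y i) powr (real d + \<alpha>)) \<le> 2 * ennreal ((1 - cos (z 0)) / enorm d z powr (real d + \<alpha>))"
        unfolding e by (subst ennreal_numeral[symmetric], subst ennreal_mult[symmetric]) (auto intro: ennreal_leI)
    qed
    also have "\<dots> = 2 * (\<integral>\<^sup>+z. ennreal ((1 - cos (z 0)) / enorm d z powr (real d + \<alpha>)) \<partial>leb d)"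
      by (rule nn_integral_cmult) measurable
    finally have "ennreal (frac_const d \<alpha>) * inner y \<le> ennreal (frac_const d \<alpha>) * (2 * (\<integral>\<^sup>+z. ennreal ((1 - cos (z 0)) / enorm d z powr (real d + \<alpha>)) \<partial>leb d))"
      by (rule mult_left_mono) simp
    also have "\<dots> = 2" using nn_integral_levy_1_cos[OF d \<alpha>] by (simp add: mult.left_commute)
    finally show ?thesis .
  qed
  have "frac_energy d \<alpha> \<mu> (\<lambda>x. sin (x 0)) = (\<integral>\<^sup>+y. (ennreal (frac_const d \<alpha>) * inner y) * ennreal (\<mu> y) \<partial>leb d)"
    unfolding frac_energy_alt inner_def[symmetric] using im by (simp add: nn_integral_cmult[symmetric] mult.assoc)
  also have "\<dots> \<le> (\<integral>\<^sup>+y. 2 * ennreal (\<mu> y) \<partial>leb d)"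
    by (intro nn_integral_mono mult_right_mono inner_le) auto
  also have "\<dots> = 2" by (simp add: nn_integral_cmult \<mu>1)
  finally show ?thesis .
qed

text \<open>\<open>Gamma (\<nu> / 2)\<close> times the mean of the squared sine of the first
  coordinate under the target, written as a mixture over \<open>u\<close>: for the normalised
  Gaussian proportional to \<open>exp (- u * |x|^2)\<close> that mean is
  \<open>(1 - exp (- 1 / u)) / 2\<close>.\<close>

definition sin_mass :: "real \<Rightarrow> ennreal" where
  "sin_mass \<nu> = (\<integral>\<^sup>+u. ennreal (indicator {0<..} u * u powr (\<nu> / 2 - 1) * exp (- u) * (1 - exp (- 1 / u)) / 2) \<partial>lborel)"

lemma sin_mass_cmult:
  "(\<integral>\<^sup>+u. ennreal b * ennreal (indicator {0<..} u * u powr (\<nu> / 2 - 1) * exp (- u) * (1 - exp (- 1 / u)) / 2) \<partial>lborel) = ennreal b * sin_mass \<nu>"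
  unfolding sin_mass_def by (rule nn_integral_cmult) measurable

lemma sin_mass_pos: "0 < sin_mass \<nu>"
proof -
  have "sin_mass \<nu> \<noteq> 0"
  proof
    assume "sin_mass \<nu> = 0"
    then have "AE u in lborel. ennreal (indicator {0<..} u * u powr (\<nu> / 2 - 1) * exp (- u) * (1 - exp (- 1 / u)) / 2) = 0"
      unfolding sin_mass_def by (subst (asm) nn_integral_0_iff_AE) measurable
    then have "AE u in lborel. u \<notin> {0<..1::real}"
    proof eventually_elim
      case (elim u)
      show ?case
      proof
        assume u: "u \<in> {0<..1}"
        then have "0 < indicator {0<..} u * u powr (\<nu> / 2 - 1) * exp (- u) * (1 - exp (- 1 / u)) / 2" by simp
        with elim show False by (simp only: ennreal_eq_0_iff)
      qed
    qed
    then have "emeasure lborel {u \<in> space lborel. u \<in> {0<..1::real}} = 0" by (rule emeasure_eq_0_AE)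
    also have "{u \<in> space lborel. u \<in> {0<..1::real}} = {0<..1}" by auto
    finally show False by (simp add: emeasure_lborel_Ioc)
  qed
  then show ?thesis by (simp add: zero_less_iff_neq_zero)
qed

lemma sin_mass_finite:
  assumes "0 < \<nu>"
  shows "sin_mass \<nu> < \<infinity>"
proof -
  have "sin_mass \<nu> \<le> (\<integral>\<^sup>+u. ennreal (indicator {0<..} u * u powr (\<nu> / 2 - 1) * exp (- 1 * u)) \<partial>lborel)"
    unfolding sin_mass_def
  proof (intro nn_integral_mono ennreal_leI)
    fix u :: real
    have "indicator {0<..} u * u powr (\<nu> / 2 - 1) * exp (- u) * ((1 - exp (- 1 / u)) / 2) \<le> indicator {0<..} u * u powr (\<nu> / 2 - 1) * exp (- u) * 1"
    proof (rule mult_left_mono)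
      have "1 - exp (- 1 / u) \<le> 2" by (rule order_trans[of _ 1]) simp_all
      then have "(1 - exp (- 1 / u)) / 2 \<le> 2 / 2" by (rule divide_right_mono) simp
      then show "(1 - exp (- 1 / u)) / 2 \<le> 1" by simp
    qed simp
    then show "indicator {0<..} u * u powr (\<nu> / 2 - 1) * exp (- u) * (1 - exp (- 1 / u)) / 2 \<le> indicator {0<..} u * u powr (\<nu> / 2 - 1) * exp (- 1 * u)"
      by simp
  qed
  also have "\<dots> < \<infinity>" using assms by (subst nn_integral_Gamma_scaled) auto
  finally show ?thesis .
qed

text \<open>The first coordinate has the same law under \<open>\<pi>\<^sub>\<nu>\<close> in every dimension.\<close>

lemma sin_sq_cauchy:
  assumes d: "1 \<le> d" and \<nu>: "0 < \<nu>"
  shows "(\<integral>\<^sup>+x. ennreal ((sin (x 0))\<^sup>2) * ennreal (cauchy_density d \<nu> x) \<partial>leb d) = sin_mass \<nu> * ennreal (1 / Gamma (\<nu> / 2))"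
proof -
  note [measurable] = measurable_coord0[OF d]
  define a where "a = (real d + \<nu>) / 2"
  have a: "a > 0" using \<nu> by (simp add: a_def add_nonneg_pos)
  have Ga: "Gamma a > 0" and Gn: "Gamma (\<nu> / 2) > 0" using a \<nu> by (auto intro!: Gamma_real_pos)
  define X where "X = (\<integral>\<^sup>+x. ennreal ((sin (x 0))\<^sup>2) * ennreal ((1 + (enorm d x)\<^sup>2) powr (- a)) \<partial>leb d)"
  have "ennreal (Gamma a) * X = (\<integral>\<^sup>+u. ennreal (indicator {0<..} u * u powr (a - 1) * exp (- u)) *
        (\<integral>\<^sup>+x. ennreal ((sin (x 0))\<^sup>2) * ennreal (exp (- u * (enorm d x)\<^sup>2)) \<partial>leb d) \<partial>lborel)"
    unfolding X_def by (rule nn_integral_cauchy_mixture[OF a]) measurable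
  also have "\<dots> = (\<integral>\<^sup>+u. ennreal (pi powr (real d / 2)) * ennreal (indicator {0<..} u * u powr (\<nu> / 2 - 1) * exp (- u) * (1 - exp (- 1 / u)) / 2) \<partial>lborel)"
  proof (rule nn_integral_cong)
    fix u :: real
    show "ennreal (indicator {0<..} u * u powr (a - 1) * exp (- u)) * (\<integral>\<^sup>+x. ennreal ((sin (x 0))\<^sup>2) * ennreal (exp (- u * (enorm d x)\<^sup>2)) \<partial>leb d)
      = ennreal (pi powr (real d / 2)) * ennreal (indicator {0<..} u * u powr (\<nu> / 2 - 1) * exp (- u) * (1 - exp (- 1 / u)) / 2)"
    proof (cases "u > 0")
      case True
      have "ennreal ((sin (x 0))\<^sup>2) * ennreal (exp (- u * (enorm d x)\<^sup>2)) = ennreal (1 / 2) * ennreal (exp (- u * (enorm d x)\<^sup>2) * (1 - cos (2 * x 0)))" for x :: "nat \<Rightarrow> real"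
        using cos_double_sin[of "x 0"] by (subst (1 2) ennreal_mult[symmetric]) auto
      then have "(\<integral>\<^sup>+x. ennreal ((sin (x 0))\<^sup>2) * ennreal (exp (- u * (enorm d x)\<^sup>2)) \<partial>leb d)
        = ennreal (1 / 2) * (\<integral>\<^sup>+x. ennreal (exp (- u * (enorm d x)\<^sup>2) * (1 - cos (2 * x 0))) \<partial>leb d)"
        by (simp only:) (rule nn_integral_cmult, measurable)
      also have "\<dots> = ennreal (1 / 2) * ennreal ((pi / u) powr (real d / 2) * (1 - exp (- 2\<^sup>2 / (4 * u))))"
        unfolding nn_integral_gauss_1_cos[OF d True] ..
      also have "\<dots> = ennreal (1 / 2 * ((pi / u) powr (real d / 2) * (1 - exp (- 1 / u))))"
        using True by (subst ennreal_mult[symmetric]) auto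
      finally have i: "(\<integral>\<^sup>+x. ennreal ((sin (x 0))\<^sup>2) * ennreal (exp (- u * (enorm d x)\<^sup>2)) \<partial>leb d) = ennreal (1 / 2 * ((pi / u) powr (real d / 2) * (1 - exp (- 1 / u))))" .
      have pw: "u powr (a - 1) * (pi / u) powr (real d / 2) = pi powr (real d / 2) * u powr (\<nu> / 2 - 1)"
      proof -
        have "u powr (a - 1) = u powr (\<nu> / 2 - 1) * u powr (real d / 2)"
          unfolding powr_add[symmetric] by (rule arg_cong[where f = "(powr) u"]) (simp add: a_def field_simps)
        then show ?thesis using True by (simp add: powr_divide)
      qed
      have "ennreal (indicator {0<..} u * u powr (a - 1) * exp (- u)) * ennreal (1 / 2 * ((pi / u) powr (real d / 2) * (1 - exp (- 1 / u))))
        = ennreal ((u powr (a - 1) * (pi / u) powr (real d / 2)) * exp (- u) * (1 - exp (- 1 / u)) / 2)"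
        using True by (subst ennreal_mult[symmetric]) (auto simp: mult_ac)
      also have "\<dots> = ennreal (pi powr (real d / 2)) * ennreal (indicator {0<..} u * u powr (\<nu> / 2 - 1) * exp (- u) * (1 - exp (- 1 / u)) / 2)"
        unfolding pw using True by (subst ennreal_mult[symmetric]) (auto simp: mult_ac)
      finally show ?thesis unfolding i .
    qed simp
  qed
  also have "\<dots> = ennreal (pi powr (real d / 2)) * sin_mass \<nu>"
    by (rule sin_mass_cmult)
  finally have X: "ennreal (Gamma a) * X = ennreal (pi powr (real d / 2)) * sin_mass \<nu>" .
  have "(\<integral>\<^sup>+x. ennreal ((sin (x 0))\<^sup>2) * ennreal (cauchy_density d \<nu> x) \<partial>leb d) = X * ennreal (1 / cauchy_norm d \<nu>)"
    unfolding X_def a_def by (rule nn_integral_cauchy_density_mult[OF \<nu>]) measurable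
  also have "1 / cauchy_norm d \<nu> = Gamma a * (1 / (pi powr (real d / 2) * Gamma (\<nu> / 2)))"
    by (simp add: cauchy_norm_def a_def)
  also have "X * ennreal (Gamma a * (1 / (pi powr (real d / 2) * Gamma (\<nu> / 2)))) = (ennreal (Gamma a) * X) * ennreal (1 / (pi powr (real d / 2) * Gamma (\<nu> / 2)))"
    using Ga Gn by (subst ennreal_mult) (auto simp: mult_ac)
  also have "\<dots> = sin_mass \<nu> * (ennreal (pi powr (real d / 2)) * ennreal (1 / (pi powr (real d / 2) * Gamma (\<nu> / 2))))"
    unfolding X by (simp only: mult_ac)
  also have "ennreal (pi powr (real d / 2)) * ennreal (1 / (pi powr (real d / 2) * Gamma (\<nu> / 2))) = ennreal (1 / Gamma (\<nu> / 2))"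
    using Gn by (subst ennreal_mult[symmetric]) auto
  finally show ?thesis .
qed

text \<open>Absorbs the rounding of the number of steps and turns \<open>C + \<eta>\<close> into a multiple of \<open>C\<close>.\<close>

lemma fractional_poincare_lower_bound:
  assumes \<nu>: "0 < \<nu>" and \<alpha>: "0 < \<alpha>" "\<alpha> < 2"
  obtains c where "0 < c" "\<And>d C. 1 \<le> d \<Longrightarrow> fractional_poincare d \<alpha> (cauchy_density d \<nu>) C \<Longrightarrow> c \<le> C"
proof -
  have Gn: "Gamma (\<nu> / 2) > 0" using \<nu> by (intro Gamma_real_pos) simp
  define k where "k = enn2real (sin_mass \<nu>)"
  have ks: "ennreal k = sin_mass \<nu>" using sin_mass_finite[OF \<nu>] by (simp add: k_def)
  have k: "0 < k" using sin_mass_pos[of \<nu>] unfolding ks[symmetric] by simp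
  define m where "m = k / Gamma (\<nu> / 2)"
  have m: "0 < m" using k Gn by (simp add: m_def)
  show ?thesis
  proof (rule that[of "m / 2"])
    show "0 < m / 2" using m by simp
    fix d C
    assume d: "1 \<le> d" and FPI: "fractional_poincare d \<alpha> (cauchy_density d \<nu>) C"
    note [measurable] = measurable_coord0[OF d]
    let ?\<pi> = "cauchy_density d \<nu>"
    let ?M = "density (leb d) (\<lambda>x. ennreal (?\<pi> x))"
    have C: "0 < C" using FPI by (simp add: fractional_poincare_def)
    interpret P: prob_space ?M
      by (rule prob_spaceI) (simp add: emeasure_density nn_integral_cauchy_density[OF \<nu>] cong: nn_integral_cong_simp)
    have is2: "integrable ?M (\<lambda>x. (sin (x 0))\<^sup>2)" by (rule P.integrable_const_bound[where B = 1]) (auto simp: abs_square_le_1)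
    have en: "frac_energy d \<alpha> ?\<pi> (\<lambda>x. sin (x 0)) \<le> 2"
      by (rule energy_sin_le[OF d \<alpha> _ nn_integral_cauchy_density[OF \<nu>]]) measurable
    then have "frac_energy d \<alpha> ?\<pi> (\<lambda>x. sin (x 0)) < \<infinity>" by (rule le_less_trans) simp
    then have dom: "(\<lambda>x. sin (x 0)) \<in> frac_domain d \<alpha> ?\<pi>" unfolding frac_domain_def using is2 by simp
    \<comment> \<open>Reflection symmetry of the target centres the sine, so its variance equals the
      second moment computed in \<open>sin_sq_cauchy\<close>.\<close>
    have E0: "(\<integral>x. sin (x 0) \<partial>?M) = 0"
    proof -
      have sym: "?\<pi> (affine_map d (\<lambda>_. 0) (-1) x) = ?\<pi> x" for x
      proof -
        have "enorm d (affine_map d (\<lambda>_. 0) (-1) x) = enorm d (\<lambda>i. - x i)" by (rule enorm_cong) (simp add: affine_map_def)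
        also have "\<dots> = enorm d x" by (simp add: enorm_def L2_set_def)
        finally show ?thesis by (simp add: cauchy_density_eq[OF \<nu>])
      qed
      have s0: "affine_map d (\<lambda>_. 0) (-1) x 0 = - x 0" for x using d by (simp add: affine_map_def)
      have "(\<integral>x. sin (x 0) \<partial>?M) = (\<integral>x. ?\<pi> x * sin (x 0) \<partial>leb d)"
        using cauchy_density_pos[OF \<nu>] by (subst integral_real_density) (auto simp: less_imp_le)
      also have "\<dots> = \<bar>-1\<bar> ^ d * (\<integral>x. ?\<pi> (affine_map d (\<lambda>_. 0) (-1) x) * sin (affine_map d (\<lambda>_. 0) (-1) x 0) \<partial>leb d)"
        by (rule integral_affine) auto
      also have "\<dots> = - (\<integral>x. ?\<pi> x * sin (x 0) \<partial>leb d)" unfolding sym s0 by simp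
      also have "(\<integral>x. ?\<pi> x * sin (x 0) \<partial>leb d) = (\<integral>x. sin (x 0) \<partial>?M)"
        using cauchy_density_pos[OF \<nu>] by (subst integral_real_density) (auto simp: less_imp_le)
      finally show ?thesis by simp
    qed
    have "P.variance (\<lambda>x. sin (x 0)) = (\<integral>x. (sin (x 0))\<^sup>2 \<partial>?M)" by (simp add: E0)
    also have "\<dots> = m"
    proof -
      have "ennreal (\<integral>x. (sin (x 0))\<^sup>2 \<partial>?M) = (\<integral>\<^sup>+x. ennreal ((sin (x 0))\<^sup>2) \<partial>?M)"
        using is2 by (intro nn_integral_eq_integral[symmetric]) auto
      also have "\<dots> = (\<integral>\<^sup>+x. ennreal (?\<pi> x) * ennreal ((sin (x 0))\<^sup>2) \<partial>leb d)"
        by (rule nn_integral_density) measurable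
      also have "\<dots> = sin_mass \<nu> * ennreal (1 / Gamma (\<nu> / 2))"
        using sin_sq_cauchy[OF d \<nu>] by (simp add: mult.commute)
      also have "\<dots> = ennreal m" unfolding ks[symmetric] m_def using k Gn by (subst ennreal_mult[symmetric]) auto
      finally show ?thesis using m by (subst (asm) ennreal_inj) (auto intro!: Bochner_Integration.integral_nonneg)
    qed
    finally have "ennreal m \<le> ennreal C * frac_energy d \<alpha> ?\<pi> (\<lambda>x. sin (x 0))"
      using FPI dom unfolding fractional_poincare_def by metis
    also have "\<dots> \<le> ennreal C * 2" by (rule mult_left_mono[OF en]) simp
    also have "\<dots> = ennreal (C * 2)" using C by (subst ennreal_mult) auto
    finally show "m / 2 \<le> C" using C by (subst (asm) ennreal_le_iff) auto
  qed
qed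

text \<open>The hidden constant \<open>K\<close> is chosen before \<open>d\<close>,
  \<open>\<eta>\<close>, \<open>\<epsilon>\<close> and \<open>C\<close>, so it may depend only on
  \<open>\<nu>\<close>, \<open>\<alpha>\<close> and \<open>r\<close>. The threshold
  \<open>r > 1\<close> makes the asymptotic regime explicit: as \<open>d / \<epsilon>\<close>
  approaches \<open>1\<close> the logarithm vanishes, while the initial divergence need not be below
  \<open>\<epsilon>\<close>. \<open>C\<close> ranges over all admissible Poincare parameters, and
  accuracy is asserted for every iterate from \<open>N\<close> on.\<close>

theorem corollary3p2:
  fixes \<nu> \<alpha> :: real
  assumes "0 < \<nu>" and "0 < \<alpha>" and "\<alpha> < 2" and "\<alpha> \<le> \<nu>"
  shows "\<forall>r>1. \<exists>K>0. \<forall>(d::nat)\<ge>1. \<forall>(\<eta>::real) (\<epsilon>::real) (C::real).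
           0 < \<eta> \<longrightarrow> \<eta> < 1 \<longrightarrow> 0 < \<epsilon> \<longrightarrow> r \<le> real d / \<epsilon> \<longrightarrow>
           fractional_poincare d \<alpha> (cauchy_density d \<nu>) C \<longrightarrow>
           (\<exists>N. real N \<le> K * (C * (1 / \<eta>) * ln (real d / \<epsilon>)) \<and>
                (\<forall>k\<ge>N. chi_square_accurate (leb d) \<epsilon>
                   (sampler_law d \<alpha> \<eta> (cauchy_density d \<nu>)
                      (density (leb d) (\<lambda>x. ennreal (gaussian_density d x))) k)
                   (cauchy_density d \<nu>)))"
proof (intro allI impI)
  fix r :: real assume r: "1 < r"
  obtain c where c: "0 < c" "\<And>d C. 1 \<le> d \<Longrightarrow> fractional_poincare d \<alpha> (cauchy_density d \<nu>) C \<Longrightarrow> c \<le> C"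
    by (rule fractional_poincare_lower_bound[OF assms(1-3)]) blast
  define K1 where "K1 = Gamma (\<nu> / 2) * exp (1 / 2) * 2 powr (\<nu> / 2) * ((1 + \<nu>) / 2)"
  have K1: "0 < K1" using assms(1) Gamma_real_pos[of "\<nu> / 2"] by (simp add: K1_def)
  have lr: "0 < ln r" using r by simp
  \<comment> \<open>Since \<open>l = ln (d / \<epsilon>)\<close> is at least \<open>ln r\<close>,
    the fixed quantity \<open>ln K1\<close> is absorbed:
    \<open>ln K1 + l \<le> A * l\<close>.\<close>
  define A where "A = 1 + \<bar>ln K1\<bar> / ln r"
  have A: "0 < A" using lr by (simp add: A_def add_pos_nonneg)
  \<comment> \<open>One summand for each term of \<open>(C / \<eta> + 1) * (A * l) + 1\<close>, an
    upper bound for the step count: the main term, the \<open>1\<close> next to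
    \<open>C / \<eta>\<close> (absorbed through \<open>c \<le> C\<close> and
    \<open>\<eta> < 1\<close>), and the rounding (absorbed also through
    \<open>ln r \<le> l\<close>).\<close>
  define K where "K = A + A / c + 1 / (c * ln r)"
  have K: "0 < K" using A c lr by (simp add: K_def add_pos_pos)
  show "\<exists>K>0. \<forall>(d::nat)\<ge>1. \<forall>(\<eta>::real) (\<epsilon>::real) (C::real).
           0 < \<eta> \<longrightarrow> \<eta> < 1 \<longrightarrow> 0 < \<epsilon> \<longrightarrow> r \<le> real d / \<epsilon> \<longrightarrow>
           fractional_poincare d \<alpha> (cauchy_density d \<nu>) C \<longrightarrow>
           (\<exists>N. real N \<le> K * (C * (1 / \<eta>) * ln (real d / \<epsilon>)) \<and>
                (\<forall>k\<ge>N. chi_square_accurate (leb d) \<epsilon>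
                   (sampler_law d \<alpha> \<eta> (cauchy_density d \<nu>)
                      (density (leb d) (\<lambda>x. ennreal (gaussian_density d x))) k)
                   (cauchy_density d \<nu>)))"
  proof (intro exI[of _ K] conjI allI impI K)
    fix d :: nat and \<eta> \<epsilon> C :: real
    assume d: "1 \<le> d" and eta: "0 < \<eta>" "\<eta> < 1" and \<epsilon>: "0 < \<epsilon>" and re: "r \<le> real d / \<epsilon>"
      and FPI: "fractional_poincare d \<alpha> (cauchy_density d \<nu>) C"
    let ?\<pi> = "cauchy_density d \<nu>"
    interpret proximal d \<alpha> ?\<pi> \<eta> C
      by unfold_locales (use d assms eta FPI cauchy_density_pos nn_integral_cauchy_density in auto)
    have cC: "c \<le> C" by (rule c(2)[OF d FPI])
    define l where "l = ln (real d / \<epsilon>)"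
    have l: "ln r \<le> l" unfolding l_def using re r by (intro ln_mono) auto
    then have l0: "0 < l" using lr by simp
    define N where "N = nat \<lceil>(C / \<eta> + 1) * (A * l)\<rceil>"
    have N_ge: "(C / \<eta> + 1) * (A * l) \<le> real N" unfolding N_def by (rule real_nat_ceiling_ge)
    have N_le: "real N \<le> (C / \<eta> + 1) * (A * l) + 1"
    proof -
      have "0 \<le> (C / \<eta> + 1) * (A * l)" using C_pos eta A l0 by simp
      then have "- 1 < (C / \<eta> + 1) * (A * l)" by (rule less_le_trans[rotated]) simp
      then have "0 \<le> \<lceil>(C / \<eta> + 1) * (A * l)\<rceil>" by (simp only: zero_le_ceiling)
      then have "real N = of_int \<lceil>(C / \<eta> + 1) * (A * l)\<rceil>" unfolding N_def by (rule of_nat_nat)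
      then show ?thesis using of_int_ceiling_le_add_one[of "(C / \<eta> + 1) * (A * l)"] by simp
    qed
    have "real N \<le> K * (C * (1 / \<eta>) * l)"
    proof -
      have "c * \<eta> \<le> C * 1" using cC c eta by (intro mult_mono) auto
      then have 1: "1 \<le> C / \<eta> / c" using c eta by (simp add: field_simps)
      have 2: "1 \<le> l / ln r" using l lr by simp
      have 3: "1 * (A * l) \<le> (C / \<eta> / c) * (A * l)" using 1 A l0 by (intro mult_right_mono) auto
      have 4: "1 * 1 \<le> (C / \<eta> / c) * (l / ln r)" using 1 2 by (intro mult_mono) auto
      define X where "X = C * (1 / \<eta>) * l"
      have "K * X = A * X + A / c * X + 1 / (c * ln r) * X" unfolding K_def by (simp only: distrib_right)
      moreover have "A * X = C / \<eta> * (A * l)" "A / c * X = (C / \<eta> / c) * (A * l)" "1 / (c * ln r) * X = (C / \<eta> / c) * (l / ln r)"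
        by (simp_all add: X_def mult_ac)
      ultimately have "K * (C * (1 / \<eta>) * l) = C / \<eta> * (A * l) + (C / \<eta> / c) * (A * l) + (C / \<eta> / c) * (l / ln r)"
        by (simp only: X_def)
      then show ?thesis using N_le 3 4 by (simp add: distrib_right)
    qed
    moreover have "chi_square_accurate (leb d) \<epsilon> (sampler_law d \<alpha> \<eta> ?\<pi> (density (leb d) (\<lambda>x. ennreal (gaussian_density d x))) k) ?\<pi>"
      if k: "N \<le> k" for k
    proof -
      define h0 where "h0 x = ennreal (gaussian_density d x / ?\<pi> x)" for x
      have h0m: "h0 \<in> borel_measurable (leb d)" unfolding h0_def by measurable
      have h0\<pi>: "h0 x * ennreal (?\<pi> x) = ennreal (gaussian_density d x)" for x
        unfolding h0_def using cauchy_density_pos[OF assms(1), of d x] gaussian_density_pos[of d x]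
        by (subst ennreal_mult[symmetric]) auto
      have h02: "(h0 x)\<^sup>2 * ennreal (?\<pi> x) = ennreal ((gaussian_density d x)\<^sup>2 / ?\<pi> x)" for x
        unfolding h0_def using cauchy_density_pos[OF assms(1), of d x] gaussian_density_pos[of d x]
        by (subst ennreal_power, simp, subst ennreal_mult[symmetric]) (auto simp: power2_eq_square)
      have X0: "(\<integral>\<^sup>+x. (h0 x)\<^sup>2 * ennreal (?\<pi> x) \<partial>leb d) \<le> ennreal (1 + K1 * real d)"
        unfolding h02 using initial_chi_square[OF assms(1) d] unfolding K1_def[symmetric]
        by (rule order_trans) (simp add: ennreal_leI)
      have m0: "(\<integral>\<^sup>+x. h0 x * ennreal (?\<pi> x) \<partial>leb d) = 1" unfolding h0\<pi> by (rule nn_integral_gaussian_density)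
      define q where "q = 1 + \<eta> / C"
      have q: "1 < q" using eta C_pos by (simp add: q_def)
      obtain h where h: "h \<in> borel_measurable (leb d)"
        "sampler_law d \<alpha> \<eta> ?\<pi> (density (leb d) (\<lambda>x. h0 x * ennreal (?\<pi> x))) k = density (leb d) (\<lambda>x. h x * ennreal (?\<pi> x))"
        "(\<integral>\<^sup>+x. h x * ennreal (?\<pi> x) \<partial>leb d) = 1"
        "(\<integral>\<^sup>+x. (h x)\<^sup>2 * ennreal (?\<pi> x) \<partial>leb d) \<le> ennreal (1 + K1 * real d / q ^ k)"
        using sampler_density[OF h0m m0 X0, of k] K1 unfolding q_def by auto
      have "K1 * real d / q ^ k \<le> \<epsilon>"
      proof -
        \<comment> \<open>This is \<open>1 - s \<le> exp (- s)\<close> at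
          \<open>s = \<eta> / (C + \<eta>)\<close>, where \<open>1 - s = 1 / q\<close>. Each step
          thus gains \<open>s\<close> in the logarithm, which explains the factor
          \<open>C / \<eta> + 1 = 1 / s\<close> in \<open>N\<close>.\<close>
        have "exp (\<eta> / (C + \<eta>)) \<le> q"
        proof -
          have "1 - \<eta> / (C + \<eta>) \<le> exp (- (\<eta> / (C + \<eta>)))" using exp_ge_add_one_self[of "- (\<eta> / (C + \<eta>))"] by simp
          moreover have "1 - \<eta> / (C + \<eta>) = 1 / q" using C_pos eta by (simp add: q_def field_simps)
          ultimately have "1 / q \<le> 1 / exp (\<eta> / (C + \<eta>))" by (simp add: exp_minus divide_inverse)
          then show ?thesis using q by (simp add: field_simps)
        qed
        then have "exp (\<eta> / (C + \<eta>)) ^ k \<le> q ^ k" by (intro power_mono) auto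
        then have qk: "exp (real k * (\<eta> / (C + \<eta>))) \<le> q ^ k" by (simp only: exp_of_nat_mult)
        have "C / \<eta> + 1 = (C + \<eta>) / \<eta>" using eta by (simp add: add_divide_distrib)
        then have "(C / \<eta> + 1) * (\<eta> / (C + \<eta>)) = 1" using C_pos eta by simp
        moreover have "(C / \<eta> + 1) * (A * l) * (\<eta> / (C + \<eta>)) = ((C / \<eta> + 1) * (\<eta> / (C + \<eta>))) * (A * l)" by (simp only: mult_ac)
        ultimately have "A * l = (C / \<eta> + 1) * (A * l) * (\<eta> / (C + \<eta>))" by (simp only: mult_1)
        also have "\<dots> \<le> real k * (\<eta> / (C + \<eta>))" using N_ge k C_pos eta by (intro mult_right_mono) auto
        finally have Al: "A * l \<le> real k * (\<eta> / (C + \<eta>))" .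
        have "ln K1 + l \<le> A * l"
        proof -
          have "ln K1 \<le> \<bar>ln K1\<bar> / ln r * ln r" using lr by simp
          also have "\<dots> \<le> \<bar>ln K1\<bar> / ln r * l" using l lr by (intro mult_left_mono) auto
          finally show ?thesis by (simp add: A_def distrib_right)
        qed
        then have "exp (ln K1 + l) \<le> exp (real k * (\<eta> / (C + \<eta>)))" using Al by simp
        also have "exp (ln K1 + l) = K1 * (real d / \<epsilon>)" using K1 d \<epsilon> by (simp add: exp_add l_def)
        also note qk
        finally show ?thesis using q \<epsilon> by (simp add: field_simps)
      qed
      then have "ennreal (1 + K1 * real d / q ^ k) \<le> ennreal (1 + \<epsilon>)" by (intro ennreal_leI) simp
      with h(4) have "(\<integral>\<^sup>+x. (h x)\<^sup>2 * ennreal (?\<pi> x) \<partial>leb d) \<le> ennreal (1 + \<epsilon>)" by (rule order_trans)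
      from chi_square_density[OF h(1,3) this] \<epsilon> show ?thesis using h(2) unfolding h0\<pi> by simp
    qed
    ultimately show "\<exists>N. real N \<le> K * (C * (1 / \<eta>) * ln (real d / \<epsilon>)) \<and>
                (\<forall>k\<ge>N. chi_square_accurate (leb d) \<epsilon>
                   (sampler_law d \<alpha> \<eta> ?\<pi>
                      (density (leb d) (\<lambda>x. ennreal (gaussian_density d x))) k) ?\<pi>)"
      unfolding l_def by blast
  qed
qed

end
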